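(* Let $\alpha>0$, $\lambda>0$, $\varepsilon>0$, $N$ a positive integer and $\kappa\in\mathbb R$. Assume there exists a power spectral density $\bar\Phi$ (an integrable function on $\mathbb T$ with values in the $m\times m$ Hermitian positive semidefinite matrices) which is positive definite on some open interval of $\mathbb T$ and satisfies $\int_{\mathbb T}\bar\Phi e^{i\theta k}=R_k$ for $k=0,\dots,n$. Then the problem $$\min_{(\mathbf p,\mathbf Q,\bm\gamma)\in\mathcal C}\ \tilde\ell(\mathbf p,\mathbf Q,\alpha,\bm\gamma),\qquad \mathcal C=\{(\mathbf p,\mathbf Q,\bm\gamma):\ \mathbf p\in\overline{\mathfrak B_+^o},\ \mathbf Q\in\overline{\mathfrak B_+^m},\ \gamma_{jh}>0\ \text{for all } j\ge h\},$$ admits a solution, and every such solution satisfies $(\mathbf p,\mathbf Q)\in\mathfrak B_+^o\times\mathfrak B_+^m$.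
   Context: Let $m,n$ be positive integers and $V=\{1,\dots,m\}$. Let $\mathbb T=[0,2\pi)$ and write $\int_{\mathbb T}f$ for $\int_0^{2\pi}f(\theta)\,\frac{d\theta}{2\pi}$. $\mathfrak B_+^m$ is the set of matrix trigonometric polynomials $\mathbf Q(e^{i\theta})=Q_0+\frac12\sum_{k=1}^n\big(Q_ke^{-i\theta k}+Q_k^Te^{i\theta k}\big)$ with $Q_0\in\mathbb R^{m\times m}$ symmetric, $Q_1,\dots,Q_n\in\mathbb R^{m\times m}$ arbitrary, and $\mathbf Q(e^{i\theta})$ positive definite for every $\theta\in\mathbb T$. $\overline{\mathfrak B_+^m}$ denotes the closure of $\mathfrak B_+^m$ (in the finite-dimensional coefficient space) from which the points $\mathbf Q$ with $\det\mathbf Q(e^{i\theta})=0$ for all $\theta\in\mathbb T$ are removed. $\mathfrak B_+^o$ is the set of scalar trigonometric polynomials $\mathbf p(e^{i\theta})=1+\frac12\sum_{k=1}^n p_k(e^{-i\theta k}+e^{i\theta k})$, $p_k\in\mathbb R$, with $\mathbf p(e^{i\theta})>0$ for all $\theta$; $\overline{\mathfrak B_+^o}$ is its closure. Set $p_0=1$. Data: real $m\times m$ matrices $R_0,\dots,R_n$ ($R_0$ symmetric) and real numbers $c_0,\dots,c_n$. Define (values in $\mathbb R\cup\{+\infty\}$) $$J(\mathbf p,\mathbf Q)=\int_{\mathbb T}\Big(\mathbf p\log\det(\mathbf p\mathbf Q^{-1})-m\mathbf p\Big)+\sum_{k=0}^n\mathrm{tr}(Q_k^TR_k)-\sum_{k=0}^np_kc_k,$$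 $g_\lambda(\mathbf p)=\lambda\int_{\mathbb T}\mathbf p^{-1}$. The hyperparameter vector $\bm\gamma$ has entries $\gamma_{jh}$, $1\le h\le j\le m$. Let $q_{jh}(\mathbf Q)=\max\{|[Q_0]_{jh}|,\max_{k=1,\dots,n}|[Q_k]_{jh}|,\max_{k=1,\dots,n}|[Q_k]_{hj}|\}$ and $h_W(\mathbf Q)=\sum_{j\ge h}\gamma_{jh}q_{jh}(\mathbf Q)$. Define $$\tilde\ell(\mathbf p,\mathbf Q,\alpha,\bm\gamma)=\frac{N}{2\alpha}J(\mathbf p,\mathbf Q)+\kappa+g_\lambda(\mathbf p)+h_W(\mathbf Q)-\sum_{j>h}(2n+1)\log\gamma_{jh}-\sum_{j=1}^m(n+1)\log\gamma_{jj}+\sum_{j\ge h}\varepsilon\gamma_{jh}.$$ *)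

theory Defs
  imports "HOL-Analysis.Analysis"
begin

text \<open>Index type 'm (finite, linearly ordered) plays the role of V = {1..m}; m = CARD('m).
  Coefficient sequences are indexed by nat; only indices 0..n are meaningful and
  the classes below require vanishing coefficients beyond n.\<close>

text \<open>Normalised integral over T = [0,2pi) of a real function which is bounded below:
  value in R \<union> {+\<infinity>} (non-integrable means +\<infinity>).\<close>
definition T_int :: "(real \<Rightarrow> real) \<Rightarrow> ereal" where
  "T_int f = (if set_integrable lborel {0..<2*pi} f
              then ereal ((LINT \<theta>:{0..<2*pi}|lborel. f \<theta>) / (2*pi)) else \<infinity>)"

definition hermitian :: "complex^'m^'m \<Rightarrow> bool" where
  "hermitian A \<longleftrightarrow> (\<forall>i j. A $ i $ j = cnj (A $ j $ i))"

definition cquad :: "complex^'m^'m \<Rightarrow> complex^'m \<Rightarrow> complex" where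
  "cquad A v = (\<Sum>i\<in>UNIV. \<Sum>j\<in>UNIV. cnj (v $ i) * A $ i $ j * v $ j)"

definition herm_pd :: "complex^'m^'m \<Rightarrow> bool" where
  "herm_pd A \<longleftrightarrow> hermitian A \<and> (\<forall>v. v \<noteq> 0 \<longrightarrow> Re (cquad A v) > 0)"

definition herm_psd :: "complex^'m^'m \<Rightarrow> bool" where
  "herm_psd A \<longleftrightarrow> hermitian A \<and> (\<forall>v. Re (cquad A v) \<ge> 0)"

definition Qpoly :: "nat \<Rightarrow> (nat \<Rightarrow> real^'m^'m) \<Rightarrow> real \<Rightarrow> complex^'m^'m" where
  "Qpoly n Q \<theta> = (\<chi> i j. complex_of_real (Q 0 $ i $ j) +
      (1/2) * (\<Sum>k=1..n. complex_of_real (Q k $ i $ j) * cis (- \<theta> * real k)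
                       + complex_of_real (Q k $ j $ i) * cis (\<theta> * real k)))"

text \<open>The scalar trigonometric polynomial p(e^{i theta}) (p 0 = 1 is enforced by the class).\<close>
definition ppoly :: "nat \<Rightarrow> (nat \<Rightarrow> real) \<Rightarrow> real \<Rightarrow> real" where
  "ppoly n p \<theta> = p 0 + (1/2) * (\<Sum>k=1..n. p k * 2 * cos (\<theta> * real k))"

definition Bm :: "nat \<Rightarrow> (nat \<Rightarrow> real^'m^'m) \<Rightarrow> bool" where
  "Bm n Q \<longleftrightarrow> transpose (Q 0) = Q 0 \<and> (\<forall>k>n. Q k = 0) \<and>
     (\<forall>\<theta>\<in>{0..<2*pi}. herm_pd (Qpoly n Q \<theta>))"

definition Bm_cl :: "nat \<Rightarrow> (nat \<Rightarrow> real^'m^'m) \<Rightarrow> bool" where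
  "Bm_cl n Q \<longleftrightarrow> (\<exists>s. (\<forall>j. Bm n (s j)) \<and> (\<forall>k. (\<lambda>j. s j k) \<longlonglongrightarrow> Q k))
      \<and> \<not> (\<forall>\<theta>\<in>{0..<2*pi}. det (Qpoly n Q \<theta>) = 0)"

definition Bo :: "nat \<Rightarrow> (nat \<Rightarrow> real) \<Rightarrow> bool" where
  "Bo n p \<longleftrightarrow> p 0 = 1 \<and> (\<forall>k>n. p k = 0) \<and> (\<forall>\<theta>\<in>{0..<2*pi}. ppoly n p \<theta> > 0)"

definition Bo_cl :: "nat \<Rightarrow> (nat \<Rightarrow> real) \<Rightarrow> bool" where
  "Bo_cl n p \<longleftrightarrow> (\<exists>s. (\<forall>j. Bo n (s j)) \<and> (\<forall>k. (\<lambda>j. s j k) \<longlonglongrightarrow> p k))"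

definition Jfun :: "nat \<Rightarrow> (nat \<Rightarrow> real^'m^'m) \<Rightarrow> (nat \<Rightarrow> real)
      \<Rightarrow> (nat \<Rightarrow> real) \<Rightarrow> (nat \<Rightarrow> real^'m^'m) \<Rightarrow> ereal" where
  "Jfun n R c p Q =
     T_int (\<lambda>\<theta>. ppoly n p \<theta> *
              ln (Re (det (\<chi> i j. complex_of_real (ppoly n p \<theta>) * matrix_inv (Qpoly n Q \<theta>) $ i $ j)))
            - real CARD('m) * ppoly n p \<theta>)
     + ereal ((\<Sum>k=0..n. trace (transpose (Q k) ** R k)) - (\<Sum>k=0..n. p k * c k))"

definition g_lam :: "real \<Rightarrow> nat \<Rightarrow> (nat \<Rightarrow> real) \<Rightarrow> ereal" where
  "g_lam lam n p = ereal lam * T_int (\<lambda>\<theta>. inverse (ppoly n p \<theta>))"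

definition qjh :: "nat \<Rightarrow> (nat \<Rightarrow> real^'m^'m) \<Rightarrow> 'm \<Rightarrow> 'm \<Rightarrow> real" where
  "qjh n Q j h = Max ({\<bar>Q 0 $ j $ h\<bar>} \<union> {\<bar>Q k $ j $ h\<bar> | k. k \<in> {1..n}}
                                      \<union> {\<bar>Q k $ h $ j\<bar> | k. k \<in> {1..n}})"

definition hW :: "nat \<Rightarrow> ('m::{finite,linorder} \<Rightarrow> 'm \<Rightarrow> real) \<Rightarrow> (nat \<Rightarrow> real^('m::{finite,linorder})^('m::{finite,linorder})) \<Rightarrow> real" where
  "hW n \<gamma> Q = (\<Sum>(j,h)\<in>{(j,h). h \<le> j}. \<gamma> j h * qjh n Q j h)"

definition ell :: "nat \<Rightarrow> real \<Rightarrow> real \<Rightarrow> real \<Rightarrow> nat \<Rightarrow> (nat \<Rightarrow> real^('m::{finite,linorder})^('m::{finite,linorder}))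
      \<Rightarrow> (nat \<Rightarrow> real) \<Rightarrow> (nat \<Rightarrow> real) \<Rightarrow> (nat \<Rightarrow> real^('m::{finite,linorder})^('m::{finite,linorder})) \<Rightarrow> real
      \<Rightarrow> ('m::{finite,linorder} \<Rightarrow> 'm \<Rightarrow> real) \<Rightarrow> ereal" where
  "ell N \<kappa> lam \<epsilon> n R c p Q \<alpha> \<gamma> =
     ereal (real N / (2*\<alpha>)) * Jfun n R c p Q + ereal \<kappa> + g_lam lam n p
     + ereal (hW n \<gamma> Q
              - (\<Sum>(j,h)\<in>{(j,h). h < j}. real (2*n+1) * ln (\<gamma> j h))
              - (\<Sum>j\<in>UNIV. real (n+1) * ln (\<gamma> j j))
              + (\<Sum>(j,h)\<in>{(j,h). h \<le> j}. \<epsilon> * \<gamma> j h))"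

definition feasible :: "nat \<Rightarrow> (nat \<Rightarrow> real) \<Rightarrow> (nat \<Rightarrow> real^('m::{finite,linorder})^('m::{finite,linorder}))
      \<Rightarrow> ('m::{finite,linorder} \<Rightarrow> 'm \<Rightarrow> real) \<Rightarrow> bool" where
  "feasible n p Q \<gamma> \<longleftrightarrow> Bo_cl n p \<and> Bm_cl n Q \<and> (\<forall>j h. h \<le> j \<longrightarrow> \<gamma> j h > 0)"

end

theory Submission
  imports Defs "HOL-Computational_Algebra.Polynomial"
begin

text \<open>Existence is the direct method. Writing the linear term as the integral of the trace of
  \<open>Q \<Phi>\<close>, it dominates a positive multiple of the size of \<open>Q\<close> on positive semidefinite polynomials,
  because \<open>\<Phi>\<close> is definite on an interval and a nonzero trigonometric polynomial has finitely many
  zeros; this beats the logarithmic decrease of the entropy integral. The coefficients of \<open>p\<close> are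
  bounded by positivity and \<open>p 0 = 1\<close>, and \<open>\<gamma> (q + \<epsilon>) - d ln \<gamma>\<close> confines \<open>\<gamma>\<close> to a compact
  subset of the positive half-line. Hence a minimizing sequence has a convergent subsequence; by
  Fatou's lemma the objective does not increase in the limit, and a limit \<open>Q\<close> with identically
  vanishing determinant would force the entropy integral to infinity.

  For interiority, a zero of \<open>p\<close> makes the integral of \<open>1 / p\<close> diverge, since \<open>p\<close> is Lipschitz. If
  \<open>Q\<close> is singular at a point, with null vector \<open>v\<close> and \<open>v\<^sub>i \<noteq> 0\<close>, then adding \<open>t e\<^sub>i e\<^sub>i\<^sup>T\<close> to \<open>Q 0\<close> multiplies
  the determinant by at least \<open>1 + t |v\<^sub>i|\<^sup>2 / (v\<^sup>* Q v)\<close> with \<open>v\<^sup>* Q v\<close> vanishing at that point, so the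
  directional derivative of the objective is minus infinity.\<close>

section \<open>Trigonometric polynomials\<close>

text \<open>Both integrals take values in the reals extended by +\<infinity>, and their integrands
  have no integrable majorant that is uniform along a minimizing sequence. Only lower bounds are at
  hand, and the one for the entropy worsens with the size of \<open>Q\<close>, though merely
  logarithmically, because a determinant is polynomial in the coefficients. Hence the values of the
  two integrals are carried along as extra real coordinates of the sequence: on a subsequence they
  converge, the limit of the objective is then an explicit real expression in their limits, and
  Fatou only has to compare the integrals at the limit point with those numbers. Interiority has to
  be proved for \<open>p\<close> first: the gain in the log-determinant is weighted by
  \<open>p\<close> and could be lost at a common zero of \<open>p\<close> and of the quadratic form
  of \<open>Q\<close>. No derivative is taken under the integral sign. A finite step t is compared
  with its cost: the gain is at least of order t ln (1/t), the cost at most a multiple of t. Both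
  interiority arguments rest on one explicit integral, that of c / (x - t0 + s) over an interval to
  the right of a zero.\<close>

definition trigpoly :: "(real \<Rightarrow> complex) \<Rightarrow> bool" where
  "trigpoly f \<longleftrightarrow> (\<exists>N P. \<forall>\<theta>. f \<theta> = cis (- (\<theta> * real N)) * poly P (cis \<theta>))"

lemma trigpolyI: "(\<And>\<theta>. f \<theta> = cis (- (\<theta> * real N)) * poly P (cis \<theta>)) \<Longrightarrow> trigpoly f"
  unfolding trigpoly_def by blast

lemma trigpoly_const [intro]: "trigpoly (\<lambda>_. c)"
  by (rule trigpolyI[of _ 0 "[:c:]"]) simp

lemma cis_times_nat: "cis (\<theta> * real k) = cis \<theta> ^ k"
  using Complex.DeMoivre[of \<theta> k] by (simp add: mult.commute)

lemma cis_neg_times_cis_power: "cis (- (\<theta> * real k)) * cis \<theta> ^ k = 1"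
  by (simp add: cis_times_nat[symmetric] cis_mult)

lemma trigpoly_cis_pos [intro]: "trigpoly (\<lambda>\<theta>. cis (\<theta> * real k))"
  by (rule trigpolyI[of _ 0 "monom 1 k"]) (simp add: poly_monom cis_times_nat)

lemma trigpoly_cis_neg [intro]: "trigpoly (\<lambda>\<theta>. cis (- \<theta> * real k))"
  by (rule trigpolyI[of _ k "[:1:]"]) simp

lemma trigpoly_add [intro]:
  assumes "trigpoly f" "trigpoly g" shows "trigpoly (\<lambda>\<theta>. f \<theta> + g \<theta>)"
proof -
  obtain N P where f: "\<And>\<theta>. f \<theta> = cis (- (\<theta> * real N)) * poly P (cis \<theta>)"
    using assms(1) unfolding trigpoly_def by blast
  obtain M S where g: "\<And>\<theta>. g \<theta> = cis (- (\<theta> * real M)) * poly S (cis \<theta>)"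
    using assms(2) unfolding trigpoly_def by blast
  show ?thesis
  \<comment> \<open>Common shift \<open>N + M\<close>: each numerator is multiplied by the power of
    \<open>cis \<theta>\<close> that its own shift lacks.\<close>
  proof (rule trigpolyI[of _ "N + M" "monom 1 M * P + monom 1 N * S"])
    fix \<theta>
    have s: "cis (- (\<theta> * real (N + M))) = cis (- (\<theta> * real N)) * cis (- (\<theta> * real M))"
      by (simp add: cis_mult algebra_simps)
    have "cis (- (\<theta> * real (N + M))) * poly (monom 1 M * P + monom 1 N * S) (cis \<theta>)
      = cis (- (\<theta> * real N)) * poly P (cis \<theta>) * (cis (- (\<theta> * real M)) * cis \<theta> ^ M)
      + cis (- (\<theta> * real M)) * poly S (cis \<theta>) * (cis (- (\<theta> * real N)) * cis \<theta> ^ N)"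
      unfolding s by (simp add: poly_monom algebra_simps)
    then show "f \<theta> + g \<theta> = cis (- (\<theta> * real (N + M))) * poly (monom 1 M * P + monom 1 N * S) (cis \<theta>)"
      by (simp add: f g cis_neg_times_cis_power)
  qed
qed

lemma trigpoly_mult [intro]:
  assumes "trigpoly f" "trigpoly g" shows "trigpoly (\<lambda>\<theta>. f \<theta> * g \<theta>)"
proof -
  obtain N P where f: "\<And>\<theta>. f \<theta> = cis (- (\<theta> * real N)) * poly P (cis \<theta>)"
    using assms(1) unfolding trigpoly_def by blast
  obtain M S where g: "\<And>\<theta>. g \<theta> = cis (- (\<theta> * real M)) * poly S (cis \<theta>)"
    using assms(2) unfolding trigpoly_def by blast
  show ?thesis
  proof (rule trigpolyI[of _ "N + M" "P * S"])
    fix \<theta>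
    have "cis (- (\<theta> * real (N + M))) = cis (- (\<theta> * real N)) * cis (- (\<theta> * real M))"
      by (simp add: cis_mult algebra_simps)
    then show "f \<theta> * g \<theta> = cis (- (\<theta> * real (N + M))) * poly (P * S) (cis \<theta>)"
      by (simp add: f g)
  qed
qed

lemma trigpoly_sum [intro]:
  "(\<And>i. i \<in> I \<Longrightarrow> trigpoly (f i)) \<Longrightarrow> trigpoly (\<lambda>\<theta>. \<Sum>i\<in>I. f i \<theta>)"
  by (induction I rule: infinite_finite_induct) auto

lemma trigpoly_prod [intro]:
  "(\<And>i. i \<in> I \<Longrightarrow> trigpoly (f i)) \<Longrightarrow> trigpoly (\<lambda>\<theta>. \<Prod>i\<in>I. f i \<theta>)"
  by (induction I rule: infinite_finite_induct) auto

lemma trigpoly_det: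
  assumes "\<And>i j. trigpoly (\<lambda>\<theta>. A \<theta> $ i $ j)"
  shows "trigpoly (\<lambda>\<theta>. det (A \<theta>))"
  unfolding det_def by (intro trigpoly_sum trigpoly_mult trigpoly_prod trigpoly_const assms)

lemma inj_on_cis: "inj_on cis {0..<2*pi}"
proof (rule inj_onI)
  fix x y assume xy: "x \<in> {0..<2*pi}" "y \<in> {0..<2*pi}" and "cis x = cis y"
  then have "sin x = sin y \<and> cos x = cos y" by (simp add: complex_eq_iff)
  then obtain k :: int where k: "x = y + 2 * pi * k"
    using sin_cos_eq_iff[of x y] by auto
  moreover have "0 \<le> x" "x < 2 * pi" "0 \<le> y" "y < 2 * pi" using xy by auto
  ultimately have "2 * pi * k < 2 * pi * 1" "2 * pi * (-1) < 2 * pi * k" by linarith+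
  then have "real_of_int k < 1" "-1 < real_of_int k"
    using mult_less_cancel_left_pos[of "2 * pi"] pi_gt_zero by (metis mult_pos_pos zero_less_numeral)+
  then have "k = 0" by linarith
  then show "x = y" using k by simp
qed

text \<open>Up to a factor without zeros the function is an algebraic polynomial in
  \<open>cis \<theta>\<close>, which has finitely many roots; injectivity of \<open>cis\<close> on
  one period carries this back to the angles.\<close>

lemma trigpoly_finite_zeros:
  assumes "trigpoly f" "f \<theta>0 \<noteq> 0"
  shows "finite {\<theta>\<in>{0..<2*pi}. f \<theta> = 0}"
proof -
  obtain N P where f: "\<And>\<theta>. f \<theta> = cis (- (\<theta> * real N)) * poly P (cis \<theta>)"
    using assms(1) unfolding trigpoly_def by blast
  have "P \<noteq> 0" using assms(2) f by auto
  then have "finite {z. poly P z = 0}" by (rule poly_roots_finite)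
  moreover have "cis ` {\<theta>\<in>{0..<2*pi}. f \<theta> = 0} \<subseteq> {z. poly P z = 0}"
    using f by auto
  ultimately have "finite (cis ` {\<theta>\<in>{0..<2*pi}. f \<theta> = 0})"
    by (rule rev_finite_subset)
  then show ?thesis
    by (rule finite_imageD) (rule inj_on_subset[OF inj_on_cis], auto)
qed

lemma trigpoly_differentiable:
  assumes "trigpoly f" shows "f differentiable (at x)"
proof -
  obtain N P where f: "\<And>\<theta>. f \<theta> = cis (- (\<theta> * real N)) * poly P (cis \<theta>)"
    using assms unfolding trigpoly_def by blast
  have 1: "cis differentiable (at x)" for x
    using has_derivative_cis[of "\<lambda>x. x" "\<lambda>x. x" x UNIV] unfolding differentiable_def
    by (auto intro: has_derivative_ident)
  have 2: "poly P differentiable (at z)" for z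
    using poly_DERIV[of P z] unfolding differentiable_def has_field_derivative_def by blast
  have 3: "(\<lambda>\<theta>. - (\<theta> * real N)) differentiable (at x)"
    by (intro derivative_intros)
  have "(cis \<circ> (\<lambda>\<theta>. - (\<theta> * real N))) differentiable (at x)"
    by (intro differentiable_chain_at 1 3)
  moreover have "(poly P \<circ> cis) differentiable (at x)"
    by (intro differentiable_chain_at 1 2)
  ultimately have "(\<lambda>\<theta>. (cis \<circ> (\<lambda>\<theta>. - (\<theta> * real N))) \<theta> * (poly P \<circ> cis) \<theta>) differentiable (at x)"
    by (rule differentiable_mult)
  then show ?thesis by (simp add: f[abs_def] o_def)
qed

lemma trigpoly_continuous: "trigpoly f \<Longrightarrow> continuous_on A f"
  using trigpoly_differentiable differentiable_imp_continuous_within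
  by (metis continuous_at_imp_continuous_on)

text \<open>Only increments from the fixed point \<open>x\<close> are controlled. This suffices
  where a nonnegative quantity vanishes at \<open>x\<close> and has to be bounded by a multiple of
  the distance to \<open>x\<close>.\<close>

lemma differentiable_locally_lipschitz:
  fixes f :: "real \<Rightarrow> 'a::real_normed_vector"
  assumes "f differentiable (at x)"
  obtains L d where "L > 0" "d > 0" "\<And>y. \<bar>y - x\<bar> < d \<Longrightarrow> norm (f y - f x) \<le> L * \<bar>y - x\<bar>"
proof -
  obtain f' where f': "(f has_derivative f') (at x)"
    using assms unfolding differentiable_def by blast
  then have bl: "bounded_linear f'" by (rule has_derivative_bounded_linear)
  obtain K where K: "K > 0" "\<And>h. norm (f' h) \<le> norm h * K"
    using bounded_linear.pos_bounded[OF bl] by blast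
  obtain d where d: "d > 0" "\<And>y. norm (y - x) < d \<Longrightarrow> norm (f y - f x - f' (y - x)) \<le> 1 * norm (y - x)"
    using f' unfolding has_derivative_at_alt by (metis zero_less_one)
  show thesis
  proof (rule that[of "K + 1" d])
    fix y assume "\<bar>y - x\<bar> < d"
    then have "norm (f y - f x - f' (y - x)) \<le> \<bar>y - x\<bar>" using d(2)[of y] by simp
    moreover have "norm (f y - f x) \<le> norm (f y - f x - f' (y - x)) + norm (f' (y - x))"
      by (metis diff_add_cancel norm_triangle_ineq)
    moreover have "norm (f' (y - x)) \<le> \<bar>y - x\<bar> * K" using K(2)[of "y - x"] by simp
    ultimately show "norm (f y - f x) \<le> (K + 1) * \<bar>y - x\<bar>" by (simp add: algebra_simps)
  qed (use K d in auto)
qed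

text \<open>Multiplying by the n-th power of \<open>cis \<theta>\<close> yields an algebraic
  polynomial with infinitely many roots. In it \<open>a k\<close> has degree n - k, \<open>c\<close>
  degree n and \<open>b k\<close> degree n + k, so for k between 1 and n no two coefficients share a
  degree and each can be read off.\<close>

lemma laurent_coeffs_zero:
  fixes a b :: "nat \<Rightarrow> complex"
  assumes zero: "\<And>\<theta>. \<theta> \<in> X \<Longrightarrow> c + (\<Sum>k=1..n. a k * cis (- \<theta> * real k) + b k * cis (\<theta> * real k)) = 0"
    and X: "X \<subseteq> {0..<2*pi}" "infinite X"
  shows "c = 0" "\<And>k. k \<in> {1..n} \<Longrightarrow> a k = 0 \<and> b k = 0"
proof -
  define P where "P = monom c n + (\<Sum>k=1..n. monom (a k) (n - k) + monom (b k) (n + k))"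
  have P: "poly P (cis \<theta>) = cis (\<theta> * real n) *
      (c + (\<Sum>k=1..n. a k * cis (- \<theta> * real k) + b k * cis (\<theta> * real k)))" for \<theta>
  proof -
    have "a k * cis \<theta> ^ (n - k) + b k * cis \<theta> ^ (n + k) =
       cis (\<theta> * real n) * (a k * cis (- \<theta> * real k) + b k * cis (\<theta> * real k))" if "k \<in> {1..n}" for k
    proof -
      have "cis \<theta> ^ (n - k) = cis (\<theta> * real n) * cis (- \<theta> * real k)"
        using that by (simp add: cis_times_nat[symmetric] cis_mult of_nat_diff algebra_simps)
      moreover have "cis \<theta> ^ (n + k) = cis (\<theta> * real n) * cis (\<theta> * real k)"
        by (simp add: cis_times_nat[symmetric] cis_mult algebra_simps)
      ultimately show ?thesis by (simp add: algebra_simps)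
    qed
    then have "(\<Sum>k=1..n. a k * cis \<theta> ^ (n - k) + b k * cis \<theta> ^ (n + k)) =
      (\<Sum>k=1..n. cis (\<theta> * real n) * (a k * cis (- \<theta> * real k) + b k * cis (\<theta> * real k)))"
      by (intro sum.cong) auto
    then show ?thesis
      by (simp add: P_def poly_monom poly_sum cis_times_nat distrib_left sum_distrib_left mult.commute)
  qed
  have "P = 0"
  proof (rule ccontr)
    assume "P \<noteq> 0"
    then have "finite {z. poly P z = 0}" by (rule poly_roots_finite)
    moreover have "cis ` X \<subseteq> {z. poly P z = 0}" using P zero by auto
    ultimately have "finite (cis ` X)" by (rule rev_finite_subset)
    then have "finite X" by (rule finite_imageD) (rule inj_on_subset[OF inj_on_cis X(1)])
    with X show False by simp
  qed
  then have co: "coeff P l = 0" for l by simp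
  have cP: "coeff P l = (if l = n then c else 0) +
      (\<Sum>k=1..n. (if n - k = l then a k else 0) + (if n + k = l then b k else 0))" for l
    by (simp add: P_def coeff_sum)
  have "(\<Sum>k=1..n. (if n - k = n then a k else 0) + (if n + k = n then b k else 0)) = 0"
    by (intro sum.neutral) auto
  then show "c = 0" using co[of n] cP[of n] by simp
  fix k assume k: "k \<in> {1..n}"
  have "(\<Sum>i=1..n. (if n - i = n - k then a i else 0) + (if n + i = n - k then b i else 0))
     = (\<Sum>i=1..n. if i = k then a i else 0)"
    using k by (intro sum.cong) auto
  then have "coeff P (n - k) = a k" using cP[of "n - k"] k by (simp, auto)
  moreover have "(\<Sum>i=1..n. (if n - i = n + k then a i else 0) + (if n + i = n + k then b i else 0))
     = (\<Sum>i=1..n. if i = k then b i else 0)"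
    using k by (intro sum.cong) auto
  then have "coeff P (n + k) = b k" using cP[of "n + k"] k by simp
  ultimately show "a k = 0 \<and> b k = 0" using co by simp
qed

section \<open>Hermitian forms and determinants\<close>

text \<open>The polar form of \<open>cquad\<close>, conjugate-linear in its first vector.\<close>

definition sesq :: "complex^'m^'m \<Rightarrow> complex^'m \<Rightarrow> complex^'m \<Rightarrow> complex" where
  "sesq A u v = (\<Sum>i\<in>UNIV. cnj (u $ i) * (A *v v) $ i)"

lemma hermitianD: "hermitian A \<Longrightarrow> cnj (A $ i $ j) = A $ j $ i"
  unfolding hermitian_def by metis

lemma hermitianI: "(\<And>i j. cnj (A $ i $ j) = A $ j $ i) \<Longrightarrow> hermitian A"
  unfolding hermitian_def by simp

lemma cnj_mult_self: "cnj z * z = complex_of_real ((cmod z)\<^sup>2)"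
  using complex_norm_square[of z] by (simp add: mult.commute)

lemma cquad_eq_sesq: "cquad A v = sesq A v v"
  by (simp add: cquad_def sesq_def matrix_vector_mult_def sum_distrib_left mult.assoc)

lemma sesq_add_left: "sesq A (u + v) w = sesq A u w + sesq A v w"
  and sesq_add_right: "sesq A u (v + w) = sesq A u v + sesq A u w"
  and sesq_scale_left: "sesq A (z *s u) w = cnj z * sesq A u w"
  and sesq_scale_right: "sesq A u (z *s w) = z * sesq A u w"
  by (simp_all add: sesq_def matrix_vector_right_distrib vector_scalar_commute sum.distrib
      distrib_left distrib_right sum_distrib_left mult_ac)

lemma sesq_axis_left: "sesq A (axis i 1) v = (A *v v) $ i"
proof -
  have "sesq A (axis i 1) v = (\<Sum>k\<in>UNIV. if k = i then (A *v v) $ k else 0)"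
    unfolding sesq_def by (intro sum.cong) (auto simp: axis_def)
  then show ?thesis by simp
qed

lemma sesq_herm:
  assumes "hermitian A" shows "sesq A v u = cnj (sesq A u v)"
proof -
  have "sesq A v u = (\<Sum>i\<in>UNIV. \<Sum>j\<in>UNIV. cnj (v $ i) * (A $ i $ j * u $ j))"
    by (simp add: sesq_def matrix_vector_mult_def sum_distrib_left)
  also have "\<dots> = (\<Sum>j\<in>UNIV. \<Sum>i\<in>UNIV. cnj (v $ i) * (A $ i $ j * u $ j))"
    by (rule sum.swap)
  also have "\<dots> = (\<Sum>j\<in>UNIV. \<Sum>i\<in>UNIV. cnj (cnj (u $ j) * (A $ j $ i * v $ i)))"
  proof (intro sum.cong refl)
    fix i j
    have "A $ i $ j = cnj (A $ j $ i)" using assms unfolding hermitian_def by blast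
    then show "cnj (v $ i) * (A $ i $ j * u $ j) = cnj (cnj (u $ j) * (A $ j $ i * v $ i))"
      by simp
  qed
  also have "\<dots> = cnj (sesq A u v)"
    by (simp add: sesq_def matrix_vector_mult_def sum_distrib_left)
  finally show ?thesis .
qed

lemma herm_pd_imp_psd: "herm_pd A \<Longrightarrow> herm_psd A"
  unfolding herm_pd_def herm_psd_def
  by (metis cquad_eq_sesq less_eq_real_def mult_zero_left sesq_scale_right vector_smult_lzero complex.sel(1) zero_complex.code)

lemma quad_combination:
  assumes "hermitian A"
  shows "Re (cquad A (v + z *s u)) =
    Re (cquad A v) + 2 * Re (cnj z * sesq A u v) + (cmod z)\<^sup>2 * Re (cquad A u)"
proof -
  have h: "sesq A v u = cnj (sesq A u v)" by (rule sesq_herm[OF assms])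
  have "cquad A (v + z *s u) = cquad A v + (z * cnj (sesq A u v) + cnj z * sesq A u v) + z * cnj z * cquad A u"
    by (simp add: cquad_eq_sesq sesq_add_left sesq_add_right sesq_scale_left sesq_scale_right h algebra_simps)
  moreover have "Re (z * cnj (sesq A u v) + cnj z * sesq A u v) = 2 * Re (cnj z * sesq A u v)"
    by simp
  moreover have "z * cnj z = complex_of_real ((cmod z)\<^sup>2)" using cnj_mult_self[of z] by (simp only: mult.commute)
  ultimately show ?thesis by simp
qed

lemma psd_cauchy_schwarz:
  assumes "herm_psd A"
  shows "(cmod (sesq A u v))\<^sup>2 \<le> Re (cquad A u) * Re (cquad A v)"
proof -
  have H: "hermitian A" and P: "\<And>v. 0 \<le> Re (cquad A v)"
    using assms unfolding herm_psd_def by auto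
  define s where "s = sesq A u v"
  have key: "0 \<le> Re (cquad A v) - 2 * t * (cmod s)\<^sup>2 + t\<^sup>2 * (cmod s)\<^sup>2 * Re (cquad A u)" for t :: real
  proof -
    \<comment> \<open>The phase of \<open>z\<close> is aligned with \<open>s\<close>, so the cross
      term becomes the real number - t |s|^2.\<close>
    define z where "z = complex_of_real (- t) * s"
    have "cnj z * s = complex_of_real (- t * (cmod s)\<^sup>2)"
      by (simp add: z_def mult.assoc cnj_mult_self)
    then have "Re (cnj z * s) = - t * (cmod s)\<^sup>2" by (simp only: Re_complex_of_real)
    moreover have "(cmod z)\<^sup>2 = t\<^sup>2 * (cmod s)\<^sup>2"
      by (simp add: z_def norm_mult power_mult_distrib)
    ultimately show ?thesis
      using P[of "v + z *s u"] unfolding quad_combination[OF H] s_def by simp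
  qed
  show ?thesis
  proof (cases "Re (cquad A u) = 0")
    case True
    have "(cmod s)\<^sup>2 = 0"
    proof (rule ccontr)
      assume "(cmod s)\<^sup>2 \<noteq> 0"
      \<comment> \<open>With vanishing quadratic coefficient the expression is affine in t, and this
        t makes it -1.\<close>
      then show False
        using key[of "(Re (cquad A v) + 1) / (2 * (cmod s)\<^sup>2)"] True by simp
    qed
    then show ?thesis using True by (simp add: s_def)
  next
    case False
    then have pos: "Re (cquad A u) > 0" using P[of u] by simp
    \<comment> \<open>The chosen t minimizes the quadratic expression.\<close>
    have "0 \<le> Re (cquad A v) - (cmod s)\<^sup>2 / Re (cquad A u)"
      using key[of "1 / Re (cquad A u)"] pos by (simp add: power2_eq_square field_simps)
    then show ?thesis using pos by (simp add: s_def field_simps)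
  qed
qed

text \<open>Cauchy-Schwarz against every axis vector makes each coordinate of \<open>A *v v\<close>
  zero.\<close>

lemma psd_null_vector:
  assumes "herm_psd A" "Re (cquad A v) = 0" shows "A *v v = 0"
  using psd_cauchy_schwarz[OF assms(1), of "axis _ 1" v] assms(2)
  by (simp add: vec_eq_iff sesq_axis_left)

lemma psd_det_nonzero_imp_pd:
  assumes "herm_psd A" "det A \<noteq> 0" shows "herm_pd A"
proof -
  have "Re (cquad A v) > 0" if "v \<noteq> 0" for v
  proof (rule ccontr)
    assume "\<not> Re (cquad A v) > 0"
    then have "Re (cquad A v) = 0" using assms(1) unfolding herm_psd_def by (metis le_less)
    then have Av: "A *v v = 0" by (rule psd_null_vector[OF assms(1)])
    \<comment> \<open>Cramer's lemma for \<open>v\<close> and for 0 concerns the same matrix, since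
      both vectors are mapped to 0.\<close>
    have "v $ k * det A = 0" for k
      using cramer_lemma[of k A v, unfolded Av]
        cramer_lemma[of k A 0, unfolded matrix_vector_mult_0_right] by simp
    then show False using that assms(2) by (simp add: vec_eq_iff)
  qed
  then show ?thesis using assms(1) unfolding herm_pd_def herm_psd_def by auto
qed

lemma pd_det_nonzero:
  assumes "herm_pd A" shows "det A \<noteq> 0"
proof
  assume "det A = 0"
  then have "\<not> (\<forall>x. A *v x = 0 \<longrightarrow> x = 0)"
    using invertible_det_nz[of A] invertible_left_inverse[of A] matrix_left_invertible_ker[of A] by auto
  then obtain v where "A *v v = 0" "v \<noteq> 0" by blast
  then show False using assms unfolding herm_pd_def by (force simp: cquad_eq_sesq sesq_def)
qed

lemma det_cnj: "det (\<chi> i j. cnj (A $ i $ j)) = cnj (det A)"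
  by (simp add: det_def)

lemma hermitian_det_real:
  assumes "hermitian A" shows "Im (det A) = 0"
proof -
  have "(\<chi> i j. cnj (A $ i $ j)) = transpose A"
    by (simp add: vec_eq_iff transpose_def hermitianD[OF assms])
  then have "cnj (det A) = det A" using det_cnj[of A] det_transpose[of A] by simp
  then show ?thesis by (simp add: complex_eq_iff)
qed

lemma tendsto_det:
  fixes A :: "'b \<Rightarrow> complex^'m^'m"
  assumes "\<And>i j. ((\<lambda>x. A x $ i $ j) \<longlongrightarrow> B $ i $ j) F"
  shows "((\<lambda>x. det (A x)) \<longlongrightarrow> det B) F"
  unfolding det_def by (intro tendsto_intros assms)

lemma cquad_lincomb:
  "cquad (\<chi> i j. s * A $ i $ j + t * B $ i $ j) v = s * cquad A v + t * cquad B v"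
  by (simp add: cquad_def sum.distrib sum_distrib_left algebra_simps)

lemma mat_1_pd: "herm_pd (mat 1 :: complex^'m^'m)"
proof -
  have "cquad (mat 1) v = complex_of_real (\<Sum>i\<in>UNIV. (cmod (v $ i))\<^sup>2)" for v :: "complex^'m"
    by (simp add: cquad_eq_sesq sesq_def cnj_mult_self)
  moreover have "(\<Sum>i\<in>UNIV. (cmod (v $ i))\<^sup>2) > 0" if v: "v \<noteq> 0" for v :: "complex^'m"
  proof -
    obtain i where "v $ i \<noteq> 0" using v by (auto simp: vec_eq_iff)
    then show ?thesis by (intro sum_pos2[of _ i]) auto
  qed
  ultimately show ?thesis
    unfolding herm_pd_def by (auto simp: mat_def intro!: hermitianI simp del: of_real_sum)
qed

text \<open>Along the segment from the identity to \<open>A\<close> all matrices are positive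
  definite, so the determinant is real and never 0. By the intermediate value theorem it keeps the
  sign that it has at the identity. This avoids diagonalization.\<close>

lemma pd_det_pos:
  fixes A :: "complex^'m^'m"
  assumes "herm_pd A" shows "Re (det A) > 0"
proof (rule ccontr)
  assume neg: "\<not> Re (det A) > 0"
  define C where "C s = (\<chi> i j. complex_of_real (1 - s) * mat 1 $ i $ j + complex_of_real s * A $ i $ j)"
    for s :: real
  have pd: "herm_pd (C s)" if s: "0 \<le> s" "s \<le> 1" for s
  proof -
    have "hermitian (C s)"
      using assms by (intro hermitianI) (auto simp: C_def mat_def herm_pd_def hermitianD)
    moreover have "Re (cquad (C s) v) > 0" if "v \<noteq> 0" for v
    proof -
      have "Re (cquad A v) > 0" "Re (cquad (mat 1) v) > 0"
        using assms mat_1_pd[where 'm='m] that unfolding herm_pd_def by auto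
      then have "0 < (1 - s) * Re (cquad (mat 1) v) + s * Re (cquad A v)"
        using s by (cases "s = 0") (auto intro: add_nonneg_pos)
      then show ?thesis unfolding C_def cquad_lincomb by simp
    qed
    ultimately show ?thesis unfolding herm_pd_def by blast
  qed
  have C01: "C 0 = mat 1" "C 1 = A" by (simp_all add: C_def vec_eq_iff)
  have cont: "continuous_on {0..1} (\<lambda>s. Re (det (C s)))"
    unfolding det_def C_def by (auto intro!: continuous_intros)
  obtain s where s: "0 \<le> s" "s \<le> 1" "Re (det (C s)) = 0"
    using IVT2'[of "\<lambda>s. Re (det (C s))" 1 0 0] cont neg C01 by auto
  have "det (C s) = 0"
    using s hermitian_det_real[of "C s"] pd[of s] unfolding herm_pd_def by (simp add: complex_eq_iff)
  then show False using pd_det_nonzero[OF pd[OF s(1,2)]] by simp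
qed

text \<open>The matrix unit E_ii, polymorphic because it perturbs real coefficients and is then read
  as a complex matrix.\<close>

definition diag_unit :: "'m \<Rightarrow> 'a::zero_neq_one^'m^'m" where
  "diag_unit i = (\<chi> j k. if j = i \<and> k = i then 1 else 0)"

text \<open>Only column i changes, by t e_i, and the determinant is linear in that column. Since e_i
  is \<open>A *v w\<close>, Cramer's lemma evaluates the second summand. The transposes convert
  columns to the rows in which multilinearity is stated.\<close>

lemma det_add_diag_unit:
  fixes A :: "complex^'m^'m"
  assumes "A *v w = axis i 1"
  shows "det (\<chi> j k. A $ j $ k + t * diag_unit i $ j $ k) = det A * (1 + t * w $ i)"
proof -
  let ?col = "\<lambda>b. (\<chi> k. if k = i then b else column k A) :: complex^'m^'m"
  let ?e = "axis i 1 :: complex^'m"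
  have 1: "transpose (\<chi> j k. A $ j $ k + t * diag_unit i $ j $ k) = ?col (column i A + t *s ?e)"
    by (auto simp: vec_eq_iff transpose_def diag_unit_def column_def axis_def)
  have 2: "transpose (\<chi> j k. if k = i then (A *v w) $ j else A $ j $ k) = ?col ?e"
    by (auto simp: vec_eq_iff transpose_def column_def assms)
  have 3: "transpose A = ?col (column i A)"
    by (auto simp: vec_eq_iff transpose_def column_def)
  have "det (?col (column i A + t *s ?e)) = det (?col (column i A)) + t * det (?col ?e)"
    using det_row_add[of i "\<lambda>_. column i A" "\<lambda>_. t *s ?e" "\<lambda>k. column k A"]
      det_row_mul[of i t "\<lambda>_. ?e" "\<lambda>k. column k A"]
    by simp
  moreover have "det (?col ?e) = w $ i * det A"
    using arg_cong[OF 2, of det] cramer_lemma[of i A w] unfolding det_transpose by simp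
  moreover have "det (\<chi> j k. A $ j $ k + t * diag_unit i $ j $ k) = det (?col (column i A + t *s ?e))"
    "det (?col (column i A)) = det A"
    using arg_cong[OF 1, of det] arg_cong[OF 3, of det] unfolding det_transpose by (simp_all only:)
  ultimately show ?thesis by (simp add: algebra_simps)
qed

text \<open>With \<open>A *v w = axis i 1\<close>, the number \<open>w $ i\<close> is the i-th
  diagonal entry of the inverse. As \<open>sesq A v w\<close> is the conjugate of
  \<open>v $ i\<close> and \<open>cquad A w\<close> that of \<open>w $ i\<close>, Cauchy-Schwarz for
  the form of \<open>A\<close> bounds this entry from below.\<close>

lemma pd_det_add_diag_unit_ge:
  fixes A :: "complex^'m^'m"
  assumes A: "herm_pd A" and v: "v \<noteq> 0" and t: "t \<ge> 0"
  shows "Re (det (\<chi> j k. A $ j $ k + complex_of_real t * diag_unit i $ j $ k))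
    \<ge> Re (det A) * (1 + t * ((cmod (v $ i))\<^sup>2 / Re (cquad A v)))"
proof -
  have nz: "det A \<noteq> 0" by (rule pd_det_nonzero[OF A])
  obtain w where w: "A *v w = axis i 1" using cramer[OF nz] by blast
  have q: "Re (cquad A v) > 0" using A v unfolding herm_pd_def by blast
  have H: "hermitian A" using A unfolding herm_pd_def by blast
  have "sesq A v w = cnj (v $ i)"
    unfolding sesq_def w by (simp add: axis_def if_distrib cong: if_cong)
  then have 1: "cmod (sesq A w v) = cmod (v $ i)" using sesq_herm[OF H, of w v] by simp
  have "cquad A w = cnj (w $ i)"
    unfolding cquad_eq_sesq sesq_def w by (simp add: axis_def if_distrib cong: if_cong)
  then have "(cmod (v $ i))\<^sup>2 \<le> Re (w $ i) * Re (cquad A v)"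
    using psd_cauchy_schwarz[OF herm_pd_imp_psd[OF A], of w v] 1 by simp
  then have ge: "(cmod (v $ i))\<^sup>2 / Re (cquad A v) \<le> Re (w $ i)"
    using q by (simp add: field_simps)
  have "det (\<chi> j k. A $ j $ k + complex_of_real t * diag_unit i $ j $ k)
      = det A * (1 + complex_of_real t * w $ i)"
    by (rule det_add_diag_unit[OF w])
  then have "Re (det (\<chi> j k. A $ j $ k + complex_of_real t * diag_unit i $ j $ k))
      = Re (det A) * (1 + t * Re (w $ i))"
    using hermitian_det_real[OF H] by simp
  also have "\<dots> \<ge> Re (det A) * (1 + t * ((cmod (v $ i))\<^sup>2 / Re (cquad A v)))"
    using pd_det_pos[OF A] t ge by (intro mult_left_mono add_left_mono) auto
  finally show ?thesis .
qed

text \<open>Cholesky elimination, by induction on the number of nonzero diagonal entries: splitting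
  off one rank-one matrix leaves a Schur complement that is again semidefinite and has fewer of
  them. If the diagonal is zero, Cauchy-Schwarz makes the whole matrix zero.\<close>

lemma psd_sum_of_rank_ones:
  fixes A :: "complex^'m^'m"
  assumes "herm_psd A"
  shows "\<exists>S::nat. \<exists>u::nat \<Rightarrow> complex^'m. \<forall>i j. A $ i $ j = (\<Sum>k<S. u k $ i * cnj (u k $ j))"
  using assms
proof (induction "card {i. A $ i $ i \<noteq> 0}" arbitrary: A rule: less_induct)
  case less
  have H: "hermitian A" and P: "\<And>v. 0 \<le> Re (cquad A v)"
    using less.prems unfolding herm_psd_def by auto
  have ax: "sesq A (axis i 1) (axis j 1) = A $ i $ j" for i j
    unfolding sesq_axis_left by (simp add: matrix_vector_mult_def axis_def if_distrib cong: if_cong)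
  show ?case
  proof (cases "\<exists>i. A $ i $ i \<noteq> 0")
    case False
    have "A $ i $ j = 0" for i j
    proof -
      have "(cmod (A $ i $ j))\<^sup>2 \<le> 0"
        using psd_cauchy_schwarz[OF less.prems, of "axis i 1" "axis j 1"] False
        by (simp add: ax cquad_eq_sesq)
      then show ?thesis by simp
    qed
    then show ?thesis by (intro exI[of _ 0]) simp
  next
    case True
    then obtain i0 where i0: "A $ i0 $ i0 \<noteq> 0" by blast
    define a where "a = Re (A $ i0 $ i0)"
    have Aii: "A $ i0 $ i0 = complex_of_real a"
      using hermitianD[OF H, of i0 i0] by (simp add: a_def complex_eq_iff)
    have "a \<ge> 0" using P[of "axis i0 1"] by (simp add: cquad_eq_sesq ax a_def)
    then have a: "a > 0" using i0 Aii by (cases "a = 0") auto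
    define u where "u = (\<chi> i. A $ i $ i0 / complex_of_real (sqrt a))"
    have uu: "u $ i * cnj (u $ j) = A $ i $ i0 * A $ i0 $ j / a" for i j
    proof -
      have "cnj (A $ j $ i0) = A $ i0 $ j" by (rule hermitianD[OF H])
      moreover have "complex_of_real (sqrt a) * complex_of_real (sqrt a) = a"
        using a by (simp flip: of_real_mult)
      ultimately show ?thesis by (simp add: u_def)
    qed
    define B where "B = (\<chi> i j. A $ i $ j - u $ i * cnj (u $ j))"
    have "hermitian B" by (intro hermitianI) (simp add: B_def hermitianD[OF H] mult.commute)
    moreover have "Re (cquad B v) \<ge> 0" for v
    proof -
      define y where "y = (A *v v) $ i0"
      have "cquad B v = cquad A v - (\<Sum>i\<in>UNIV. \<Sum>j\<in>UNIV. (cnj (v $ i) * u $ i) * (cnj (u $ j) * v $ j))"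
        by (simp add: cquad_def B_def algebra_simps sum_subtractf)
      also have "\<dots> = cquad A v - (\<Sum>i\<in>UNIV. cnj (v $ i) * u $ i) * (\<Sum>j\<in>UNIV. cnj (u $ j) * v $ j)"
        by (simp add: sum_product)
      also have "(\<Sum>j\<in>UNIV. cnj (u $ j) * v $ j) = y / sqrt a"
      proof -
        have "cnj (A $ j $ i0) = A $ i0 $ j" for j by (rule hermitianD[OF H])
        then show ?thesis by (simp add: y_def u_def matrix_vector_mult_def sum_divide_distrib)
      qed
      also have "(\<Sum>i\<in>UNIV. cnj (v $ i) * u $ i) = cnj (\<Sum>j\<in>UNIV. cnj (u $ j) * v $ j)"
        by (simp add: mult.commute)
      also have "(\<Sum>j\<in>UNIV. cnj (u $ j) * v $ j) = y / sqrt a"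
      proof -
        have "cnj (A $ j $ i0) = A $ i0 $ j" for j by (rule hermitianD[OF H])
        then show ?thesis by (simp add: y_def u_def matrix_vector_mult_def sum_divide_distrib)
      qed
      also have "cnj (y / sqrt a) * (y / sqrt a) = complex_of_real ((cmod (y / sqrt a))\<^sup>2)"
        by (rule cnj_mult_self)
      finally have "Re (cquad B v) = Re (cquad A v) - (cmod y)\<^sup>2 / a"
        using a by (simp add: norm_divide power_divide)
      \<comment> \<open>Nonnegativity of the Schur complement at \<open>v\<close> is precisely
        Cauchy-Schwarz for \<open>axis i0 1\<close> and \<open>v\<close>.\<close>
      moreover have "(cmod y)\<^sup>2 \<le> a * Re (cquad A v)"
        using psd_cauchy_schwarz[OF less.prems, of "axis i0 1" v]
        unfolding cquad_eq_sesq[of A "axis i0 1"] ax Aii y_def by (simp add: sesq_axis_left)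
      ultimately have "(cmod y)\<^sup>2 / a \<le> Re (cquad A v)" "Re (cquad B v) = Re (cquad A v) - (cmod y)\<^sup>2 / a"
        using a by (simp_all add: pos_divide_le_eq mult.commute)
      then show ?thesis by simp
    qed
    ultimately have B: "herm_psd B" unfolding herm_psd_def by blast
    \<comment> \<open>A zero diagonal entry of \<open>A\<close> forces the entry in column i0 of its
      row to vanish, so the subtracted matrix is 0 at that diagonal position.\<close>
    have sub: "{i. B $ i $ i \<noteq> 0} \<subseteq> {i. A $ i $ i \<noteq> 0}"
    proof safe
      fix i assume Bn: "B $ i $ i \<noteq> 0" and A0: "A $ i $ i = 0"
      have "(cmod (A $ i $ i0))\<^sup>2 \<le> 0"
        using psd_cauchy_schwarz[OF less.prems, of "axis i 1" "axis i0 1"] A0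
        by (simp add: ax cquad_eq_sesq)
      then show False using Bn A0 by (simp add: B_def uu)
    qed
    moreover have "B $ i0 $ i0 = 0" using a by (simp add: B_def uu Aii)
    ultimately have "{i. B $ i $ i \<noteq> 0} \<subset> {i. A $ i $ i \<noteq> 0}" using i0 by blast
    then have "card {i. B $ i $ i \<noteq> 0} < card {i. A $ i $ i \<noteq> 0}"
      by (rule psubset_card_mono[rotated]) simp
    from less.hyps[OF this B] obtain S :: nat and w where
      w: "\<forall>i j. B $ i $ j = (\<Sum>k<S. w k $ i * cnj (w k $ j))" by blast
    have "A $ i $ j = (\<Sum>k<Suc S. (w(S := u)) k $ i * cnj ((w(S := u)) k $ j))" for i j
      using w[rule_format, of i j] by (simp add: B_def algebra_simps)
    then show ?thesis by blast
  qed
qed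

text \<open>Writing \<open>A\<close> as a sum of rank-one matrices built from vectors
  \<open>u k\<close> turns the trace of \<open>A\<close> times \<open>B\<close> into the sum of the
  values \<open>cquad B (u k)\<close>. If \<open>A\<close> is nonzero, some \<open>u k\<close> is
  nonzero.\<close>

lemma psd_trace_product:
  fixes A B :: "complex^'m^'m"
  assumes A: "herm_psd A" and B: "herm_psd B"
  shows "0 \<le> Re (\<Sum>i\<in>UNIV. \<Sum>j\<in>UNIV. A $ i $ j * B $ j $ i)"
    and "herm_pd B \<Longrightarrow> A \<noteq> 0 \<Longrightarrow> 0 < Re (\<Sum>i\<in>UNIV. \<Sum>j\<in>UNIV. A $ i $ j * B $ j $ i)"
proof -
  obtain S :: nat and u :: "nat \<Rightarrow> complex^'m" where u: "\<And>i j. A $ i $ j = (\<Sum>k<S. u k $ i * cnj (u k $ j))"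
    using psd_sum_of_rank_ones[OF A] by blast
  have "(\<Sum>i\<in>UNIV. \<Sum>j\<in>UNIV. A $ i $ j * B $ j $ i)
     = (\<Sum>i\<in>UNIV. \<Sum>j\<in>UNIV. \<Sum>k<S. cnj (u k $ j) * B $ j $ i * u k $ i)"
    by (simp add: u sum_distrib_right sum_distrib_left mult_ac)
  also have "\<dots> = (\<Sum>j\<in>UNIV. \<Sum>i\<in>UNIV. \<Sum>k<S. cnj (u k $ j) * B $ j $ i * u k $ i)"
    by (rule sum.swap)
  also have "\<dots> = (\<Sum>j\<in>UNIV. \<Sum>k<S. \<Sum>i\<in>UNIV. cnj (u k $ j) * B $ j $ i * u k $ i)"
    by (intro sum.cong refl sum.swap)
  also have "\<dots> = (\<Sum>k<S. \<Sum>j\<in>UNIV. \<Sum>i\<in>UNIV. cnj (u k $ j) * B $ j $ i * u k $ i)"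
    by (rule sum.swap)
  also have "\<dots> = (\<Sum>k<S. cquad B (u k))" by (simp add: cquad_def)
  finally have eq: "Re (\<Sum>i\<in>UNIV. \<Sum>j\<in>UNIV. A $ i $ j * B $ j $ i) = (\<Sum>k<S. Re (cquad B (u k)))"
    by simp
  have nn: "0 \<le> Re (cquad B (u k))" for k using B unfolding herm_psd_def by blast
  show "0 \<le> Re (\<Sum>i\<in>UNIV. \<Sum>j\<in>UNIV. A $ i $ j * B $ j $ i)"
    unfolding eq using nn by (intro sum_nonneg) auto
  assume pd: "herm_pd B" and "A \<noteq> 0"
  then obtain i j where "A $ i $ j \<noteq> 0" by (auto simp: vec_eq_iff)
  then obtain k where k: "k < S" "u k \<noteq> 0"
    using u[of i j] by (metis (no_types, lifting) lessThan_iff mult_zero_left sum.neutral zero_index)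
  then have "0 < Re (cquad B (u k))" using pd unfolding herm_pd_def by blast
  then show "0 < Re (\<Sum>i\<in>UNIV. \<Sum>j\<in>UNIV. A $ i $ j * B $ j $ i)"
    unfolding eq using nn k by (intro sum_pos2[of _ k]) auto
qed

section \<open>Integration over the circle\<close>

text \<open>Lebesgue measure on one period, left unnormalized: its mass is 2 pi, which is the source
  of that factor in the bounds below. Being finite, it allows integrands to be shifted by
  constants.\<close>

definition circ :: "real measure" where
  "circ = restrict_space lborel {0..<2*pi}"

lemma space_circ [simp]: "space circ = {0..<2*pi}"
  by (simp add: circ_def space_restrict_space)

lemma emeasure_circ: "emeasure circ (space circ) = ennreal (2 * pi)"
  unfolding space_circ unfolding circ_def by (subst emeasure_restrict_space) auto

interpretation circ: finite_measure circ
  by (rule finite_measureI) (unfold emeasure_circ infinity_ennreal_def, rule ennreal_neq_top)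

lemma measure_circ: "measure circ {0..<2*pi} = 2 * pi"
  using emeasure_circ by (simp add: measure_def)

lemma circ_measurable: "f \<in> borel_measurable borel \<Longrightarrow> f \<in> borel_measurable circ"
  unfolding circ_def by (rule measurable_restrict_space1) simp

lemma circ_measurable_continuous:
  "(\<And>A. continuous_on A f) \<Longrightarrow> f \<in> borel_measurable circ"
  by (intro circ_measurable borel_measurable_continuous_onI)

lemma AE_circ_iff: "(AE x in circ. P x) \<longleftrightarrow> (AE x in lborel. x \<in> {0..<2*pi} \<longrightarrow> P x)"
  unfolding circ_def by (rule AE_restrict_space_iff) simp

lemma AE_circ_finite:
  assumes "finite {x \<in> {0..<2*pi}. P x}" shows "AE x in circ. \<not> P x"
proof -
  have "AE x in lborel. x \<notin> {x \<in> {0..<2*pi}. P x}"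
    using finite_imp_null_set_lborel[OF assms] by (rule AE_not_in)
  then show ?thesis unfolding AE_circ_iff by eventually_elim auto
qed

lemma set_integrable_circ:
  fixes f :: "real \<Rightarrow> 'a::{banach, second_countable_topology}"
  shows "set_integrable lborel {0..<2*pi} f \<longleftrightarrow> integrable circ f"
  unfolding set_integrable_def circ_def by (subst integrable_restrict_space) auto

lemma set_integral_circ:
  fixes f :: "real \<Rightarrow> 'a::{banach, second_countable_topology}"
  shows "(LINT \<theta>:{0..<2*pi}|lborel. f \<theta>) = (\<integral>\<theta>. f \<theta> \<partial>circ)"
  unfolding set_lebesgue_integral_def circ_def by (subst integral_restrict_space) auto

lemma T_int_circ:
  "T_int f = (if integrable circ f then ereal ((\<integral>\<theta>. f \<theta> \<partial>circ) / (2*pi)) else \<infinity>)"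
  unfolding T_int_def set_integrable_circ set_integral_circ ..

lemma T_int_le_ereal:
  assumes "T_int f \<le> ereal t"
  shows "integrable circ f" "(\<integral>\<theta>. f \<theta> \<partial>circ) \<le> 2 * pi * t"
  using assms unfolding T_int_circ by (auto split: if_splits simp: field_simps)

text \<open>Since \<open>ennreal\<close> truncates negative reals to 0, the integrand is shifted by
  its lower bound. The second conclusion certifies that the bound on the right is not truncated
  either; \<open>T_int_leI\<close> relies on it for the way back.\<close>

lemma nn_integral_T_int_le:
  assumes lb: "AE x in circ. - K \<le> f x" and le: "T_int f \<le> ereal t"
  shows "(\<integral>\<^sup>+x. ennreal (f x + K) \<partial>circ) \<le> ennreal (2 * pi * (t + K))" "0 \<le> t + K"
proof -
  note i = T_int_le_ereal[OF le]
  have int: "(\<integral>x. f x + K \<partial>circ) = (\<integral>x. f x \<partial>circ) + 2 * pi * K"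
    using i(1) by (simp add: measure_circ)
  have nn: "AE x in circ. 0 \<le> f x + K" using lb by eventually_elim auto
  have "(\<integral>\<^sup>+x. ennreal (f x + K) \<partial>circ) = ennreal (\<integral>x. f x + K \<partial>circ)"
    using i(1) nn by (intro nn_integral_eq_integral) auto
  also have "\<dots> \<le> ennreal (2 * pi * (t + K))"
    unfolding int using i(2) by (intro ennreal_leI) (simp add: algebra_simps)
  finally show "(\<integral>\<^sup>+x. ennreal (f x + K) \<partial>circ) \<le> ennreal (2 * pi * (t + K))" .
  have "0 \<le> (\<integral>x. f x + K \<partial>circ)" using nn by (rule integral_nonneg_AE)
  then have "0 \<le> 2 * pi * (t + K)" unfolding int using i(2) by (simp add: algebra_simps)
  then show "0 \<le> t + K" using pi_gt_zero by (auto simp: zero_le_mult_iff simp del: pi_gt_zero)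
qed

lemma T_int_leI:
  assumes m: "f \<in> borel_measurable circ" and lb: "AE x in circ. - K \<le> f x"
    and le: "(\<integral>\<^sup>+x. ennreal (f x + K) \<partial>circ) \<le> ennreal (2 * pi * (t + K))" and t: "0 \<le> t + K"
  shows "T_int f \<le> ereal t"
proof -
  have nn: "AE x in circ. 0 \<le> f x + K" using lb by eventually_elim auto
  have fin: "(\<integral>\<^sup>+x. ennreal (f x + K) \<partial>circ) < \<infinity>"
    using le by (rule order.strict_trans1) simp
  have i: "integrable circ (\<lambda>x. f x + K)"
    using m nn fin by (intro integrableI_nonneg) auto
  then have "integrable circ (\<lambda>x. (f x + K) - K)" by (rule Bochner_Integration.integrable_diff) simp
  then have i': "integrable circ f" by simp
  have "ennreal (\<integral>x. f x + K \<partial>circ) \<le> ennreal (2 * pi * (t + K))"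
    using le nn_integral_eq_integral[OF i nn] by simp
  then have "(\<integral>x. f x + K \<partial>circ) \<le> 2 * pi * (t + K)"
    using t by (subst (asm) ennreal_le_iff) auto
  moreover have "(\<integral>x. f x + K \<partial>circ) = (\<integral>x. f x \<partial>circ) + 2 * pi * K"
    using i' by (simp add: measure_circ)
  ultimately have "(\<integral>x. f x \<partial>circ) \<le> 2 * pi * t" by (simp add: algebra_simps)
  then show ?thesis using i' unfolding T_int_circ by (simp add: field_simps)
qed

lemma T_int_ge:
  assumes "AE x in circ. - K \<le> f x" shows "ereal (- K) \<le> T_int f"
proof (cases "integrable circ f")
  case True
  then have "T_int f \<le> ereal ((\<integral>\<theta>. f \<theta> \<partial>circ) / (2*pi))" unfolding T_int_circ by simp
  from nn_integral_T_int_le(2)[OF assms this] True show ?thesis unfolding T_int_circ by simp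
qed (simp add: T_int_circ)

text \<open>One constant \<open>K\<close> has to serve all indices, so that the shifted integrands
  are nonnegative simultaneously.\<close>

lemma T_int_fatou_nn:
  assumes m: "\<And>j. f j \<in> borel_measurable circ" and lb: "\<And>j. AE x in circ. - K \<le> f j x"
    and le: "\<And>j. T_int (f j) \<le> ereal (\<tau> j)" and \<tau>: "\<tau> \<longlonglongrightarrow> t"
  shows "(\<integral>\<^sup>+x. liminf (\<lambda>j. ennreal (f j x + K)) \<partial>circ) \<le> ennreal (2 * pi * (t + K))" "0 \<le> t + K"
proof -
  have "(\<integral>\<^sup>+x. liminf (\<lambda>j. ennreal (f j x + K)) \<partial>circ)
      \<le> liminf (\<lambda>j. \<integral>\<^sup>+x. ennreal (f j x + K) \<partial>circ)"
    using m by (intro nn_integral_liminf) auto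
  also have "\<dots> \<le> liminf (\<lambda>j. ennreal (2 * pi * (\<tau> j + K)))"
    by (intro Liminf_mono always_eventually allI nn_integral_T_int_le(1)[OF lb le])
  also have "\<dots> = ennreal (2 * pi * (t + K))"
    by (intro lim_imp_Liminf tendsto_ennrealI tendsto_intros \<tau>) simp
  finally show "(\<integral>\<^sup>+x. liminf (\<lambda>j. ennreal (f j x + K)) \<partial>circ) \<le> ennreal (2 * pi * (t + K))" .
  show "0 \<le> t + K"
    by (rule LIMSEQ_le_const[of "\<lambda>j. \<tau> j + K"])
       (use nn_integral_T_int_le(2)[OF lb le] \<tau> in \<open>auto intro!: tendsto_intros\<close>)
qed

lemma T_int_fatou:
  assumes m: "\<And>j. f j \<in> borel_measurable circ" and lb: "\<And>j. AE x in circ. - K \<le> f j x"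
    and le: "\<And>j. T_int (f j) \<le> ereal (\<tau> j)" and \<tau>: "\<tau> \<longlonglongrightarrow> t"
    and mg: "g \<in> borel_measurable circ" and lim: "AE x in circ. (\<lambda>j. f j x) \<longlonglongrightarrow> g x"
  shows "T_int g \<le> ereal t"
proof (rule T_int_leI[OF mg])
  have "AE x in circ. \<forall>j. - K \<le> f j x" using lb by (simp add: AE_all_countable)
  with lim show "AE x in circ. - K \<le> g x"
    by eventually_elim (auto intro: LIMSEQ_le_const)
  have "AE x in circ. ennreal (g x + K) = liminf (\<lambda>j. ennreal (f j x + K))"
    using lim
    by eventually_elim (auto intro!: lim_imp_Liminf[symmetric] tendsto_ennrealI tendsto_intros)
  then have "(\<integral>\<^sup>+x. ennreal (g x + K) \<partial>circ) = (\<integral>\<^sup>+x. liminf (\<lambda>j. ennreal (f j x + K)) \<partial>circ)"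
    by (rule nn_integral_cong_AE)
  then show "(\<integral>\<^sup>+x. ennreal (g x + K) \<partial>circ) \<le> ennreal (2 * pi * (t + K))"
    using T_int_fatou_nn(1)[OF m lb le \<tau>] by simp
  show "0 \<le> t + K" by (rule T_int_fatou_nn(2)[OF m lb le \<tau>])
qed

text \<open>By Fatou the common bound \<open>t\<close> would dominate the integral of \<infinity>
  over a set of positive measure.\<close>

lemma T_int_no_blowup:
  assumes m: "\<And>j. f j \<in> borel_measurable circ" and lb: "\<And>j. AE x in circ. - K \<le> f j x"
    and le: "\<And>j. T_int (f j) \<le> ereal t"
    and lim: "AE x in circ. filterlim (\<lambda>j. f j x) at_top sequentially"
  shows False
proof -
  have "AE x in circ. liminf (\<lambda>j. ennreal (f j x + K)) = \<infinity>"
    using lim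
  proof eventually_elim
    case (elim x)
    have "filterlim (\<lambda>j. f j x + K) at_top sequentially"
      using filterlim_tendsto_add_at_top[OF tendsto_const elim, of K] by (simp add: add.commute)
    then have "((\<lambda>j. ennreal (f j x + K)) \<longlongrightarrow> \<infinity>) sequentially"
      by (simp add: ennreal_tendsto_top_eq_at_top)
    then show ?case by (intro lim_imp_Liminf) auto
  qed
  then have "(\<integral>\<^sup>+x. liminf (\<lambda>j. ennreal (f j x + K)) \<partial>circ) = (\<integral>\<^sup>+x. \<infinity> \<partial>circ)"
    by (rule nn_integral_cong_AE)
  also have "\<dots> = \<infinity>" using emeasure_circ by (simp add: ennreal_top_mult)
  finally show False
    using T_int_fatou_nn(1)[OF m lb le tendsto_const, of "\<lambda>j. j"] by (simp add: top_unique)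
qed

text \<open>The shift \<open>s\<close> removes the singularity at \<open>t0\<close>, and an
  antiderivative is c ln (x - t0 + s). For \<open>p\<close> the shift is an auxiliary parameter sent
  to 0; for \<open>Q\<close> both \<open>c\<close> and \<open>s\<close> are proportional to the
  perturbation, and the logarithm is what exceeds linear growth.\<close>

lemma set_integral_log_lower_bound:
  fixes f :: "real \<Rightarrow> real"
  assumes t0: "0 \<le> t0" "0 < d" "t0 + d < 2 * pi" and cs: "c > 0" "s > 0"
    and f: "integrable circ f" "AE x in circ. 0 \<le> f x"
    and ge: "AE x in circ. x \<in> {t0..t0+d} \<longrightarrow> c / (x - t0 + s) \<le> f x"
  shows "c * ln ((d + s) / s) \<le> (\<integral>x. f x \<partial>circ)"
proof -
  let ?g = "\<lambda>x. c / (x - t0 + s)"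
  have hb: "has_bochner_integral lborel (\<lambda>x. indicator {t0..t0+d} x *\<^sub>R ?g x)
      (c * ln (t0 + d - t0 + s) - c * ln (t0 - t0 + s))"
  proof (rule has_bochner_integral_FTC_Icc)
    fix x assume "t0 \<le> x" "x \<le> t0 + d"
    then have "x - t0 + s > 0" using cs by simp
    then have "((\<lambda>x. c * ln (x - t0 + s)) has_real_derivative c / (x - t0 + s)) (at x within {t0..t0+d})"
      by (auto intro!: derivative_eq_intros)
    then show "((\<lambda>x. c * ln (x - t0 + s)) has_vector_derivative c / (x - t0 + s)) (at x within {t0..t0+d})"
      by (simp add: has_real_derivative_iff_has_vector_derivative)
  next
    show "continuous_on {t0..t0 + d} ?g"
      using cs by (auto intro!: continuous_intros)
  qed (use t0 in auto)
  have eq: "indicator {0..<2*pi} x *\<^sub>R (indicator {t0..t0+d} x *\<^sub>R ?g x) = indicator {t0..t0+d} x *\<^sub>R ?g x" for x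
    using t0 by (auto simp: indicator_def)
  have ig: "integrable circ (\<lambda>x. indicator {t0..t0+d} x *\<^sub>R ?g x)"
    unfolding set_integrable_circ[symmetric] set_integrable_def eq using hb
    by (simp add: has_bochner_integral_iff)
  have "c * ln ((d + s) / s) = c * ln (t0 + d - t0 + s) - c * ln (t0 - t0 + s)"
    using cs t0 by (simp add: ln_div right_diff_distrib)
  also have "\<dots> = (\<integral>x. indicator {t0..t0+d} x *\<^sub>R ?g x \<partial>circ)"
    unfolding set_integral_circ[symmetric] set_lebesgue_integral_def eq
    using hb by (simp add: has_bochner_integral_iff)
  also have "\<dots> \<le> (\<integral>x. f x \<partial>circ)"
    using f ge ig by (intro integral_mono_AE) (auto simp: indicator_def elim!: eventually_elim2)
  finally show ?thesis .
qed

lemma ln_ratio_unbounded: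
  assumes "d > (0::real)" shows "\<exists>s>0. K < ln ((d + s) / s)"
proof -
  let ?s = "d / exp K"
  have "(d + ?s) / ?s = exp K + 1" using assms by (simp add: field_simps)
  moreover have "K < ln (exp K + 1)" by (subst ln_exp[symmetric, of K], subst ln_less_cancel_iff) (auto intro: add_pos_pos)
  ultimately show ?thesis using assms by (intro exI[of _ ?s]) auto
qed

section \<open>Closures of the polynomial classes and the entropy integrand\<close>

lemma trigpoly_Qpoly: "trigpoly (\<lambda>\<theta>. Qpoly n Q \<theta> $ i $ j)"
  unfolding Qpoly_def vec_lambda_beta
  by (intro trigpoly_add trigpoly_mult trigpoly_const trigpoly_sum trigpoly_cis_pos trigpoly_cis_neg)

lemma trigpoly_det_Qpoly: "trigpoly (\<lambda>\<theta>. det (Qpoly n Q \<theta>))"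
  by (intro trigpoly_det trigpoly_Qpoly)

lemma trigpoly_cquad_Qpoly: "trigpoly (\<lambda>\<theta>. cquad (Qpoly n Q \<theta>) v)"
  unfolding cquad_def by (intro trigpoly_sum trigpoly_mult trigpoly_const trigpoly_Qpoly)

lemma of_real_ppoly:
  "complex_of_real (ppoly n p \<theta>) = complex_of_real (p 0) +
    (\<Sum>k=1..n. complex_of_real (p k / 2) * cis (- \<theta> * real k) + complex_of_real (p k / 2) * cis (\<theta> * real k))"
  by (simp add: ppoly_def sum_distrib_left complex_eq_iff flip: sum.distrib)

lemma trigpoly_ppoly: "trigpoly (\<lambda>\<theta>. complex_of_real (ppoly n p \<theta>))"
  unfolding of_real_ppoly
  by (intro trigpoly_add trigpoly_mult trigpoly_const trigpoly_sum trigpoly_cis_pos trigpoly_cis_neg)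

lemma continuous_ppoly: "continuous_on A (ppoly n p)"
  unfolding ppoly_def by (intro continuous_intros)

lemma AE_det_Qpoly_nonzero:
  "det (Qpoly n Q \<theta>0) \<noteq> 0 \<Longrightarrow> AE \<theta> in circ. det (Qpoly n Q \<theta>) \<noteq> 0"
  by (rule AE_circ_finite) (rule trigpoly_finite_zeros[OF trigpoly_det_Qpoly])

text \<open>\<open>p 0\<close> is one of the Laurent coefficients, so infinitely many zeros would
  force it to be 0.\<close>

lemma AE_ppoly_nonzero:
  assumes "p 0 \<noteq> 0" shows "AE \<theta> in circ. ppoly n p \<theta> \<noteq> 0"
proof (rule AE_circ_finite, rule ccontr)
  assume inf: "infinite {x \<in> {0..<2*pi}. ppoly n p x = 0}"
  have "complex_of_real (p 0) = 0"
    using inf by (rule laurent_coeffs_zero(1)[rotated 2, where n = n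
        and a = "\<lambda>k. complex_of_real (p k / 2)" and b = "\<lambda>k. complex_of_real (p k / 2)"])
      (auto simp only: of_real_ppoly[symmetric] mem_Collect_eq of_real_0)
  with assms show False by simp
qed

lemma transpose_entry: "transpose A = A \<Longrightarrow> A $ i $ j = A $ j $ i"
  by (drule arg_cong[where f = "\<lambda>M. M $ j $ i"]) (simp add: transpose_def)

lemma Qpoly_hermitian:
  assumes "transpose (Q 0) = Q 0" shows "hermitian (Qpoly n Q \<theta>)"
proof (rule hermitianI)
  fix i j
  have "Q 0 $ i $ j = Q 0 $ j $ i" by (rule transpose_entry[OF assms])
  then show "cnj (Qpoly n Q \<theta> $ i $ j) = Qpoly n Q \<theta> $ j $ i"
    by (simp add: Qpoly_def cis_cnj add.commute)
qed

lemma tendsto_Qpoly: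
  assumes "\<And>k. (\<lambda>j. s j k) \<longlonglongrightarrow> Q k"
  shows "(\<lambda>j. Qpoly n (s j) \<theta> $ a $ b) \<longlonglongrightarrow> Qpoly n Q \<theta> $ a $ b"
  unfolding Qpoly_def vec_lambda_beta by (intro tendsto_intros assms)

lemma tendsto_cquad_Qpoly:
  assumes "\<And>k. (\<lambda>j. s j k) \<longlonglongrightarrow> Q k"
  shows "(\<lambda>j. cquad (Qpoly n (s j) \<theta>) v) \<longlonglongrightarrow> cquad (Qpoly n Q \<theta>) v"
  unfolding cquad_def by (intro tendsto_intros tendsto_Qpoly assms)

lemma tendsto_ppoly:
  assumes "\<And>k. (\<lambda>j. s j k) \<longlonglongrightarrow> p k"
  shows "(\<lambda>j. ppoly n (s j) \<theta>) \<longlonglongrightarrow> ppoly n p \<theta>"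
  unfolding ppoly_def by (intro tendsto_intros assms)

text \<open>The closure of \<open>Bm\<close> in coefficient space before the identically singular
  polynomials are removed, as the proof of \<open>Bm_cl_iff\<close> shows. \<open>ppos\<close> plays
  the same role for \<open>Bo\<close>.\<close>

definition Qpsd :: "nat \<Rightarrow> (nat \<Rightarrow> real^'m^'m) \<Rightarrow> bool" where
  "Qpsd n Q \<longleftrightarrow> transpose (Q 0) = Q 0 \<and> (\<forall>k>n. Q k = 0) \<and>
     (\<forall>\<theta>\<in>{0..<2*pi}. herm_psd (Qpoly n Q \<theta>))"

definition ppos :: "nat \<Rightarrow> (nat \<Rightarrow> real) \<Rightarrow> bool" where
  "ppos n p \<longleftrightarrow> p 0 = 1 \<and> (\<forall>k>n. p k = 0) \<and> (\<forall>\<theta>\<in>{0..<2*pi}. ppoly n p \<theta> \<ge> 0)"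

lemma Qpsd_limit:
  fixes Q :: "nat \<Rightarrow> real^'m^'m"
  assumes s: "\<And>j. Qpsd n (s j)" and lim: "\<And>k. (\<lambda>j. s j k) \<longlonglongrightarrow> Q k"
  shows "Qpsd n Q"
proof -
  have "Q 0 $ a $ b = Q 0 $ b $ a" for a b
  proof (rule LIMSEQ_unique)
    show "(\<lambda>j. s j 0 $ a $ b) \<longlonglongrightarrow> Q 0 $ a $ b" by (intro tendsto_intros lim)
    have "s j 0 $ a $ b = s j 0 $ b $ a" for j
      using s[of j] unfolding Qpsd_def by (intro transpose_entry) blast
    then show "(\<lambda>j. s j 0 $ a $ b) \<longlonglongrightarrow> Q 0 $ b $ a"
      by simp (intro tendsto_intros lim)
  qed
  then have sym: "transpose (Q 0) = Q 0" by (simp add: vec_eq_iff transpose_def)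
  moreover have "Q k = 0" if "k > n" for k
  proof -
    have "(\<lambda>j. s j k) = (\<lambda>_. 0)" using s that unfolding Qpsd_def by auto
    then show ?thesis using lim[of k] by (simp add: LIMSEQ_const_iff)
  qed
  moreover have "herm_psd (Qpoly n Q \<theta>)" if "\<theta> \<in> {0..<2*pi}" for \<theta>
  proof -
    have "0 \<le> Re (cquad (Qpoly n Q \<theta>) v)" for v
      by (rule LIMSEQ_le_const[OF tendsto_Re[OF tendsto_cquad_Qpoly[OF lim]]])
         (use s that in \<open>auto simp: Qpsd_def herm_psd_def\<close>)
    then show ?thesis using Qpoly_hermitian[where Q = Q, OF sym] unfolding herm_psd_def by blast
  qed
  ultimately show ?thesis unfolding Qpsd_def by blast
qed

lemma ppos_limit:
  assumes s: "\<And>j. ppos n (s j)" and lim: "\<And>k. (\<lambda>j. s j k) \<longlonglongrightarrow> p k"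
  shows "ppos n p"
proof -
  have "(\<lambda>j. s j 0) = (\<lambda>_. 1)" using s unfolding ppos_def by auto
  then have "p 0 = 1" using lim[of 0] by (simp add: LIMSEQ_const_iff)
  moreover have "p k = 0" if "k > n" for k
  proof -
    have "(\<lambda>j. s j k) = (\<lambda>_. 0)" using s that unfolding ppos_def by auto
    then show ?thesis using lim[of k] by (simp add: LIMSEQ_const_iff)
  qed
  moreover have "0 \<le> ppoly n p \<theta>" if "\<theta> \<in> {0..<2*pi}" for \<theta>
    by (rule LIMSEQ_le_const[OF tendsto_ppoly[OF lim]]) (use s that in \<open>auto simp: ppos_def\<close>)
  ultimately show ?thesis unfolding ppos_def by blast
qed

section \<open>Pointwise descriptions of the two closures\<close>

lemma Qpoly_add_const:
  "Qpoly n (Q(0 := Q 0 + D)) \<theta> = (\<chi> i j. Qpoly n Q \<theta> $ i $ j + complex_of_real (D $ i $ j))"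
  by (simp add: Qpoly_def vec_eq_iff)

lemma cquad_Qpoly_add_const:
  "cquad (Qpoly n (Q(0 := Q 0 + D)) \<theta>) v =
     cquad (Qpoly n Q \<theta>) v + cquad (\<chi> i j. complex_of_real (D $ i $ j)) v"
  unfolding Qpoly_add_const by (simp add: cquad_def sum.distrib algebra_simps)

lemma Bm_imp_Qpsd: "Bm n Q \<Longrightarrow> Qpsd n Q"
  unfolding Bm_def Qpsd_def by (auto intro: herm_pd_imp_psd)

text \<open>A semidefinite polynomial is approximated by adding 1/(j+1) times the identity to its
  constant coefficient; conversely semidefiniteness survives limits.\<close>

lemma Bm_cl_iff:
  fixes Q :: "nat \<Rightarrow> real^'m^'m"
  shows "Bm_cl n Q \<longleftrightarrow> Qpsd n Q \<and> (\<exists>\<theta>\<in>{0..<2*pi}. det (Qpoly n Q \<theta>) \<noteq> 0)"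
proof -
  have "\<exists>s. (\<forall>j. Bm n (s j)) \<and> (\<forall>k. (\<lambda>j. s j k) \<longlonglongrightarrow> Q k)" if Q: "Qpsd n Q"
  proof -
    define D where "D j = (1 / real (Suc j)) *\<^sub>R (mat 1 :: real^'m^'m)" for j
    define s where "s j = Q(0 := Q 0 + D j)" for j
    have "Bm n (s j)" for j
    proof -
      have "transpose (s j 0) = s j 0"
        using Q by (auto simp: s_def D_def Qpsd_def vec_eq_iff transpose_def mat_def)
      moreover have "\<forall>k>n. s j k = 0" using Q by (auto simp: s_def Qpsd_def)
      moreover have "Re (cquad (Qpoly n (s j) \<theta>) v) > 0" if "\<theta> \<in> {0..<2*pi}" "v \<noteq> 0" for \<theta> v
      proof -
        have "(\<chi> a b. complex_of_real (D j $ a $ b)) =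
          (\<chi> a b. complex_of_real (1 / real (Suc j)) * mat 1 $ a $ b + 0 * mat 1 $ a $ b)"
          by (simp add: D_def vec_eq_iff mat_def)
        then have "cquad (\<chi> a b. complex_of_real (D j $ a $ b)) v
          = complex_of_real (1 / real (Suc j)) * cquad (mat 1) v"
          by (simp only: cquad_lincomb) simp
        then have "Re (cquad (\<chi> a b. complex_of_real (D j $ a $ b)) v)
          = (1 / real (Suc j)) * Re (cquad (mat 1) v)"
          by (simp only:) (simp add: Re_divide_of_nat del: of_nat_Suc of_real_divide)
        moreover have "Re (cquad (mat 1) v) > 0" using mat_1_pd that unfolding herm_pd_def by blast
        moreover have "Re (cquad (Qpoly n Q \<theta>) v) \<ge> 0"
          using Q that unfolding Qpsd_def herm_psd_def by blast
        ultimately show ?thesis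
          unfolding s_def cquad_Qpoly_add_const by (simp add: add_nonneg_pos)
      qed
      ultimately show ?thesis unfolding Bm_def herm_pd_def using Qpoly_hermitian[of "s j" n] by blast
    qed
    moreover have "(\<lambda>j. s j k) \<longlonglongrightarrow> Q k" for k
    proof -
      have "(\<lambda>j. D j) \<longlonglongrightarrow> 0 *\<^sub>R mat 1"
        unfolding D_def by (intro tendsto_intros LIMSEQ_Suc[OF lim_1_over_n])
      then have "(\<lambda>j. Q 0 + D j) \<longlonglongrightarrow> Q 0 + 0 *\<^sub>R mat 1" by (intro tendsto_intros)
      then show ?thesis by (cases "k = 0") (auto simp: s_def)
    qed
    ultimately show ?thesis by blast
  qed
  moreover have "Qpsd n Q" if "\<forall>j. Bm n (s j)" "\<forall>k. (\<lambda>j. s j k) \<longlonglongrightarrow> Q k" for s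
    using that Qpsd_limit Bm_imp_Qpsd by blast
  ultimately show ?thesis unfolding Bm_cl_def by blast
qed

text \<open>Adding a positive constant would violate \<open>p 0 = 1\<close>, so the approximants are
  convex combinations with the constant polynomial 1.\<close>

lemma Bo_cl_iff: "Bo_cl n p \<longleftrightarrow> ppos n p"
proof
  assume p: "ppos n p"
  define s where "s j = (\<lambda>k. (1 - 1 / real (Suc j)) * p k + (1 / real (Suc j)) * (if k = 0 then 1 else 0))" for j
  have "Bo n (s j)" for j
  proof -
    have "s j 0 = 1" using p by (simp add: s_def ppos_def)
    moreover have "\<forall>k>n. s j k = 0" using p by (simp add: s_def ppos_def)
    moreover have "ppoly n (s j) \<theta> = (1 - 1 / real (Suc j)) * ppoly n p \<theta> + 1 / real (Suc j)" for \<theta>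
      by (simp add: ppoly_def s_def sum_distrib_left algebra_simps)
    moreover have "(1 - 1 / real (Suc j)) * ppoly n p \<theta> \<ge> 0" if "\<theta> \<in> {0..<2*pi}" for \<theta>
      using p that unfolding ppos_def by (intro mult_nonneg_nonneg) auto
    ultimately show ?thesis unfolding Bo_def by (simp add: add_nonneg_pos)
  qed
  moreover have "(\<lambda>j. s j k) \<longlonglongrightarrow> p k" for k
  proof -
    have "(\<lambda>j. s j k) \<longlonglongrightarrow> (1 - 0) * p k + 0 * (if k = 0 then 1 else 0)"
      unfolding s_def by (intro tendsto_intros LIMSEQ_Suc[OF lim_1_over_n])
    then show ?thesis by simp
  qed
  ultimately show "Bo_cl n p" unfolding Bo_cl_def by blast
next
  assume "Bo_cl n p"
  then obtain s where s: "\<And>j. Bo n (s j)" and lim: "\<And>k. (\<lambda>j. s j k) \<longlonglongrightarrow> p k"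
    unfolding Bo_cl_def by blast
  have "ppos n (s j)" for j using s[of j] unfolding Bo_def ppos_def by (auto intro: less_imp_le)
  then show "ppos n p" using lim by (rule ppos_limit)
qed

section \<open>Bounds for the coefficients of nonnegative scalar polynomials\<close>

lemma cos_int_has_integral:
  "((\<lambda>\<theta>. cos (\<theta> * real_of_int k)) has_integral (if k = 0 then 2 * pi else 0)) {0..2*pi}"
proof (cases "k = 0")
  case True
  then show ?thesis using has_integral_const_real[of "1::real" 0 "2*pi"] by simp
next
  case False
  have "((\<lambda>\<theta>. cos (\<theta> * real_of_int k)) has_integral
      (sin (2 * pi * real_of_int k) / real_of_int k - sin (0 * real_of_int k) / real_of_int k)) {0..2*pi}"
  proof (rule fundamental_theorem_of_calculus)
    fix x assume "x \<in> {0..2*pi}"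
    have "((\<lambda>\<theta>. sin (\<theta> * real_of_int k) / real_of_int k) has_real_derivative cos (x * real_of_int k))
      (at x within {0..2*pi})"
      using False by (auto intro!: derivative_eq_intros)
    then show "((\<lambda>\<theta>. sin (\<theta> * real_of_int k) / real_of_int k) has_vector_derivative cos (x * real_of_int k))
      (at x within {0..2*pi})"
      by (simp add: has_real_derivative_iff_has_vector_derivative)
  qed simp
  then show ?thesis using False sin_int_2pin[of k] by (simp add: mult.commute mult.left_commute)
qed

lemma cos_cos_has_integral:
  assumes "l \<ge> 1" "k \<ge> 1"
  shows "((\<lambda>\<theta>. cos (\<theta> * real l) * cos (\<theta> * real k)) has_integral (if l = k then pi else 0)) {0..2*pi}"
proof -
  have "((\<lambda>\<theta>. (cos (\<theta> * real_of_int (int l - int k)) + cos (\<theta> * real_of_int (int l + int k))) / 2)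
    has_integral ((if int l - int k = 0 then 2 * pi else 0) + (if int l + int k = 0 then 2 * pi else 0)) / 2) {0..2*pi}"
    by (intro has_integral_divide has_integral_add cos_int_has_integral)
  moreover have "(cos (\<theta> * real_of_int (int l - int k)) + cos (\<theta> * real_of_int (int l + int k))) / 2
      = cos (\<theta> * real l) * cos (\<theta> * real k)" for \<theta>
    using cos_times_cos[of "\<theta> * real l" "\<theta> * real k"] by (simp add: right_diff_distrib distrib_left)
  ultimately show ?thesis using assms by (auto split: if_splits)
qed

text \<open>The polynomial times 1 + cos (k \<theta>), and times 1 - cos (k \<theta>), is
  nonnegative. By orthogonality the two integrals are pi (2 + p_k) and pi (2 - p_k).\<close>

lemma ppos_coeff_bound:
  assumes p: "ppos n p" shows "\<bar>p k\<bar> \<le> 2"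
proof -
  consider "k = 0" | "k > n" | "k \<in> {1..n}" by force
  then show ?thesis
  proof cases
    case 3
    have pn: "ppoly n p \<theta> = p 0 + (\<Sum>l=1..n. p l * cos (\<theta> * real l))" for \<theta>
      by (simp add: ppoly_def sum_distrib_left)
    have cz: "((\<lambda>\<theta>. cos (\<theta> * real l)) has_integral 0) {0..2*pi}" if "l \<in> {1..n}" for l
      using cos_int_has_integral[of "int l"] that by simp
    have 1: "((\<lambda>\<theta>. ppoly n p \<theta>) has_integral 2 * pi) {0..2*pi}"
    proof -
      have "((\<lambda>\<theta>. p 0 + (\<Sum>l=1..n. p l * cos (\<theta> * real l))) has_integral
        (2 * pi * p 0 + (\<Sum>l=1..n. p l * 0))) {0..2*pi}"
        using has_integral_const_real[of "p 0" 0 "2*pi"]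
        by (intro has_integral_add has_integral_sum has_integral_mult_right cz) auto
      then show ?thesis using p by (simp add: pn ppos_def)
    qed
    have 2: "((\<lambda>\<theta>. ppoly n p \<theta> * cos (\<theta> * real k)) has_integral p k * pi) {0..2*pi}"
    proof -
      have "((\<lambda>\<theta>. p 0 * cos (\<theta> * real k) + (\<Sum>l=1..n. p l * (cos (\<theta> * real l) * cos (\<theta> * real k)))) has_integral
        (p 0 * 0 + (\<Sum>l=1..n. p l * (if l = k then pi else 0)))) {0..2*pi}"
        using 3
        by (intro has_integral_add has_integral_sum has_integral_mult_right cz cos_cos_has_integral) auto
      moreover have "(\<Sum>l=1..n. p l * (if l = k then pi else 0)) = (\<Sum>l=1..n. if l = k then p k * pi else 0)"
        by (intro sum.cong) auto
      ultimately show ?thesis using 3 by (simp add: pn distrib_right sum_distrib_right mult.assoc)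
    qed
    \<comment> \<open>The integrals are over the closed interval, so the endpoint 2 pi, absent from
      the definition of \<open>ppos\<close>, is reached by periodicity.\<close>
    have nn: "0 \<le> ppoly n p \<theta>" if "\<theta> \<in> {0..2*pi}" for \<theta>
    proof (cases "\<theta> = 2 * pi")
      case True
      have "cos (2 * pi * real l) = 1" for l using cos_int_2pin[of "int l"] by simp
      then have "ppoly n p \<theta> = ppoly n p 0" using True by (simp add: pn)
      then show ?thesis using p by (simp add: ppos_def)
    qed (use p that in \<open>auto simp: ppos_def\<close>)
    have "0 \<le> 2 * pi + p k * pi"
      using has_integral_add[OF 1 2]
    proof (rule has_integral_nonneg)
      fix \<theta> assume "\<theta> \<in> {0..2*pi}"
      then have "0 \<le> ppoly n p \<theta> * (1 + cos (\<theta> * real k))"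
        using nn[of \<theta>] cos_ge_minus_one[of "\<theta> * real k"] by (intro mult_nonneg_nonneg) linarith+
      then show "0 \<le> ppoly n p \<theta> + ppoly n p \<theta> * cos (\<theta> * real k)" by (simp add: algebra_simps)
    qed
    moreover have "0 \<le> 2 * pi - p k * pi"
      using has_integral_diff[OF 1 2]
    proof (rule has_integral_nonneg)
      fix \<theta> assume "\<theta> \<in> {0..2*pi}"
      then have "0 \<le> ppoly n p \<theta> * (1 - cos (\<theta> * real k))"
        using nn[of \<theta>] cos_le_one[of "\<theta> * real k"] by (intro mult_nonneg_nonneg) linarith+
      then show "0 \<le> ppoly n p \<theta> - ppoly n p \<theta> * cos (\<theta> * real k)" by (simp add: algebra_simps)
    qed
    ultimately have "0 \<le> pi * (2 + p k)" "0 \<le> pi * (2 - p k)" by (simp_all add: algebra_simps)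
    then have "0 \<le> 2 + p k" "0 \<le> 2 - p k"
      using pi_gt_zero by (auto simp: zero_le_mult_iff simp del: pi_gt_zero)
    then show ?thesis by linarith
  qed (use p in \<open>auto simp: ppos_def\<close>)
qed

lemma ppos_ppoly_le:
  assumes p: "ppos n p" shows "ppoly n p \<theta> \<le> 1 + 2 * real n"
proof -
  have "(\<Sum>k=1..n. p k * cos (\<theta> * real k)) \<le> (\<Sum>k=1..n. 2)"
  proof (rule sum_mono)
    fix k
    have "\<bar>p k * cos (\<theta> * real k)\<bar> \<le> 2 * 1"
      unfolding abs_mult by (intro mult_mono ppos_coeff_bound[OF p]) auto
    then show "p k * cos (\<theta> * real k) \<le> 2" by linarith
  qed
  then show ?thesis using p by (simp add: ppoly_def ppos_def sum_distrib_left)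
qed

section \<open>Determinant bounds and the entropy integrand\<close>

definition Qsize :: "nat \<Rightarrow> (nat \<Rightarrow> real^'m^'m) \<Rightarrow> real" where
  "Qsize n Q = (\<Sum>k\<le>n. norm (Q k))"

lemma Qsize_nonneg: "0 \<le> Qsize n Q"
  by (simp add: Qsize_def sum_nonneg)

lemma matrix_entry_le_norm: "\<bar>A $ i $ j\<bar> \<le> norm (A :: real^'m^'m)"
  using component_le_norm_cart[of "A $ i" j] Finite_Cartesian_Product.norm_nth_le[of A i] by linarith

lemma Qpoly_entry_le: "cmod (Qpoly n Q \<theta> $ i $ j) \<le> Qsize n Q"
proof -
  have "cmod (Qpoly n Q \<theta> $ i $ j) \<le> \<bar>Q 0 $ i $ j\<bar> +
     cmod (1 / 2 * (\<Sum>k=1..n. complex_of_real (Q k $ i $ j) * cis (- \<theta> * real k)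
                       + complex_of_real (Q k $ j $ i) * cis (\<theta> * real k)))"
    unfolding Qpoly_def vec_lambda_beta by (rule order_trans[OF norm_triangle_ineq]) simp
  also have "cmod (1 / 2 * (\<Sum>k=1..n. complex_of_real (Q k $ i $ j) * cis (- \<theta> * real k)
                       + complex_of_real (Q k $ j $ i) * cis (\<theta> * real k)))
     = 1 / 2 * cmod (\<Sum>k=1..n. complex_of_real (Q k $ i $ j) * cis (- \<theta> * real k)
                       + complex_of_real (Q k $ j $ i) * cis (\<theta> * real k))"
    by (simp add: norm_mult)
  also have "\<dots> \<le> 1 / 2 * (\<Sum>k=1..n. 2 * norm (Q k))"
  proof (intro mult_left_mono sum_norm_le)
    fix k
    have "cmod (complex_of_real (Q k $ i $ j) * cis (- \<theta> * real k)
                       + complex_of_real (Q k $ j $ i) * cis (\<theta> * real k))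
       \<le> \<bar>Q k $ i $ j\<bar> + \<bar>Q k $ j $ i\<bar>"
      by (rule order_trans[OF norm_triangle_ineq]) (simp add: norm_mult)
    then show "cmod (complex_of_real (Q k $ i $ j) * cis (- \<theta> * real k)
                       + complex_of_real (Q k $ j $ i) * cis (\<theta> * real k)) \<le> 2 * norm (Q k)"
      using matrix_entry_le_norm[of "Q k" i j] matrix_entry_le_norm[of "Q k" j i] by linarith
  qed simp
  also have "\<bar>Q 0 $ i $ j\<bar> + 1 / 2 * (\<Sum>k=1..n. 2 * norm (Q k)) \<le> norm (Q 0) + (\<Sum>k=1..n. norm (Q k))"
    using matrix_entry_le_norm[of "Q 0" i j] by (simp add: sum_distrib_left[symmetric])
  also have "\<dots> = Qsize n Q"
    unfolding Qsize_def atMost_atLeast0 by (simp add: sum.atLeast_Suc_atMost)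
  finally show ?thesis by simp
qed

text \<open>A crude count of the Leibniz expansion; polynomial growth in \<open>a\<close> suffices,
  since only its logarithm enters.\<close>

lemma norm_det_le:
  fixes A :: "complex^'m^'m"
  assumes "\<And>i j. cmod (A $ i $ j) \<le> a"
  shows "cmod (det A) \<le> fact CARD('m) * a ^ CARD('m)"
proof -
  have "cmod (det A) \<le> (\<Sum>p\<in>{p. p permutes (UNIV::'m set)}. a ^ CARD('m))"
    unfolding det_def
  proof (rule sum_norm_le)
    fix p :: "'m \<Rightarrow> 'm"
    have "cmod (of_int (sign p)) = 1" by (simp add: sign_def)
    moreover have "cmod (\<Prod>i\<in>UNIV. A $ i $ p i) \<le> (\<Prod>i\<in>(UNIV::'m set). a)"
      unfolding prod_norm[symmetric] by (rule prod_mono) (simp add: assms)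
    ultimately show "cmod (of_int (sign p) * (\<Prod>i\<in>UNIV. A $ i $ p i)) \<le> a ^ CARD('m)"
      by (simp add: norm_mult)
  qed
  then show ?thesis by (simp add: card_permutations)
qed

lemma det_matrix_inv:
  fixes A :: "complex^'m^'m"
  assumes "det A \<noteq> 0" shows "det (matrix_inv A) = 1 / det A"
proof -
  have "\<exists>B. A ** B = mat 1 \<and> B ** A = mat 1"
    using assms invertible_det_nz[of A] unfolding invertible_def by blast
  then have "A ** matrix_inv A = mat 1"
    unfolding matrix_inv_def by (rule someI2_ex) blast
  then have "det A * det (matrix_inv A) = 1" by (metis det_I det_mul)
  then show ?thesis using assms by (simp add: field_simps)
qed

lemma det_scale:
  fixes A :: "complex^'m^'m"
  shows "det (\<chi> i j. c * A $ i $ j) = c ^ CARD('m) * det A"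
proof -
  have "(\<chi> i j. c * A $ i $ j) = (\<chi> i. c *s (A $ i))" by (simp add: vec_eq_iff)
  then show ?thesis using det_rows_mul[of "\<lambda>_. c" "\<lambda>i. A $ i"] by simp
qed

definition Jint :: "nat \<Rightarrow> (nat \<Rightarrow> real) \<Rightarrow> (nat \<Rightarrow> real^'m^'m) \<Rightarrow> real \<Rightarrow> real" where
  "Jint n p Q \<theta> = ppoly n p \<theta> *
       ln (Re (det (\<chi> i j. complex_of_real (ppoly n p \<theta>) * matrix_inv (Qpoly n Q \<theta>) $ i $ j)))
     - real CARD('m) * ppoly n p \<theta>"

text \<open>Where \<open>ppoly\<close> vanishes every term carries it as a factor, so both sides are
  0 whatever value \<open>ln\<close> takes there.\<close>

lemma Jint_eq:
  fixes Q :: "nat \<Rightarrow> real^'m^'m"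
  assumes pd: "herm_pd (Qpoly n Q \<theta>)" and p: "ppoly n p \<theta> \<ge> 0"
  shows "Jint n p Q \<theta> = real CARD('m) * (ppoly n p \<theta> * ln (ppoly n p \<theta>)) - real CARD('m) * ppoly n p \<theta>
     - ppoly n p \<theta> * ln (Re (det (Qpoly n Q \<theta>)))"
proof (cases "ppoly n p \<theta> = 0")
  case False
  let ?d = "det (Qpoly n Q \<theta>)" and ?p = "ppoly n p \<theta>"
  have d: "?d = complex_of_real (Re ?d)" "Re ?d > 0"
    using hermitian_det_real pd pd_det_pos[OF pd] by (auto simp: complex_eq_iff herm_pd_def)
  have "det (\<chi> i j. complex_of_real ?p * matrix_inv (Qpoly n Q \<theta>) $ i $ j)
      = complex_of_real ?p ^ CARD('m) * (1 / ?d)"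
    by (simp add: det_scale det_matrix_inv pd_det_nonzero[OF pd])
  also have "\<dots> = complex_of_real (?p ^ CARD('m) / Re ?d)" by (subst d(1)) simp
  finally have "Re (det (\<chi> i j. complex_of_real ?p * matrix_inv (Qpoly n Q \<theta>) $ i $ j)) = ?p ^ CARD('m) / Re ?d"
    by simp
  then show ?thesis
    using False p d(2) by (simp add: Jint_def ln_div ln_realpow right_diff_distrib)
qed (simp add: Jint_def)

text \<open>Three bounds combine: x ln x >= x - 1 for the scalar part, x <= 1 + 2n for the weight
  \<open>ppoly\<close>, and the logarithm of the Leibniz bound for the determinant.\<close>

lemma Jint_ge:
  fixes Q :: "nat \<Rightarrow> real^'m^'m"
  assumes pd: "herm_pd (Qpoly n Q \<theta>)" and p: "ppos n p" "\<theta> \<in> {0..<2*pi}"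
    and a: "Qsize n Q \<le> a"
  shows "- (real CARD('m) + (1 + 2 * real n) * (ln (fact CARD('m)) + real CARD('m) * ln (1 + a)))
     \<le> Jint n p Q \<theta>"
proof -
  let ?d = "Re (det (Qpoly n Q \<theta>))" and ?p = "ppoly n p \<theta>" and ?m = "real CARD('m)"
  have p0: "?p \<ge> 0" using p unfolding ppos_def by blast
  have d: "?d > 0" by (rule pd_det_pos[OF pd])
  have a0: "a \<ge> 0" using a Qsize_nonneg[of n Q] by linarith
  have "?d \<le> fact CARD('m) * a ^ CARD('m)"
    using complex_Re_le_cmod[of "det (Qpoly n Q \<theta>)"] norm_det_le[of "Qpoly n Q \<theta>" a] Qpoly_entry_le[of n Q \<theta>] a
    by (meson order_trans)
  \<comment> \<open>Replacing \<open>a\<close> by 1 + a makes the logarithm nonnegative, so that the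
    weight may be replaced by its upper bound.\<close>
  also have "\<dots> \<le> fact CARD('m) * (1 + a) ^ CARD('m)"
    using a0 by (intro mult_left_mono power_mono) auto
  finally have "ln ?d \<le> ln (fact CARD('m) * (1 + a) ^ CARD('m))"
    using d by (subst ln_le_cancel_iff) auto
  also have "\<dots> = ln (fact CARD('m)) + ?m * ln (1 + a)" using a0 by (simp add: ln_mult ln_realpow)
  finally have lnd: "ln ?d \<le> ln (fact CARD('m)) + ?m * ln (1 + a)" .
  have L0: "0 \<le> ln (fact CARD('m)) + ?m * ln (1 + a)"
    using a0 fact_ge_1[of "CARD('m)", where 'a=real] by (intro add_nonneg_nonneg mult_nonneg_nonneg) auto
  have "?p * ln ?d \<le> ?p * (ln (fact CARD('m)) + ?m * ln (1 + a))"
    by (rule mult_left_mono[OF lnd p0])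
  also have "\<dots> \<le> (1 + 2 * real n) * (ln (fact CARD('m)) + ?m * ln (1 + a))"
    by (rule mult_right_mono[OF ppos_ppoly_le[OF p(1)] L0])
  finally have 1: "?p * ln ?d \<le> (1 + 2 * real n) * (ln (fact CARD('m)) + ?m * ln (1 + a))" .
  have "?p - 1 \<le> ?p * ln ?p"
  proof (cases "?p = 0")
    case False
    then have pp: "?p > 0" using p0 by simp
    have "ln (1 / ?p) \<le> 1 / ?p - 1" using pp by (intro ln_le_minus_one) auto
    then have "?p * (1 - 1 / ?p) \<le> ?p * ln ?p" using pp by (intro mult_left_mono) (auto simp: ln_div)
    moreover have "?p * (1 - 1 / ?p) = ?p - 1" using pp by (simp add: right_diff_distrib)
    ultimately show ?thesis by simp
  qed simp
  then have "?m * (?p - 1) \<le> ?m * (?p * ln ?p)" by (intro mult_left_mono) auto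
  then show ?thesis using 1 by (simp add: Jint_eq[OF pd p0] right_diff_distrib)
qed

text \<open>\<open>matrix_inv\<close> is unspecified at singular matrices; there are finitely many
  such angles, and off them the integrand equals the explicit expression of
  \<open>Jint_eq\<close>.\<close>

lemma Jint_measurable:
  fixes Q :: "nat \<Rightarrow> real^'m^'m"
  assumes Q: "Bm_cl n Q" and p: "ppos n p"
  shows "Jint n p Q \<in> borel_measurable circ"
proof (rule measurable_discrete_difference)
  let ?g = "\<lambda>\<theta>. real CARD('m) * (ppoly n p \<theta> * ln (ppoly n p \<theta>)) - real CARD('m) * ppoly n p \<theta>
     - ppoly n p \<theta> * ln (Re (det (Qpoly n Q \<theta>)))"
  have [measurable]: "ppoly n p \<in> borel_measurable circ"
    by (rule circ_measurable_continuous) (rule continuous_ppoly)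
  have [measurable]: "(\<lambda>\<theta>. Re (det (Qpoly n Q \<theta>))) \<in> borel_measurable circ"
    by (rule circ_measurable_continuous) (intro continuous_intros trigpoly_continuous trigpoly_det_Qpoly)
  show "?g \<in> borel_measurable circ" by measurable
  obtain \<theta>0 where "det (Qpoly n Q \<theta>0) \<noteq> 0" using Q unfolding Bm_cl_iff by blast
  then have "finite {\<theta> \<in> {0..<2*pi}. det (Qpoly n Q \<theta>) = 0}"
    by (rule trigpoly_finite_zeros[OF trigpoly_det_Qpoly])
  then show "countable {\<theta> \<in> {0..<2*pi}. det (Qpoly n Q \<theta>) = 0}" by (rule countable_finite)
  fix \<theta>
  show "{\<theta>} \<in> sets circ" if "\<theta> \<in> {\<theta> \<in> {0..<2*pi}. det (Qpoly n Q \<theta>) = 0}"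
    using that unfolding circ_def by (subst sets_restrict_space_iff) auto
  assume "\<theta> \<in> space circ" "\<theta> \<notin> {\<theta> \<in> {0..<2*pi}. det (Qpoly n Q \<theta>) = 0}"
  then have \<theta>: "\<theta> \<in> {0..<2*pi}" "det (Qpoly n Q \<theta>) \<noteq> 0" by auto
  then show "?g \<theta> = Jint n p Q \<theta>"
    using Q p by (subst Jint_eq) (auto simp: Bm_cl_iff Qpsd_def ppos_def intro: psd_det_nonzero_imp_pd)
qed auto

lemma Bm_cl_AE_pd:
  fixes Q :: "nat \<Rightarrow> real^'m^'m"
  assumes Q: "Bm_cl n Q"
  shows "AE \<theta> in circ. herm_pd (Qpoly n Q \<theta>)"
proof -
  obtain \<theta>0 where "det (Qpoly n Q \<theta>0) \<noteq> 0" using Q unfolding Bm_cl_iff by blast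
  then have "AE \<theta> in circ. det (Qpoly n Q \<theta>) \<noteq> 0" by (rule AE_det_Qpoly_nonzero)
  then show ?thesis using AE_space
    by eventually_elim (use Q in \<open>auto simp: Bm_cl_iff Qpsd_def intro: psd_det_nonzero_imp_pd\<close>)
qed

lemma AE_Jint_ge:
  fixes Q :: "nat \<Rightarrow> real^'m^'m"
  assumes Q: "Bm_cl n Q" and p: "ppos n p" and a: "Qsize n Q \<le> a"
  shows "AE \<theta> in circ. - (real CARD('m) + (1 + 2 * real n) * (ln (fact CARD('m)) + real CARD('m) * ln (1 + a)))
     \<le> Jint n p Q \<theta>"
  using Bm_cl_AE_pd[OF Q] AE_space
  by eventually_elim (rule Jint_ge[OF _ p _ a], simp_all)

section \<open>Coercivity of the moment pairing\<close>

text \<open>Only finitely many coordinates are involved, so refining the subsequence once per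
  coordinate is enough.\<close>

lemma bounded_convergent_subseq:
  fixes s :: "nat \<Rightarrow> nat \<Rightarrow> 'a::heine_borel"
  assumes "\<And>k. k < K \<Longrightarrow> bounded (range (\<lambda>j. s j k))"
  shows "\<exists>r::nat\<Rightarrow>nat. strict_mono r \<and> (\<forall>k<K. convergent (\<lambda>j. s (r j) k))"
  using assms
proof (induction K)
  case 0
  then show ?case by (intro exI[of _ id]) (auto simp: strict_mono_def)
next
  case (Suc K)
  then obtain r :: "nat \<Rightarrow> nat" where r: "strict_mono r" "\<And>k. k < K \<Longrightarrow> convergent (\<lambda>j. s (r j) k)"
    by (metis less_SucI)
  have "bounded (range (\<lambda>j. s (r j) K))"
    using Suc.prems[of K] by (rule bounded_subset) auto
  then obtain l and q :: "nat \<Rightarrow> nat" where q: "strict_mono q" "((\<lambda>j. s (r j) K) \<circ> q) \<longlonglongrightarrow> l"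
    using bounded_imp_convergent_subsequence by blast
  have "convergent (\<lambda>j. s ((r \<circ> q) j) k)" if "k < Suc K" for k
  proof (cases "k = K")
    case True
    then show ?thesis using q(2) by (auto simp: o_def convergent_def)
  next
    case False
    then have "convergent (\<lambda>j. s (r j) k)" using r(2) that by simp
    then obtain l' where "(\<lambda>j. s (r j) k) \<longlonglongrightarrow> l'" unfolding convergent_def by blast
    from LIMSEQ_subseq_LIMSEQ[OF this q(1)] show ?thesis by (auto simp: o_def convergent_def)
  qed
  then show ?case using strict_mono_o[OF r(1) q(1)] by blast
qed

definition moment_pairing :: "nat \<Rightarrow> (nat \<Rightarrow> real^'m^'m) \<Rightarrow> (nat \<Rightarrow> real^'m^'m) \<Rightarrow> real" where
  "moment_pairing n R Q = (\<Sum>k=0..n. trace (transpose (Q k) ** R k))"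

lemma trace_transpose_mult:
  fixes A B :: "real^'m^'m"
  shows "trace (transpose A ** B) = (\<Sum>i\<in>UNIV. \<Sum>j\<in>UNIV. A $ i $ j * B $ i $ j)"
  unfolding trace_def matrix_matrix_mult_def transpose_def by simp (rule sum.swap)

lemma moment_pairing_eq:
  "moment_pairing n R Q = (\<Sum>k=0..n. \<Sum>i\<in>UNIV. \<Sum>j\<in>UNIV. Q k $ i $ j * R k $ i $ j)"
  unfolding moment_pairing_def trace_transpose_mult ..

lemma tendsto_moment_pairing:
  assumes "\<And>k. (\<lambda>j. s j k) \<longlonglongrightarrow> Q k"
  shows "(\<lambda>j. moment_pairing n R (s j)) \<longlonglongrightarrow> moment_pairing n R Q"
  unfolding moment_pairing_eq by (intro tendsto_intros assms)

lemma integrable_matrixI: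
  fixes F :: "'a \<Rightarrow> complex^'m^'m"
  assumes "\<And>i j. integrable M (\<lambda>x. F x $ i $ j)"
  shows "integrable M F"
proof -
  have bl: "bounded_linear (\<lambda>z::complex. axis i (axis j z) :: complex^'m^'m)" for i j
    unfolding linear_conv_bounded_linear[symmetric]
    by (rule linearI) (auto simp: vec_eq_iff axis_def)
  have "integrable M (\<lambda>x. \<Sum>i\<in>UNIV. \<Sum>j\<in>UNIV. axis i (axis j (F x $ i $ j)) :: complex^'m^'m)"
    by (intro Bochner_Integration.integrable_sum integrable_bounded_linear[OF bl] assms)
  moreover have "(\<Sum>i\<in>UNIV. \<Sum>j\<in>UNIV. axis i (axis j (F x $ i $ j))) = F x" for x
    by (simp add: vec_eq_iff axis_def if_distrib[of "\<lambda>v. v $ _"] sum.If_cases cong: if_cong)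
  ultimately show ?thesis by simp
qed

text \<open>The terms with frequencies k and -k each contribute one half of the trace of Q_k^T R_k,
  which absorbs the factor 1/2 in \<open>Qpoly\<close>. Symmetry of \<open>Q 0\<close> reconciles
  the transposition in the constant term.\<close>

lemma moment_pairing_integral:
  fixes R :: "nat \<Rightarrow> real^'m^'m" and \<Phi> :: "real \<Rightarrow> complex^'m^'m"
  assumes Phi_int: "integrable circ \<Phi>"
    and herm: "\<And>\<theta>. \<theta> \<in> {0..<2*pi} \<Longrightarrow> hermitian (\<Phi> \<theta>)"
    and mom: "\<And>k. k \<le> n \<Longrightarrow> (\<integral>\<theta>. (\<chi> i j. cis (\<theta> * real k) * \<Phi> \<theta> $ i $ j) /\<^sub>R (2*pi) \<partial>circ)
                  = (\<chi> i j. complex_of_real (R k $ i $ j))"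
    and sym: "transpose (Q 0) = Q 0"
  shows "has_bochner_integral circ (\<lambda>\<theta>. \<Sum>i\<in>UNIV. \<Sum>j\<in>UNIV. Qpoly n Q \<theta> $ i $ j * \<Phi> \<theta> $ j $ i)
     (complex_of_real (2 * pi * moment_pairing n R Q))"
proof -
  have bl: "bounded_linear (\<lambda>A::complex^'m^'m. A $ i $ j)" for i j
    by (intro bounded_linear_compose[OF bounded_linear_vec_nth bounded_linear_vec_nth])
  have ent: "integrable circ (\<lambda>\<theta>. \<Phi> \<theta> $ i $ j)" for i j
    by (rule integrable_bounded_linear[OF bl Phi_int])
  have cisint: "integrable circ (\<lambda>\<theta>. cis (\<theta> * real k) * \<Phi> \<theta> $ i $ j)" for k i j
  proof (rule Bochner_Integration.integrable_bound[OF ent[of i j]])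
    have "(\<lambda>\<theta>. cis (\<theta> * real k)) \<in> borel_measurable circ"
      by (intro circ_measurable_continuous trigpoly_continuous) auto
    then show "(\<lambda>\<theta>. cis (\<theta> * real k) * \<Phi> \<theta> $ i $ j) \<in> borel_measurable circ"
      using ent[of i j] by (intro borel_measurable_times) auto
  qed (simp add: norm_mult)
  have pos: "has_bochner_integral circ (\<lambda>\<theta>. cis (\<theta> * real k) * \<Phi> \<theta> $ i $ j) (complex_of_real (2 * pi * R k $ i $ j))"
    if k: "k \<le> n" for k i j
  proof -
    define F where "F \<theta> = ((\<chi> i j. cis (\<theta> * real k) * \<Phi> \<theta> $ i $ j) /\<^sub>R (2*pi) :: complex^'m^'m)" for \<theta>
    have "integrable circ F"
      unfolding F_def
      by (intro integrable_matrixI integrable_scaleR_right) (simp add: cisint)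
    then have "(\<integral>\<theta>. F \<theta> $ i $ j \<partial>circ) = (\<integral>\<theta>. F \<theta> \<partial>circ) $ i $ j"
      by (rule integral_bounded_linear[OF bl])
    also have "\<dots> = complex_of_real (R k $ i $ j)"
    proof -
      have "(\<integral>\<theta>. F \<theta> \<partial>circ) = (\<chi> i j. complex_of_real (R k $ i $ j))"
        unfolding F_def by (rule mom[OF k])
      then show ?thesis by simp
    qed
    finally have "(\<integral>\<theta>. cis (\<theta> * real k) * \<Phi> \<theta> $ i $ j \<partial>circ) /\<^sub>R (2*pi) = complex_of_real (R k $ i $ j)"
      by (simp add: F_def)
    then have "(2 * pi) *\<^sub>R ((\<integral>\<theta>. cis (\<theta> * real k) * \<Phi> \<theta> $ i $ j \<partial>circ) /\<^sub>R (2*pi))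
        = (2 * pi) *\<^sub>R complex_of_real (R k $ i $ j)"
      by (rule arg_cong)
    then have "(\<integral>\<theta>. cis (\<theta> * real k) * \<Phi> \<theta> $ i $ j \<partial>circ) = (2 * pi) *\<^sub>R complex_of_real (R k $ i $ j)"
      unfolding scaleR_scaleR by (simp del: scaleR_left_commute)
    then show ?thesis
      using cisint[of k i j] unfolding has_bochner_integral_iff by (simp add: scaleR_conv_of_real)
  qed
  \<comment> \<open>Negative moments follow by conjugation: \<open>R k\<close> is real, and
    conjugating \<Phi> swaps its indices.\<close>
  have neg: "has_bochner_integral circ (\<lambda>\<theta>. cis (- \<theta> * real k) * \<Phi> \<theta> $ j $ i) (complex_of_real (2 * pi * R k $ i $ j))"
    if k: "k \<le> n" for k i j
  proof -
    have "has_bochner_integral circ (\<lambda>\<theta>. cnj (cis (\<theta> * real k) * \<Phi> \<theta> $ i $ j)) (cnj (complex_of_real (2 * pi * R k $ i $ j)))"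
      by (rule has_bochner_integral_bounded_linear[OF bounded_linear_cnj pos[OF k]])
    moreover have "cnj (cis (\<theta> * real k) * \<Phi> \<theta> $ i $ j) = cis (- \<theta> * real k) * \<Phi> \<theta> $ j $ i"
      if "\<theta> \<in> space circ" for \<theta>
      using that hermitianD[OF herm] by (simp add: cis_cnj)
    ultimately show ?thesis by (subst has_bochner_integral_cong[OF refl _ refl]) auto
  qed
  have zero: "has_bochner_integral circ (\<lambda>\<theta>. \<Phi> \<theta> $ j $ i) (complex_of_real (2 * pi * R 0 $ j $ i))" for i j
    using pos[of 0 j i] by simp
  have tm: "has_bochner_integral circ (\<lambda>\<theta>. Qpoly n Q \<theta> $ i $ j * \<Phi> \<theta> $ j $ i)
     (complex_of_real (Q 0 $ i $ j) * complex_of_real (2 * pi * R 0 $ j $ i) +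
       (\<Sum>k=1..n. complex_of_real (Q k $ i $ j / 2) * complex_of_real (2 * pi * R k $ i $ j)
               + complex_of_real (Q k $ j $ i / 2) * complex_of_real (2 * pi * R k $ j $ i)))" for i j
  proof -
    have "has_bochner_integral circ (\<lambda>\<theta>. complex_of_real (Q 0 $ i $ j) * \<Phi> \<theta> $ j $ i +
       (\<Sum>k=1..n. complex_of_real (Q k $ i $ j / 2) * (cis (- \<theta> * real k) * \<Phi> \<theta> $ j $ i)
               + complex_of_real (Q k $ j $ i / 2) * (cis (\<theta> * real k) * \<Phi> \<theta> $ j $ i)))
     (complex_of_real (Q 0 $ i $ j) * complex_of_real (2 * pi * R 0 $ j $ i) +
       (\<Sum>k=1..n. complex_of_real (Q k $ i $ j / 2) * complex_of_real (2 * pi * R k $ i $ j)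
               + complex_of_real (Q k $ j $ i / 2) * complex_of_real (2 * pi * R k $ j $ i)))"
      by (intro has_bochner_integral_add has_bochner_integral_sum has_bochner_integral_mult_right
          zero pos neg) auto
    moreover have "complex_of_real (Q 0 $ i $ j) * \<Phi> \<theta> $ j $ i +
       (\<Sum>k=1..n. complex_of_real (Q k $ i $ j / 2) * (cis (- \<theta> * real k) * \<Phi> \<theta> $ j $ i)
               + complex_of_real (Q k $ j $ i / 2) * (cis (\<theta> * real k) * \<Phi> \<theta> $ j $ i))
      = Qpoly n Q \<theta> $ i $ j * \<Phi> \<theta> $ j $ i" for \<theta>
      by (simp add: Qpoly_def distrib_right sum_distrib_left sum_distrib_right mult.assoc add_divide_distrib)
    ultimately show ?thesis by simp
  qed
  have "has_bochner_integral circ (\<lambda>\<theta>. \<Sum>i\<in>UNIV. \<Sum>j\<in>UNIV. Qpoly n Q \<theta> $ i $ j * \<Phi> \<theta> $ j $ i)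
     (\<Sum>i\<in>UNIV. \<Sum>j\<in>UNIV. complex_of_real (Q 0 $ i $ j) * complex_of_real (2 * pi * R 0 $ j $ i) +
       (\<Sum>k=1..n. complex_of_real (Q k $ i $ j / 2) * complex_of_real (2 * pi * R k $ i $ j)
               + complex_of_real (Q k $ j $ i / 2) * complex_of_real (2 * pi * R k $ j $ i)))"
    by (intro has_bochner_integral_sum tm)
  moreover have "(\<Sum>i\<in>UNIV. \<Sum>j\<in>UNIV. Q 0 $ i $ j * (2 * pi * R 0 $ j $ i) +
       (\<Sum>k=1..n. Q k $ i $ j / 2 * (2 * pi * R k $ i $ j) + Q k $ j $ i / 2 * (2 * pi * R k $ j $ i)))
     = 2 * pi * moment_pairing n R Q"
  proof -
    let ?S = "\<lambda>k. \<Sum>i\<in>UNIV. \<Sum>j\<in>UNIV. Q k $ i $ j * R k $ i $ j"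
    have S': "(\<Sum>i\<in>UNIV. \<Sum>j\<in>UNIV. Q k $ j $ i * R k $ j $ i) = ?S k" for k
      by (rule sum.swap)
    have "(\<Sum>i\<in>UNIV. \<Sum>j\<in>UNIV. Q 0 $ i $ j * R 0 $ j $ i) = ?S 0"
      unfolding S'[symmetric] using transpose_entry[OF sym] by (metis (no_types, lifting) sum.cong)
    moreover have "(\<Sum>i\<in>UNIV. \<Sum>j\<in>UNIV. Q 0 $ i $ j * (2 * pi * R 0 $ j $ i))
        = 2 * pi * (\<Sum>i\<in>UNIV. \<Sum>j\<in>UNIV. Q 0 $ i $ j * R 0 $ j $ i)"
      by (simp add: sum_distrib_left mult_ac)
    ultimately have a: "(\<Sum>i\<in>UNIV. \<Sum>j\<in>UNIV. Q 0 $ i $ j * (2 * pi * R 0 $ j $ i)) = 2 * pi * ?S 0"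
      by simp
    have "(\<Sum>i\<in>UNIV. \<Sum>j\<in>UNIV. \<Sum>k=1..n. Q k $ i $ j / 2 * (2 * pi * R k $ i $ j) + Q k $ j $ i / 2 * (2 * pi * R k $ j $ i))
      = (\<Sum>k=1..n. \<Sum>i\<in>UNIV. \<Sum>j\<in>UNIV. Q k $ i $ j / 2 * (2 * pi * R k $ i $ j) + Q k $ j $ i / 2 * (2 * pi * R k $ j $ i))"
      by (rule trans[OF sum.cong[OF refl sum.swap] sum.swap])
    also have "\<dots> = (\<Sum>k=1..n. 2 * pi * ?S k)"
    proof (rule sum.cong[OF refl])
      fix k
      have "(\<Sum>i\<in>UNIV. \<Sum>j\<in>UNIV. Q k $ i $ j / 2 * (2 * pi * R k $ i $ j) + Q k $ j $ i / 2 * (2 * pi * R k $ j $ i))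
        = pi * ?S k + pi * (\<Sum>i\<in>UNIV. \<Sum>j\<in>UNIV. Q k $ j $ i * R k $ j $ i)"
        by (simp add: sum.distrib sum_distrib_left mult_ac)
      then show "(\<Sum>i\<in>UNIV. \<Sum>j\<in>UNIV. Q k $ i $ j / 2 * (2 * pi * R k $ i $ j) + Q k $ j $ i / 2 * (2 * pi * R k $ j $ i))
        = 2 * pi * ?S k"
        by (simp add: S')
    qed
    finally have b: "(\<Sum>i\<in>UNIV. \<Sum>j\<in>UNIV. \<Sum>k=1..n. Q k $ i $ j / 2 * (2 * pi * R k $ i $ j) + Q k $ j $ i / 2 * (2 * pi * R k $ j $ i))
      = (\<Sum>k=1..n. 2 * pi * ?S k)" .
    have "moment_pairing n R Q = ?S 0 + (\<Sum>k=1..n. ?S k)"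
      unfolding moment_pairing_eq by (simp add: sum.atLeast_Suc_atMost)
    then show ?thesis using a b by (simp add: sum.distrib distrib_left sum_distrib_left)
  qed
  then have "(\<Sum>i\<in>UNIV. \<Sum>j\<in>UNIV. complex_of_real (Q 0 $ i $ j) * complex_of_real (2 * pi * R 0 $ j $ i) +
       (\<Sum>k=1..n. complex_of_real (Q k $ i $ j / 2) * complex_of_real (2 * pi * R k $ i $ j)
               + complex_of_real (Q k $ j $ i / 2) * complex_of_real (2 * pi * R k $ j $ i)))
     = complex_of_real (2 * pi * moment_pairing n R Q)"
    by (simp only: of_real_sum[symmetric] of_real_mult[symmetric] of_real_add[symmetric])
  ultimately show ?thesis by simp
qed

lemma Qpoly_eq_zero_imp:
  fixes Q :: "nat \<Rightarrow> real^'m^'m"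
  assumes zero: "\<And>\<theta>. \<theta> \<in> X \<Longrightarrow> Qpoly n Q \<theta> = 0" and X: "X \<subseteq> {0..<2*pi}" "infinite X" and k: "k \<le> n"
  shows "Q k = 0"
proof -
  have "Q k $ i $ j = 0" for i j
  proof -
    have z: "complex_of_real (Q 0 $ i $ j) + (\<Sum>k=1..n. complex_of_real (Q k $ i $ j / 2) * cis (- \<theta> * real k)
         + complex_of_real (Q k $ j $ i / 2) * cis (\<theta> * real k)) = 0" if "\<theta> \<in> X" for \<theta>
    proof -
      have "Qpoly n Q \<theta> $ i $ j = 0" using zero[OF that] by simp
      then show ?thesis by (simp add: Qpoly_def sum_distrib_left distrib_left mult.assoc)
    qed
    show ?thesis
      using laurent_coeffs_zero[OF z X] k by (cases "k = 0") auto
  qed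
  then show ?thesis by (simp add: vec_eq_iff)
qed

text \<open>The integrand is the trace of a product of semidefinite matrices. If its integral is 0
  it vanishes almost everywhere, which forces the polynomial to vanish wherever \<Phi> is definite,
  hence at infinitely many points.\<close>

lemma moment_pairing_nonneg:
  fixes R :: "nat \<Rightarrow> real^'m^'m" and \<Phi> :: "real \<Rightarrow> complex^'m^'m"
  assumes Phi_int: "integrable circ \<Phi>"
    and psd: "\<And>\<theta>. \<theta> \<in> {0..<2*pi} \<Longrightarrow> herm_psd (\<Phi> \<theta>)"
    and mom: "\<And>k. k \<le> n \<Longrightarrow> (\<integral>\<theta>. (\<chi> i j. cis (\<theta> * real k) * \<Phi> \<theta> $ i $ j) /\<^sub>R (2*pi) \<partial>circ)
                  = (\<chi> i j. complex_of_real (R k $ i $ j))"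
    and Q: "Qpsd n Q"
  shows "0 \<le> moment_pairing n R Q"
    and "0 \<le> a \<Longrightarrow> a < b \<Longrightarrow> b \<le> 2*pi \<Longrightarrow> (\<And>\<theta>. \<theta> \<in> {a<..<b} \<Longrightarrow> herm_pd (\<Phi> \<theta>))
      \<Longrightarrow> moment_pairing n R Q = 0 \<Longrightarrow> Qsize n Q = 0"
proof -
  let ?T = "\<lambda>\<theta>. \<Sum>i\<in>UNIV. \<Sum>j\<in>UNIV. Qpoly n Q \<theta> $ i $ j * \<Phi> \<theta> $ j $ i"
  have hb: "has_bochner_integral circ ?T (complex_of_real (2 * pi * moment_pairing n R Q))"
    using psd Q by (intro moment_pairing_integral[OF Phi_int _ mom]) (auto simp: herm_psd_def Qpsd_def)
  have hr: "has_bochner_integral circ (\<lambda>\<theta>. Re (?T \<theta>)) (2 * pi * moment_pairing n R Q)"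
    using has_bochner_integral_bounded_linear[OF bounded_linear_Re hb] by simp
  have nn: "AE \<theta> in circ. 0 \<le> Re (?T \<theta>)"
    using psd Q by (intro AE_I2 psd_trace_product(1)) (auto simp: Qpsd_def)
  have "0 \<le> (\<integral>\<theta>. Re (?T \<theta>) \<partial>circ)" using nn by (rule integral_nonneg_AE)
  then have "0 \<le> 2 * pi * moment_pairing n R Q" using hr by (simp add: has_bochner_integral_iff)
  then show "0 \<le> moment_pairing n R Q" using pi_gt_zero by (auto simp: zero_le_mult_iff simp del: pi_gt_zero)
  assume ab: "0 \<le> a" "a < b" "b \<le> 2*pi" and pd: "\<And>\<theta>. \<theta> \<in> {a<..<b} \<Longrightarrow> herm_pd (\<Phi> \<theta>)"
    and L0: "moment_pairing n R Q = 0"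
  have "AE \<theta> in circ. Re (?T \<theta>) = 0"
    using integral_nonneg_eq_0_iff_AE[OF _ nn] hr L0 by (simp add: has_bochner_integral_iff)
  then have z: "AE \<theta> in circ. \<theta> \<in> {a<..<b} \<longrightarrow> Qpoly n Q \<theta> = 0"
    using AE_space
  proof eventually_elim
    case (elim \<theta>)
    show ?case
    proof (intro impI, rule ccontr)
      assume "\<theta> \<in> {a<..<b}" "Qpoly n Q \<theta> \<noteq> 0"
      then have "0 < Re (?T \<theta>)"
        using elim psd Q pd by (intro psd_trace_product(2)) (auto simp: Qpsd_def)
      then show False using elim by simp
    qed
  qed
  define X where "X = {\<theta> \<in> {a<..<b}. Qpoly n Q \<theta> = 0}"
  \<comment> \<open>Otherwise almost every angle would avoid the interval, which has positive
    length.\<close>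
  have inf: "infinite X"
  proof
    assume "finite X"
    then have "finite {\<theta> \<in> {0..<2*pi}. \<theta> \<in> X}" by simp
    then have "AE \<theta> in circ. \<theta> \<notin> X" by (rule AE_circ_finite)
    with z have "AE \<theta> in circ. \<theta> \<notin> {a<..<b}" by eventually_elim (auto simp: X_def)
    then have "AE \<theta> in lborel. \<theta> \<notin> {a<..<b}"
      unfolding AE_circ_iff by eventually_elim (use ab in auto)
    then have "{a<..<b} \<in> null_sets lborel" by (subst (asm) AE_iff_null_sets[symmetric]) auto
    then show False using ab by (auto simp: null_sets_def)
  qed
  have "Q k = 0" if "k \<le> n" for k
    by (rule Qpoly_eq_zero_imp[OF _ _ inf that]) (use ab in \<open>auto simp: X_def\<close>)
  then show "Qsize n Q = 0" by (simp add: Qsize_def)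
qed

lemma Qpoly_scale:
  "Qpoly n (\<lambda>k. t *\<^sub>R Q k) \<theta> = (\<chi> i j. complex_of_real t * Qpoly n Q \<theta> $ i $ j)"
  by (simp add: Qpoly_def vec_eq_iff sum_distrib_left algebra_simps)

lemma Qpsd_scale:
  fixes Q :: "nat \<Rightarrow> real^'m^'m"
  assumes "Qpsd n Q" "t \<ge> 0" shows "Qpsd n (\<lambda>k. t *\<^sub>R Q k)"
proof -
  have "transpose (t *\<^sub>R Q 0) = t *\<^sub>R Q 0"
  proof -
    have "transpose (t *\<^sub>R Q 0) = t *\<^sub>R transpose (Q 0)" by (simp add: vec_eq_iff transpose_def)
    then show ?thesis using assms unfolding Qpsd_def by simp
  qed
  moreover have "cquad (Qpoly n (\<lambda>k. t *\<^sub>R Q k) \<theta>) v = complex_of_real t * cquad (Qpoly n Q \<theta>) v" for \<theta> v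
    unfolding Qpoly_scale by (simp add: cquad_def sum_distrib_left mult_ac)
  ultimately show ?thesis
    using assms Qpoly_hermitian[of "\<lambda>k. t *\<^sub>R Q k" n] by (auto simp: Qpsd_def herm_psd_def)
qed

text \<open>Compactness: a failing sequence, rescaled to \<open>Qsize\<close> 1 within the closed
  cone \<open>Qpsd\<close>, has a limit of size 1 with pairing 0, contrary to the definiteness just
  shown. The constant is therefore not explicit.\<close>

lemma moment_pairing_coercive:
  fixes R :: "nat \<Rightarrow> real^'m^'m" and \<Phi> :: "real \<Rightarrow> complex^'m^'m"
  assumes Phi_int: "integrable circ \<Phi>"
    and psd: "\<And>\<theta>. \<theta> \<in> {0..<2*pi} \<Longrightarrow> herm_psd (\<Phi> \<theta>)"
    and mom: "\<And>k. k \<le> n \<Longrightarrow> (\<integral>\<theta>. (\<chi> i j. cis (\<theta> * real k) * \<Phi> \<theta> $ i $ j) /\<^sub>R (2*pi) \<partial>circ)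
                  = (\<chi> i j. complex_of_real (R k $ i $ j))"
    and ab: "0 \<le> a" "a < b" "b \<le> 2*pi" and pd: "\<And>\<theta>. \<theta> \<in> {a<..<b} \<Longrightarrow> herm_pd (\<Phi> \<theta>)"
  shows "\<exists>c0>0. \<forall>Q. Qpsd n Q \<longrightarrow> c0 * Qsize n Q \<le> moment_pairing n R Q"
proof (rule ccontr)
  note nonneg = moment_pairing_nonneg[OF Phi_int psd mom]
  assume neg: "\<not> ?thesis"
  have "\<exists>Q. Qpsd n Q \<and> moment_pairing n R Q < (1 / real (Suc j)) * Qsize n Q" for j
  proof -
    have "1 / real (Suc j) > 0" by simp
    then show ?thesis using neg by (meson not_le)
  qed
  then obtain S where S: "\<And>j. Qpsd n (S j)" "\<And>j. moment_pairing n R (S j) < (1 / real (Suc j)) * Qsize n (S j)"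
    by metis
  have pos: "Qsize n (S j) > 0" for j
    using nonneg(1)[OF _ _ S(1)[of j]] S(2)[of j] Qsize_nonneg[of n "S j"]
    by (cases "Qsize n (S j) = 0") auto
  define T where "T j = (\<lambda>k. (1 / Qsize n (S j)) *\<^sub>R S j k)" for j
  have T: "Qpsd n (T j)" for j unfolding T_def using S(1) pos[of j] by (intro Qpsd_scale) auto
  have T1: "Qsize n (T j) = 1" for j
  proof -
    have "Qsize n (T j) = (1 / Qsize n (S j)) * Qsize n (S j)"
      unfolding T_def using pos[of j] by (simp add: Qsize_def flip: sum_divide_distrib)
    then show ?thesis using pos[of j] by simp
  qed
  have TL: "moment_pairing n R (T j) \<le> 1 / real (Suc j)" for j
  proof -
    have "moment_pairing n R (T j) = (1 / Qsize n (S j)) * moment_pairing n R (S j)"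
      unfolding T_def by (simp add: moment_pairing_eq sum_divide_distrib)
    also have "\<dots> \<le> (1 / Qsize n (S j)) * ((1 / real (Suc j)) * Qsize n (S j))"
      using S(2)[of j] pos[of j] by (intro mult_left_mono) auto
    finally show ?thesis using pos[of j] by simp
  qed
  have bd: "bounded (range (\<lambda>j. T j k))" if "k < Suc n" for k
  proof -
    have "norm (T j k) \<le> 1" for j
      using member_le_sum[of k "{..n}" "\<lambda>k. norm (T j k)"] that T1[of j] by (simp add: Qsize_def)
    then show ?thesis by (auto simp: bounded_iff)
  qed
  obtain r :: "nat \<Rightarrow> nat" where r: "strict_mono r" "\<And>k. k < Suc n \<Longrightarrow> convergent (\<lambda>j. T (r j) k)"
    using bounded_convergent_subseq[of "Suc n" T] bd by blast
  define Q where "Q k = lim (\<lambda>j. T (r j) k)" for k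
  have lim: "(\<lambda>j. T (r j) k) \<longlonglongrightarrow> Q k" for k
  proof (cases "k < Suc n")
    case True
    then show ?thesis using r(2) unfolding Q_def convergent_LIMSEQ_iff by blast
  next
    case False
    then have "(\<lambda>j. T (r j) k) = (\<lambda>_. 0)" using T unfolding Qpsd_def by auto
    then show ?thesis by (simp add: Q_def)
  qed
  have Q: "Qpsd n Q" using T lim by (rule Qpsd_limit)
  have "(\<lambda>j. Qsize n (T (r j))) \<longlonglongrightarrow> Qsize n Q"
    unfolding Qsize_def by (intro tendsto_intros lim)
  then have Q1: "Qsize n Q = 1" by (simp add: T1 LIMSEQ_const_iff)
  have "moment_pairing n R Q \<le> 0"
  proof (rule LIMSEQ_le)
    show "(\<lambda>j. moment_pairing n R (T (r j))) \<longlonglongrightarrow> moment_pairing n R Q"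
      by (rule tendsto_moment_pairing[OF lim])
    show "(\<lambda>j. 1 / real (Suc (r j))) \<longlonglongrightarrow> 0"
      using LIMSEQ_subseq_LIMSEQ[OF LIMSEQ_Suc[OF lim_1_over_n] r(1)] by (simp add: o_def)
  qed (use TL in blast)
  then have "moment_pairing n R Q = 0" using nonneg(1)[OF _ _ Q] by simp
  then have "Qsize n Q = 0" using nonneg(2)[OF _ _ Q ab] pd by blast
  then show False using Q1 by simp
qed

section \<open>The objective function\<close>

text \<open>The left side is the minimum over g, attained at g = d / c; it comes from ln x <= x - 1
  at x = g c / d.\<close>

lemma linear_minus_log_lower:
  assumes "c > 0" "d > (0::real)" "g > 0"
  shows "d + d * ln (c / d) \<le> c * g - d * ln g"
proof -
  have "ln (g * (c / d)) \<le> g * (c / d) - 1" using assms by (intro ln_le_minus_one) auto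
  moreover have "ln (g * (c / d)) = ln g + ln (c / d)" using assms by (intro ln_mult_pos) auto
  ultimately have "d * (ln g + ln (c / d)) \<le> d * (g * (c / d) - 1)"
    using assms(2) by (intro mult_left_mono) linarith+
  also have "\<dots> = c * g - d" using assms by (simp add: field_simps)
  finally show ?thesis by (simp add: algebra_simps)
qed

text \<open>Half of the linear term pays for the logarithm and the other half bounds g above.
  Dropping the positive linear term altogether gives the lower bound. It serves both for the entries
  of \<gamma> and for the size of \<open>Q\<close>.\<close>

lemma linear_minus_log_bounded:
  assumes "c > 0" "d > (0::real)" "g > 0" "c * g - d * ln g \<le> B"
  shows "g \<le> 2 / c * (B - (d + d * ln (c / 2 / d)))" "exp (- B / d) \<le> g"
proof -
  have "d + d * ln (c / 2 / d) \<le> c / 2 * g - d * ln g"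
    using assms by (intro linear_minus_log_lower) auto
  then have "c / 2 * g \<le> B - (d + d * ln (c / 2 / d))" using assms(4) by simp
  then show "g \<le> 2 / c * (B - (d + d * ln (c / 2 / d)))" using assms(1) by (simp add: field_simps)
  have "- d * ln g \<le> B" using assms mult_pos_pos[of c g] by linarith
  then have "- B / d \<le> ln g" using assms(2) by (simp add: field_simps)
  then show "exp (- B / d) \<le> g" using assms(3) by (metis exp_le_cancel_iff exp_ln)
qed

text \<open>A maximum over a fixed finite index set is continuous in the family. The Boolean selects
  the entry or its transpose; index 0 occurs in one orientation only.\<close>

lemma qjh_image:
  "qjh n Q j h = Max ((\<lambda>(k, b). if b then \<bar>Q k $ j $ h\<bar> else \<bar>Q k $ h $ j\<bar>) ` (insert (0, True) ({1..n} \<times> UNIV)))"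
proof -
  have "{\<bar>Q 0 $ j $ h\<bar>} \<union> {\<bar>Q k $ j $ h\<bar> | k. k \<in> {1..n}} \<union> {\<bar>Q k $ h $ j\<bar> | k. k \<in> {1..n}}
    = (\<lambda>(k, b). if b then \<bar>Q k $ j $ h\<bar> else \<bar>Q k $ h $ j\<bar>) ` (insert (0, True) ({1..n} \<times> UNIV))"
  proof -
    have "{1..n} \<times> UNIV = (\<lambda>k. (k, True)) ` {1..n} \<union> (\<lambda>k. (k, False)) ` {1..n}"
      by (auto simp: image_iff)
    then show ?thesis by (simp add: image_Un image_image) auto
  qed
  then show ?thesis unfolding qjh_def by (rule arg_cong)
qed

lemma tendsto_Max_image:
  fixes f :: "'a \<Rightarrow> 'b \<Rightarrow> real"
  assumes "finite I" "I \<noteq> {}" "\<And>i. i \<in> I \<Longrightarrow> ((\<lambda>x. f x i) \<longlongrightarrow> g i) F"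
  shows "((\<lambda>x. Max (f x ` I)) \<longlongrightarrow> Max (g ` I)) F"
  using assms
proof (induction I rule: finite_ne_induct)
  case (insert i I)
  then have "((\<lambda>x. max (f x i) (Max (f x ` I))) \<longlongrightarrow> max (g i) (Max (g ` I))) F"
    by (intro tendsto_max) auto
  then show ?case using insert by simp
qed simp

lemma tendsto_qjh:
  assumes "\<And>k. (\<lambda>i. s i k) \<longlonglongrightarrow> Q k"
  shows "(\<lambda>i. qjh n (s i) j h) \<longlonglongrightarrow> qjh n Q j h"
  unfolding qjh_image
  by (rule tendsto_Max_image) (auto simp: split_beta intro!: tendsto_intros assms)

lemma qjh_nonneg: "0 \<le> qjh n Q j h"
  unfolding qjh_image by (rule Max_ge_iff[THEN iffD2]) auto

lemma qjh_perturb_le: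
  assumes "\<And>k a b. \<bar>Q' k $ a $ b\<bar> \<le> \<bar>Q k $ a $ b\<bar> + t"
  shows "qjh n Q' j h \<le> qjh n Q j h + t"
proof -
  let ?I = "insert (0, True) ({1..n} \<times> UNIV)"
  have *: "(if b then \<bar>Q' k $ j $ h\<bar> else \<bar>Q' k $ h $ j\<bar>) \<le> qjh n Q j h + t" if "(k, b) \<in> ?I" for k b
  proof -
    have "(if b then \<bar>Q k $ j $ h\<bar> else \<bar>Q k $ h $ j\<bar>) \<le> qjh n Q j h"
      unfolding qjh_image by (rule Max_ge) (use that in \<open>auto intro!: rev_image_eqI[of "(k, b)"]\<close>)
    then show ?thesis using assms[of k j h] assms[of k h j] by (auto split: if_splits)
  qed
  show ?thesis
    unfolding qjh_image[of n Q']
  proof (rule Max.boundedI)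
    fix y assume "y \<in> (\<lambda>(k, b). if b then \<bar>Q' k $ j $ h\<bar> else \<bar>Q' k $ h $ j\<bar>) ` ?I"
    then obtain x where x: "x \<in> ?I" "y = (\<lambda>(k, b). if b then \<bar>Q' k $ j $ h\<bar> else \<bar>Q' k $ h $ j\<bar>) x"
      by (rule imageE)
    obtain k b where "x = (k, b)" by (cases x)
    then show "y \<le> qjh n Q j h + t" using x *[of k b] by simp
  qed auto
qed

text \<open>All terms containing \<gamma>, merged into one sum over pairs so that every entry of
  \<gamma> can be confined separately.\<close>

definition penalty :: "nat \<Rightarrow> real \<Rightarrow> ('m::{finite,linorder} \<Rightarrow> 'm \<Rightarrow> real) \<Rightarrow> (nat \<Rightarrow> real^('m::{finite,linorder})^('m::{finite,linorder})) \<Rightarrow> real" where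
  "penalty n \<epsilon> \<gamma> Q = (\<Sum>(j,h)\<in>{(j,h). h \<le> j}. \<gamma> j h * (qjh n Q j h + \<epsilon>)
      - real (if h = j then n + 1 else 2 * n + 1) * ln (\<gamma> j h))"

lemma penalty_eq:
  fixes Q :: "nat \<Rightarrow> real^('m::{finite,linorder})^('m::{finite,linorder})"
  shows "hW n \<gamma> Q - (\<Sum>(j,h)\<in>{(j,h). h < j}. real (2*n+1) * ln (\<gamma> j h))
      - (\<Sum>j\<in>UNIV. real (n+1) * ln (\<gamma> j j)) + (\<Sum>(j,h)\<in>{(j,h). h \<le> j}. \<epsilon> * \<gamma> j h)
     = penalty n \<epsilon> \<gamma> Q"
proof -
  let ?D = "{(j::'m,h). h = j}" and ?S = "{(j::'m,h). h < j}"
  have U: "{(j::'m,h). h \<le> j} = ?S \<union> ?D" by auto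
  have dis: "?S \<inter> ?D = {}" by auto
  have D: "?D = (\<lambda>j. (j, j)) ` UNIV" by auto
  have pen: "penalty n \<epsilon> \<gamma> Q = hW n \<gamma> Q + (\<Sum>(j,h)\<in>{(j,h). h \<le> j}. \<epsilon> * \<gamma> j h)
      - (\<Sum>(j,h)\<in>{(j,h). h \<le> j}. real (if h = j then n + 1 else 2 * n + 1) * ln (\<gamma> j h))"
    unfolding penalty_def hW_def sum.distrib[symmetric] sum_subtractf[symmetric]
    by (rule sum.cong) (auto simp: algebra_simps)
  have "(\<Sum>(j,h)\<in>{(j,h). h \<le> j}. real (if h = j then n + 1 else 2 * n + 1) * ln (\<gamma> j h))
    = (\<Sum>(j,h)\<in>?S. real (if h = j then n + 1 else 2 * n + 1) * ln (\<gamma> j h))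
    + (\<Sum>(j,h)\<in>?D. real (if h = j then n + 1 else 2 * n + 1) * ln (\<gamma> j h))"
    unfolding U by (rule sum.union_disjoint) (auto simp: dis)
  also have "(\<Sum>(j,h)\<in>?S. real (if h = j then n + 1 else 2 * n + 1) * ln (\<gamma> j h))
    = (\<Sum>(j,h)\<in>?S. real (2*n+1) * ln (\<gamma> j h))"
    by (intro sum.cong) auto
  also have "(\<Sum>(j,h)\<in>?D. real (if h = j then n + 1 else 2 * n + 1) * ln (\<gamma> j h))
    = (\<Sum>j\<in>UNIV. real (n+1) * ln (\<gamma> j j))"
    unfolding D by (subst sum.reindex) (auto simp: inj_on_def)
  finally show ?thesis unfolding pen by linarith
qed

lemma ell_eq:
  "ell N \<kappa> lam \<epsilon> n R c p Q \<alpha> \<gamma> =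
    ereal (real N / (2*\<alpha>)) * (T_int (Jint n p Q) + ereal (moment_pairing n R Q - (\<Sum>k=0..n. p k * c k)))
    + ereal \<kappa> + ereal lam * T_int (\<lambda>\<theta>. inverse (ppoly n p \<theta>)) + ereal (penalty n \<epsilon> \<gamma> Q)"
  unfolding ell_def penalty_eq Jfun_def g_lam_def moment_pairing_def Jint_def[abs_def] ..

text \<open>The objective with \<open>A\<close> for N / (2 \<alpha>) and with real numbers
  \<open>t1\<close>, \<open>t2\<close> in place of the two integrals, so that limits are taken in
  the reals and an upper bound may replace an integral.\<close>

definition ell_value where
  "ell_value A \<kappa> lam \<epsilon> n R c p Q \<gamma> t1 t2 =
     A * (t1 + (moment_pairing n R Q - (\<Sum>k=0..n. p k * c k))) + \<kappa> + lam * t2 + penalty n \<epsilon> \<gamma> Q"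

lemma ell_le_value:
  assumes "T_int (Jint n p Q) \<le> ereal t1" "T_int (\<lambda>\<theta>. inverse (ppoly n p \<theta>)) \<le> ereal t2"
    and "\<alpha> > 0" "lam \<ge> 0"
  shows "ell N \<kappa> lam \<epsilon> n R c p Q \<alpha> \<gamma> \<le> ereal (ell_value (real N / (2*\<alpha>)) \<kappa> lam \<epsilon> n R c p Q \<gamma> t1 t2)"
proof -
  have "ereal (real N / (2*\<alpha>)) * (T_int (Jint n p Q) + ereal (moment_pairing n R Q - (\<Sum>k=0..n. p k * c k)))
     \<le> ereal (real N / (2*\<alpha>)) * (ereal t1 + ereal (moment_pairing n R Q - (\<Sum>k=0..n. p k * c k)))"
    using assms by (intro ereal_mult_left_mono add_right_mono) auto
  moreover have "ereal lam * T_int (\<lambda>\<theta>. inverse (ppoly n p \<theta>)) \<le> ereal lam * ereal t2"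
    using assms by (intro ereal_mult_left_mono) auto
  ultimately have "ell N \<kappa> lam \<epsilon> n R c p Q \<alpha> \<gamma> \<le>
     ereal (real N / (2*\<alpha>)) * (ereal t1 + ereal (moment_pairing n R Q - (\<Sum>k=0..n. p k * c k)))
     + ereal \<kappa> + ereal lam * ereal t2 + ereal (penalty n \<epsilon> \<gamma> Q)"
    unfolding ell_eq by (intro add_mono) auto
  then show ?thesis by (simp add: ell_value_def)
qed

text \<open>\<open>T_int\<close> never takes the value -\<infinity>, so an infinite integral cannot
  be cancelled; strictly positive weights are used because 0 * \<infinity> = 0 in
  \<open>ereal\<close>.\<close>

lemma ell_finite:
  assumes le: "ell N \<kappa> lam \<epsilon> n R c p Q \<alpha> \<gamma> \<le> ereal M"
    and pos: "\<alpha> > 0" "lam > 0" "N > 0"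
  obtains t1 t2 where "T_int (Jint n p Q) = ereal t1" "T_int (\<lambda>\<theta>. inverse (ppoly n p \<theta>)) = ereal t2"
    "ell N \<kappa> lam \<epsilon> n R c p Q \<alpha> \<gamma> = ereal (ell_value (real N / (2*\<alpha>)) \<kappa> lam \<epsilon> n R c p Q \<gamma> t1 t2)"
proof -
  have cases: "T_int f = \<infinity> \<or> (\<exists>t. T_int f = ereal t)" for f by (simp add: T_int_circ)
  have A: "real N / (2*\<alpha>) > 0" using pos by simp
  show thesis
  proof (cases "T_int (Jint n p Q) = \<infinity> \<or> T_int (\<lambda>\<theta>. inverse (ppoly n p \<theta>)) = \<infinity>")
    case True
    have "ell N \<kappa> lam \<epsilon> n R c p Q \<alpha> \<gamma> = \<infinity>"
      using True cases[of "Jint n p Q"] cases[of "\<lambda>\<theta>. inverse (ppoly n p \<theta>)"] A pos(2)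
      unfolding ell_eq by auto
    then show thesis using le by simp
  next
    case False
    then obtain t1 t2 where t: "T_int (Jint n p Q) = ereal t1" "T_int (\<lambda>\<theta>. inverse (ppoly n p \<theta>)) = ereal t2"
      using cases by blast
    show thesis by (rule that[OF t]) (simp add: ell_eq t ell_value_def)
  qed
qed

lemma AE_inverse_ppoly_nonneg:
  "ppos n p \<Longrightarrow> AE \<theta> in circ. - 0 \<le> inverse (ppoly n p \<theta>)"
  by (intro AE_I2) (auto simp: ppos_def)

lemma feasible_iff:
  "feasible n p Q \<gamma> \<longleftrightarrow> ppos n p \<and> Bm_cl n Q \<and> (\<forall>j h. h \<le> j \<longrightarrow> \<gamma> j h > 0)"
  unfolding feasible_def Bo_cl_iff ..

text \<open>Witness: \<open>p\<close> the constant 1, \<open>Q\<close> the constant identity and all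
  \<gamma> equal to 1, which makes both integrands constant.\<close>

lemma feasible_finite_point:
  fixes R :: "nat \<Rightarrow> real^('m::{finite,linorder})^('m::{finite,linorder})"
  assumes "\<alpha> > 0" "lam > 0"
  obtains p Q and \<gamma> :: "'m \<Rightarrow> 'm \<Rightarrow> real" and M where "feasible n p Q \<gamma>"
    "ell N \<kappa> lam \<epsilon> n R c p Q \<alpha> \<gamma> \<le> ereal M"
proof -
  define p :: "nat \<Rightarrow> real" where "p k = (if k = 0 then 1 else 0)" for k
  define Q :: "nat \<Rightarrow> real^('m::{finite,linorder})^('m::{finite,linorder})" where "Q k = (if k = 0 then mat 1 else 0)" for k
  define \<gamma> :: "'m \<Rightarrow> 'm \<Rightarrow> real" where "\<gamma> = (\<lambda>_ _. 1)"
  have p1: "ppoly n p \<theta> = 1" for \<theta> by (simp add: ppoly_def p_def)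
  have Q1: "Qpoly n Q \<theta> = mat 1" for \<theta> by (simp add: Qpoly_def Q_def vec_eq_iff mat_def)
  have "ppos n p" by (simp add: ppos_def p1) (simp add: p_def)
  moreover have "Bm_cl n Q"
    unfolding Bm_cl_iff Qpsd_def Q1 using herm_pd_imp_psd[OF mat_1_pd]
    by (auto simp: Q_def transpose_mat intro!: bexI[of _ 0])
  ultimately have f: "feasible n p Q \<gamma>" by (simp add: feasible_iff \<gamma>_def)
  have J: "Jint n p Q = (\<lambda>\<theta>. - real CARD('m))"
  proof
    show "Jint n p Q \<theta> = - real CARD('m)" for \<theta>
      by (subst Jint_eq) (simp_all add: Q1 mat_1_pd p1)
  qed
  have c: "T_int (\<lambda>\<theta>. x) \<le> ereal x" for x
    unfolding T_int_circ by (simp add: measure_circ)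
  have "T_int (Jint n p Q) \<le> ereal (- real CARD('m))" unfolding J by (rule c)
  moreover have "T_int (\<lambda>\<theta>. inverse (ppoly n p \<theta>)) \<le> ereal 1" unfolding p1 using c[of 1] by simp
  ultimately show thesis
    by (rule that[OF f ell_le_value]) (use assms in auto)
qed

section \<open>Pointwise limits of the entropy integrand\<close>

lemma det_Qpoly_tendsto:
  fixes Q :: "nat \<Rightarrow> real^'m^'m"
  assumes "\<And>k. (\<lambda>j. s j k) \<longlonglongrightarrow> Q k"
  shows "(\<lambda>j. Re (det (Qpoly n (s j) \<theta>))) \<longlonglongrightarrow> Re (det (Qpoly n Q \<theta>))"
  by (intro tendsto_Re tendsto_det tendsto_Qpoly assms)

lemma Jint_tendsto:
  fixes Q :: "nat \<Rightarrow> real^'m^'m"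
  assumes s: "\<And>k. (\<lambda>j. s j k) \<longlonglongrightarrow> Q k" "\<And>j. herm_pd (Qpoly n (s j) \<theta>)" "herm_pd (Qpoly n Q \<theta>)"
    and u: "\<And>k. (\<lambda>j. u j k) \<longlonglongrightarrow> p k" "\<And>j. 0 \<le> ppoly n (u j) \<theta>" "0 < ppoly n p \<theta>"
  shows "(\<lambda>j. Jint n (u j) (s j) \<theta>) \<longlonglongrightarrow> Jint n p Q \<theta>"
proof -
  have d: "Re (det (Qpoly n Q \<theta>)) > 0" by (rule pd_det_pos[OF s(3)])
  have "Jint n p Q \<theta> = real CARD('m) * (ppoly n p \<theta> * ln (ppoly n p \<theta>)) - real CARD('m) * ppoly n p \<theta>
     - ppoly n p \<theta> * ln (Re (det (Qpoly n Q \<theta>)))"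
    using u(3) by (intro Jint_eq[OF s(3)]) simp
  then show ?thesis
    unfolding Jint_eq[OF s(2) u(2)]
    using d u(3) by (auto intro!: tendsto_intros tendsto_ppoly u(1) det_Qpoly_tendsto s(1))
qed

text \<open>The determinants tend to 0 from above, so their negative logarithm diverges, and its
  weight has a positive limit.\<close>

lemma Jint_blowup:
  fixes Q :: "nat \<Rightarrow> real^'m^'m"
  assumes s: "\<And>k. (\<lambda>j. s j k) \<longlonglongrightarrow> Q k" "\<And>j. herm_pd (Qpoly n (s j) \<theta>)" "det (Qpoly n Q \<theta>) = 0"
    and u: "\<And>k. (\<lambda>j. u j k) \<longlonglongrightarrow> p k" "\<And>j. 0 \<le> ppoly n (u j) \<theta>" "0 < ppoly n p \<theta>"
  shows "filterlim (\<lambda>j. Jint n (u j) (s j) \<theta>) at_top sequentially"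
proof -
  let ?x = "\<lambda>j. ppoly n (u j) \<theta>" and ?d = "\<lambda>j. Re (det (Qpoly n (s j) \<theta>))"
  have x: "?x \<longlonglongrightarrow> ppoly n p \<theta>" by (rule tendsto_ppoly[OF u(1)])
  have "?d \<longlonglongrightarrow> 0" using det_Qpoly_tendsto[of s Q n \<theta>, OF s(1)] s(3) by simp
  then have "filterlim ?d (at_right 0) sequentially"
    using pd_det_pos[OF s(2)] by (intro tendsto_imp_filterlim_at_right) auto
  then have "filterlim (\<lambda>j. ln (?d j)) at_bot sequentially"
    by (rule filterlim_compose[OF ln_at_0])
  then have "filterlim (\<lambda>j. - ln (?d j)) at_top sequentially"
    by (simp add: filterlim_uminus_at_bot)
  then have "filterlim (\<lambda>j. ?x j * - ln (?d j)) at_top sequentially"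
    by (rule filterlim_tendsto_pos_mult_at_top[OF x u(3)])
  moreover have "(\<lambda>j. real CARD('m) * (?x j * ln (?x j)) - real CARD('m) * ?x j) \<longlonglongrightarrow>
      real CARD('m) * (ppoly n p \<theta> * ln (ppoly n p \<theta>)) - real CARD('m) * ppoly n p \<theta>"
    using u(3) by (intro tendsto_intros x) auto
  ultimately have "filterlim (\<lambda>j. (real CARD('m) * (?x j * ln (?x j)) - real CARD('m) * ?x j) + ?x j * - ln (?d j))
      at_top sequentially"
    by (intro filterlim_tendsto_add_at_top)
  then show ?thesis unfolding Jint_eq[OF s(2) u(2)] by simp
qed

section \<open>Existence of a minimizer\<close>

text \<open>One subsequence makes the coefficients, \<gamma> and the values of both integrals
  converge. The integrals are only lower semicontinuous, hence the inequality in the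
  conclusion.\<close>

lemma ell_sublevel_limit:
  fixes R :: "nat \<Rightarrow> real^('m::{finite,linorder})^('m::{finite,linorder})"
    and q :: "nat \<Rightarrow> nat \<Rightarrow> real^('m::{finite,linorder})^('m::{finite,linorder})"
    and g :: "nat \<Rightarrow> 'm \<Rightarrow> 'm \<Rightarrow> real"
  assumes pos: "\<alpha> > 0" "lam > 0" "\<epsilon> > 0" "N > 0"
    and c0: "c0 > 0" "\<And>Q. Qpsd n Q \<Longrightarrow> c0 * Qsize n Q \<le> moment_pairing n R Q"
    and feas: "\<And>j. feasible n (u j) (q j) (g j)"
    and le: "\<And>j. ell N \<kappa> lam \<epsilon> n R c (u j) (q j) \<alpha> (g j) \<le> ereal M"
    and lim: "(\<lambda>j. ell N \<kappa> lam \<epsilon> n R c (u j) (q j) \<alpha> (g j)) \<longlonglongrightarrow> I"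
  shows "\<exists>p Q \<gamma>. feasible n p Q \<gamma> \<and> ell N \<kappa> lam \<epsilon> n R c p Q \<alpha> \<gamma> \<le> I"
proof -
  define A where "A = real N / (2*\<alpha>)"
  have A: "A > 0" using pos by (simp add: A_def)
  define E where "E p Q \<gamma> t1 t2 = ell_value A \<kappa> lam \<epsilon> n R c p Q \<gamma> t1 t2" for p Q and \<gamma> :: "'m \<Rightarrow> 'm \<Rightarrow> real" and t1 t2
  have "\<exists>t1 t2. T_int (Jint n (u j) (q j)) = ereal t1 \<and> T_int (\<lambda>\<theta>. inverse (ppoly n (u j) \<theta>)) = ereal t2 \<and>
    ell N \<kappa> lam \<epsilon> n R c (u j) (q j) \<alpha> (g j) = ereal (E (u j) (q j) (g j) t1 t2)" for j
    using ell_finite[OF le[of j] pos(1,2,4)] unfolding E_def A_def by metis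
  then obtain t1 t2 where t1: "\<And>j. T_int (Jint n (u j) (q j)) = ereal (t1 j)"
    and t2: "\<And>j. T_int (\<lambda>\<theta>. inverse (ppoly n (u j) \<theta>)) = ereal (t2 j)"
    and ellE: "\<And>j. ell N \<kappa> lam \<epsilon> n R c (u j) (q j) \<alpha> (g j) = ereal (E (u j) (q j) (g j) (t1 j) (t2 j))"
    by metis
  have u: "ppos n (u j)" and q: "Bm_cl n (q j)" and g: "\<And>x y. y \<le> x \<Longrightarrow> g j x y > 0" for j
    using feas[of j] unfolding feasible_iff by auto
  have qpsd: "Qpsd n (q j)" for j using q[of j] unfolding Bm_cl_iff by blast
  have EM: "E (u j) (q j) (g j) (t1 j) (t2 j) \<le> M" for j using le[of j] unfolding ellE by simp

  text \<open>Every summand of the objective is bounded below, hence on a sublevel set also above.\<close>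
  define P where "P = 1 + 2 * real n"
  define K2 where "K2 = P * real CARD('m)"
  define K1 where "K1 = real CARD('m) + P * ln (fact CARD('m))"
  have K2: "K2 > 0" unfolding K2_def P_def by (simp add: add_pos_nonneg)
  have t1_lb: "- K1 - K2 * ln (1 + a) \<le> t1 j" if "Qsize n (q j) \<le> a" for a j
    using T_int_ge[OF AE_Jint_ge[OF q[of j] u[of j] that]]
    by (simp add: t1 K1_def K2_def P_def algebra_simps)
  have t2_lb: "0 \<le> t2 j" for j
    using T_int_ge[OF AE_inverse_ppoly_nonneg[OF u[of j]]] by (simp add: t2)
  define C where "C = (\<Sum>k=0..n. 2 * \<bar>c k\<bar>)"
  have C: "(\<Sum>k=0..n. u j k * c k) \<le> C" for j
    unfolding C_def
  proof (rule sum_mono)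
    fix k
    have "\<bar>u j k\<bar> * \<bar>c k\<bar> \<le> 2 * \<bar>c k\<bar>" by (intro mult_right_mono ppos_coeff_bound[OF u]) simp
    then show "u j k * c k \<le> 2 * \<bar>c k\<bar>" using abs_ge_self[of "u j k * c k"] by (simp add: abs_mult)
  qed
  define dd where "dd x y = real (if y = x then n + 1 else 2 * n + 1)" for x y :: 'm
  have dd: "dd x y > 0" for x y by (simp add: dd_def)
  define pt where "pt j x y = g j x y * (qjh n (q j) x y + \<epsilon>) - dd x y * ln (g j x y)" for j and x y :: 'm
  have pen: "penalty n \<epsilon> (g j) (q j) = (\<Sum>(x,y)\<in>{(x,y). y \<le> x}. pt j x y)" for j
    by (simp add: penalty_def pt_def dd_def)
  have pt_ge: "\<epsilon> * g j x y - dd x y * ln (g j x y) \<le> pt j x y" if "y \<le> x" for j x y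
    using mult_nonneg_nonneg[OF less_imp_le[OF g[OF that, of j]] qjh_nonneg[of n "q j" x y]]
    by (simp add: pt_def algebra_simps)
  \<comment> \<open>The minimum of \<epsilon> g - d ln g over positive g, with d =
    \<open>dd x y\<close>.\<close>
  define lo where "lo x y = dd x y + dd x y * ln (\<epsilon> / dd x y)" for x y :: 'm
  have lo: "lo x y \<le> pt j x y" if "y \<le> x" for j x y
    using linear_minus_log_lower[OF pos(3) dd[of x y] g[OF that, of j]] pt_ge[OF that, of j]
    by (simp add: lo_def)
  define LO where "LO = (\<Sum>(x,y)\<in>{(x::'m,y). y \<le> x}. lo x y)"
  have LO: "LO \<le> penalty n \<epsilon> (g j) (q j)" for j
    unfolding pen LO_def by (rule sum_mono) (use lo in auto)
  have J_lb: "c0 * Qsize n (q j) - K2 * ln (1 + Qsize n (q j)) - K1 - C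
      \<le> t1 j + (moment_pairing n R (q j) - (\<Sum>k=0..n. u j k * c k))" for j
    using t1_lb[OF order_refl, of j] c0(2)[OF qpsd[of j]] C[of j] by linarith
  have E_split: "A * (t1 j + (moment_pairing n R (q j) - (\<Sum>k=0..n. u j k * c k)))
      + \<kappa> + lam * t2 j + penalty n \<epsilon> (g j) (q j) \<le> M" for j
    using EM[of j] by (simp add: E_def ell_value_def)
  have lt2: "0 \<le> lam * t2 j" for j using t2_lb[of j] pos by simp
  obtain b where b: "\<And>j. Qsize n (q j) \<le> b"
  proof -
    \<comment> \<open>The linear-minus-log bound is applied to 1 + \<open>Qsize\<close>; the extra
      \<open>c0\<close> pays for the 1.\<close>
    define B where "B = (M - \<kappa> - LO) / A + K1 + C + c0"
    have "1 + Qsize n (q j) \<le> 2 / c0 * (B - (K2 + K2 * ln (c0 / 2 / K2)))" for j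
    proof (rule linear_minus_log_bounded(1)[OF c0(1) K2])
      have "A * (t1 j + (moment_pairing n R (q j) - (\<Sum>k=0..n. u j k * c k))) \<le> M - \<kappa> - LO"
        using E_split[of j] LO[of j] lt2[of j] by linarith
      then have "t1 j + (moment_pairing n R (q j) - (\<Sum>k=0..n. u j k * c k)) \<le> (M - \<kappa> - LO) / A"
        using A by (simp add: pos_le_divide_eq mult.commute)
      then show "c0 * (1 + Qsize n (q j)) - K2 * ln (1 + Qsize n (q j)) \<le> B"
        using J_lb[of j] by (simp add: B_def distrib_left)
    qed (use Qsize_nonneg[of n "q j"] in linarith)
    then show thesis by (intro that[of "2 / c0 * (B - (K2 + K2 * ln (c0 / 2 / K2))) - 1"]) (simp add: le_diff_eq add.commute)
  qed
  have b0: "b \<ge> 0" using b[of 0] Qsize_nonneg[of n "q 0"] by linarith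
  define K where "K = K1 + K2 * ln (1 + b)"
  have t1K: "- K \<le> t1 j" for j using t1_lb[OF b, of j] by (simp add: K_def)
  have L0: "0 \<le> moment_pairing n R (q j)" for j
    using c0(2)[OF qpsd[of j]] mult_nonneg_nonneg[OF less_imp_le[OF c0(1)] Qsize_nonneg[of n "q j"]] by linarith
  define B1 where "B1 = A * (- K - C)"
  have AJ: "B1 \<le> A * (t1 j + (moment_pairing n R (q j) - (\<Sum>k=0..n. u j k * c k)))" for j
    unfolding B1_def using A t1K[of j] L0[of j] C[of j] by (intro mult_left_mono) linarith+
  have t2_ub: "t2 j \<le> (M - \<kappa> - LO - B1) / lam" for j
    using E_split[of j] AJ[of j] LO[of j] pos(2) by (simp add: pos_le_divide_eq mult.commute)
  define T1 where "T1 = (M - \<kappa> - LO) / A + C"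
  have t1_ub: "t1 j \<le> T1" for j
  proof -
    have "A * (t1 j + (moment_pairing n R (q j) - (\<Sum>k=0..n. u j k * c k))) \<le> M - \<kappa> - LO"
      using E_split[of j] LO[of j] lt2[of j] by linarith
    then have "t1 j + (moment_pairing n R (q j) - (\<Sum>k=0..n. u j k * c k)) \<le> (M - \<kappa> - LO) / A"
      using A by (simp add: pos_le_divide_eq mult.commute)
    then show ?thesis using L0[of j] C[of j] by (simp add: T1_def)
  qed
  \<comment> \<open>What the sublevel bound leaves for one pair when all other pairs are charged
    their lower bounds.\<close>
  define PB where "PB x y = (M - \<kappa> - B1) - (LO - lo x y)" for x y :: 'm
  have pt_ub: "pt j x y \<le> PB x y" if "y \<le> x" for j x y
  proof -
    have fin: "(x, y) \<in> {(x,y). y \<le> x}" using that by simp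
    have "(\<Sum>z\<in>{(x,y). y \<le> x} - {(x,y)}. lo (fst z) (snd z)) \<le> (\<Sum>z\<in>{(x,y). y \<le> x} - {(x,y)}. pt j (fst z) (snd z))"
      by (rule sum_mono) (use lo in auto)
    moreover have "LO = lo x y + (\<Sum>z\<in>{(x,y). y \<le> x} - {(x,y)}. lo (fst z) (snd z))"
      unfolding LO_def using sum.remove[OF _ fin, of "\<lambda>z. lo (fst z) (snd z)"] by (simp add: split_beta)
    moreover have "penalty n \<epsilon> (g j) (q j) = pt j x y + (\<Sum>z\<in>{(x,y). y \<le> x} - {(x,y)}. pt j (fst z) (snd z))"
      unfolding pen using sum.remove[OF _ fin, of "\<lambda>z. pt j (fst z) (snd z)"] by (simp add: split_beta)
    ultimately show ?thesis using E_split[of j] AJ[of j] lt2[of j] by (simp add: PB_def)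
  qed
  define gl gu where "gl x y = exp (- PB x y / dd x y)"
    and "gu x y = 2 / \<epsilon> * (PB x y - (dd x y + dd x y * ln (\<epsilon> / 2 / dd x y)))" for x y :: 'm
  have g_bd: "gl x y \<le> g j x y" "g j x y \<le> gu x y" if "y \<le> x" for j x y
    using linear_minus_log_bounded[OF pos(3) dd[of x y] g[OF that, of j], of "PB x y"]
      pt_ge[OF that, of j] pt_ub[OF that, of j] unfolding gl_def gu_def by auto

  \<comment> \<open>Feasibility says nothing about \<gamma> at pairs with x < y; setting them to 1
    keeps the whole matrix bounded.\<close>
  define G :: "nat \<Rightarrow> real^('m::{finite,linorder})^('m::{finite,linorder})"
    where "G j = (\<chi> x y. if y \<le> x then g j x y else 1)" for j
  \<comment> \<open>The k-independent data are repeated in every coordinate, so a single extraction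
    yields all limits; they are read off at k = 0.\<close>
  define W where "W j k = ((u j k, q j k), (t1 j, t2 j), G j)" for j k
  have bd: "bounded (range (\<lambda>j. W j k))" if "k < Suc n" for k
  proof -
    have "bounded (range (\<lambda>j. u j k))"
      using ppos_coeff_bound[OF u] by (auto simp: bounded_iff)
    moreover have "bounded (range (\<lambda>j. q j k))"
    proof -
      have "norm (q j k) \<le> b" for j
        using member_le_sum[of k "{..n}" "\<lambda>k. norm (q j k)"] that b[of j] by (simp add: Qsize_def)
      then show ?thesis by (auto simp: bounded_iff)
    qed
    moreover have "bounded (range t1)"
    proof -
      have "norm (t1 j) \<le> max K T1" for j using t1K[of j] t1_ub[of j] by simp
      then show ?thesis by (auto simp: bounded_iff)
    qed
    moreover have "bounded (range t2)"
      unfolding bounded_iff using t2_lb t2_ub by (intro exI[of _ "(M - \<kappa> - LO - B1) / lam"]) auto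
    moreover have "bounded (range G)"
    proof -
      have "norm (G j) \<le> (\<Sum>x\<in>UNIV. \<Sum>y\<in>UNIV. max 1 \<bar>gu x y\<bar>)" for j
      proof -
        have "norm (G j) \<le> (\<Sum>x\<in>UNIV. norm (G j $ x))"
          unfolding norm_vec_def by (rule L2_set_le_sum) simp
        also have "\<dots> \<le> (\<Sum>x\<in>UNIV. \<Sum>y\<in>UNIV. norm (G j $ x $ y))"
          unfolding norm_vec_def by (intro sum_mono L2_set_le_sum) simp
        also have "\<dots> \<le> (\<Sum>x\<in>UNIV. \<Sum>y\<in>UNIV. max 1 \<bar>gu x y\<bar>)"
        proof (intro sum_mono)
          fix x y show "norm (G j $ x $ y) \<le> max 1 \<bar>gu x y\<bar>"
          proof (cases "y \<le> x")
            case True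
            then show ?thesis using g_bd(2)[OF True, of j] g[OF True, of j] by (simp add: G_def)
          qed (simp add: G_def)
        qed
        finally show ?thesis .
      qed
      then show ?thesis by (auto simp: bounded_iff)
    qed
    ultimately have "bounded ((range (\<lambda>j. u j k) \<times> range (\<lambda>j. q j k)) \<times> (range t1 \<times> range t2) \<times> range G)"
      by (intro bounded_Times)
    then show ?thesis by (rule bounded_subset) (auto simp: W_def)
  qed
  obtain r :: "nat \<Rightarrow> nat" where r: "strict_mono r" "\<And>k. k < Suc n \<Longrightarrow> convergent (\<lambda>j. W (r j) k)"
    using bounded_convergent_subseq[of "Suc n" W] bd by blast
  have W: "(\<lambda>j. W (r j) k) \<longlonglongrightarrow> lim (\<lambda>j. W (r j) k)" if "k < Suc n" for k
    using r(2)[OF that] by (simp add: convergent_LIMSEQ_iff)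
  define p where "p k = lim (\<lambda>j. u (r j) k)" for k
  define Q where "Q k = lim (\<lambda>j. q (r j) k)" for k
  define \<tau>1 \<tau>2 where "\<tau>1 = lim (\<lambda>j. t1 (r j))" and "\<tau>2 = lim (\<lambda>j. t2 (r j))"
  define \<gamma> where "\<gamma> x y = lim (\<lambda>j. G (r j)) $ x $ y" for x y
  have pl: "(\<lambda>j. u (r j) k) \<longlonglongrightarrow> p k" for k
  proof (cases "k < Suc n")
    case True
    from tendsto_fst[OF tendsto_fst[OF W[OF this]]] show ?thesis
      unfolding p_def W_def by (simp add: convergent_LIMSEQ_iff[symmetric] convergentI)
  next
    case False
    then have "(\<lambda>j. u (r j) k) = (\<lambda>_. 0)" using u unfolding ppos_def by auto
    then show ?thesis by (simp add: p_def)
  qed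
  have Ql: "(\<lambda>j. q (r j) k) \<longlonglongrightarrow> Q k" for k
  proof (cases "k < Suc n")
    case True
    from tendsto_snd[OF tendsto_fst[OF W[OF this]]] show ?thesis
      unfolding Q_def W_def by (simp add: convergent_LIMSEQ_iff[symmetric] convergentI)
  next
    case False
    then have "(\<lambda>j. q (r j) k) = (\<lambda>_. 0)" using qpsd unfolding Qpsd_def by auto
    then show ?thesis by (simp add: Q_def)
  qed
  have W0: "(\<lambda>j. W (r j) 0) \<longlonglongrightarrow> lim (\<lambda>j. W (r j) 0)" by (rule W) simp
  have \<tau>1: "(\<lambda>j. t1 (r j)) \<longlonglongrightarrow> \<tau>1"
    using tendsto_fst[OF tendsto_fst[OF tendsto_snd[OF W0]]]
    unfolding \<tau>1_def W_def by (simp add: convergent_LIMSEQ_iff[symmetric] convergentI)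
  have \<tau>2: "(\<lambda>j. t2 (r j)) \<longlonglongrightarrow> \<tau>2"
    using tendsto_snd[OF tendsto_fst[OF tendsto_snd[OF W0]]]
    unfolding \<tau>2_def W_def by (simp add: convergent_LIMSEQ_iff[symmetric] convergentI)
  have Gl: "(\<lambda>j. G (r j)) \<longlonglongrightarrow> lim (\<lambda>j. G (r j))"
    using tendsto_snd[OF tendsto_snd[OF W0]]
    unfolding W_def by (simp add: convergent_LIMSEQ_iff[symmetric] convergentI)
  have gl: "(\<lambda>j. g (r j) x y) \<longlonglongrightarrow> \<gamma> x y" if "y \<le> x" for x y
  proof -
    have "(\<lambda>j. G (r j) $ x $ y) \<longlonglongrightarrow> \<gamma> x y" unfolding \<gamma>_def by (intro tendsto_intros Gl)
    then show ?thesis using that by (simp add: G_def)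
  qed
  \<comment> \<open>The lower bound \<open>gl\<close> is an exponential independent of the index, so
    strict positivity survives the limit.\<close>
  have \<gamma>: "\<gamma> x y > 0" if "y \<le> x" for x y
  proof -
    have "gl x y \<le> \<gamma> x y"
      by (rule LIMSEQ_le_const[OF gl[OF that]]) (use g_bd[OF that] in blast)
    then show ?thesis using exp_gt_zero[of "- PB x y / dd x y"] unfolding gl_def by linarith
  qed
  have p: "ppos n p" using u pl by (rule ppos_limit)
  have Q: "Qpsd n Q" using qpsd Ql by (rule Qpsd_limit)
  have p_AE: "AE \<theta> in circ. 0 < ppoly n p \<theta>"
  proof -
    have "AE \<theta> in circ. ppoly n p \<theta> \<noteq> 0" by (rule AE_ppoly_nonzero) (use p in \<open>simp add: ppos_def\<close>)
    then show ?thesis using AE_space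
      by eventually_elim (use p in \<open>auto simp: ppos_def less_le\<close>)
  qed
  have pd_AE: "AE \<theta> in circ. \<forall>j. herm_pd (Qpoly n (q (r j)) \<theta>)"
    using Bm_cl_AE_pd[OF q] by (simp add: AE_all_countable)
  have J_lbK: "AE \<theta> in circ. - K \<le> Jint n (u (r j)) (q (r j)) \<theta>" for j
    using AE_Jint_ge[OF q[of "r j"] u[of "r j"] b] by (simp add: K_def K1_def K2_def P_def algebra_simps)
  have J_meas: "Jint n (u (r j)) (q (r j)) \<in> borel_measurable circ" for j
    by (rule Jint_measurable[OF q[of "r j"] u[of "r j"]])
  \<comment> \<open>If the limit were identically singular the integrands would diverge almost
    everywhere, although their integrals stay below \<open>T1\<close>.\<close>
  have Qcl: "Bm_cl n Q"
  proof (rule ccontr)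
    assume "\<not> Bm_cl n Q"
    then have det0: "\<And>\<theta>. \<theta> \<in> {0..<2*pi} \<Longrightarrow> det (Qpoly n Q \<theta>) = 0" using Q unfolding Bm_cl_iff by blast
    have blow: "AE \<theta> in circ. filterlim (\<lambda>j. Jint n (u (r j)) (q (r j)) \<theta>) at_top sequentially"
      using p_AE pd_AE AE_space
    proof eventually_elim
      case (elim \<theta>)
      show ?case
        by (rule Jint_blowup[of "\<lambda>j. q (r j)" Q n \<theta> "\<lambda>j. u (r j)" p])
           (use elim det0 pl Ql u in \<open>auto simp: ppos_def\<close>)
    qed
    show False
      by (rule T_int_no_blowup[where f = "\<lambda>j. Jint n (u (r j)) (q (r j))", OF J_meas J_lbK _ blow, of T1])
         (simp add: t1 t1_ub)
  qed
  have J_lim: "T_int (Jint n p Q) \<le> ereal \<tau>1"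
  proof (rule T_int_fatou[where f = "\<lambda>j. Jint n (u (r j)) (q (r j))", OF J_meas J_lbK _ \<tau>1 Jint_measurable[OF Qcl p]])
    show "AE \<theta> in circ. (\<lambda>j. Jint n (u (r j)) (q (r j)) \<theta>) \<longlonglongrightarrow> Jint n p Q \<theta>"
      using p_AE pd_AE Bm_cl_AE_pd[OF Qcl] AE_space
    proof eventually_elim
      case (elim \<theta>)
      show ?case
        by (rule Jint_tendsto[of "\<lambda>j. q (r j)" Q n \<theta> "\<lambda>j. u (r j)" p])
           (use elim pl Ql u in \<open>auto simp: ppos_def\<close>)
    qed
  qed (simp add: t1)
  have inv_meas: "(\<lambda>\<theta>. inverse (ppoly n p' \<theta>)) \<in> borel_measurable circ" for p'
    using circ_measurable_continuous[OF continuous_ppoly, of n p'] by measurable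
  have inv_lim: "T_int (\<lambda>\<theta>. inverse (ppoly n p \<theta>)) \<le> ereal \<tau>2"
  proof (rule T_int_fatou[where f = "\<lambda>j \<theta>. inverse (ppoly n (u (r j)) \<theta>)", OF inv_meas AE_inverse_ppoly_nonneg[OF u] _ \<tau>2 inv_meas])
    show "AE \<theta> in circ. (\<lambda>j. inverse (ppoly n (u (r j)) \<theta>)) \<longlonglongrightarrow> inverse (ppoly n p \<theta>)"
      using p_AE by eventually_elim (auto intro!: tendsto_intros tendsto_ppoly pl)
  qed (simp add: t2)
  have pen_lim: "(\<lambda>j. penalty n \<epsilon> (g (r j)) (q (r j))) \<longlonglongrightarrow> penalty n \<epsilon> \<gamma> Q"
    unfolding penalty_def
  proof (rule tendsto_sum)
    fix z :: "'m \<times> 'm" assume z: "z \<in> {(x, y). y \<le> x}"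
    obtain x y where xy: "z = (x, y)" by (cases z)
    then have le: "y \<le> x" using z by simp
    have "\<gamma> x y \<noteq> 0" using \<gamma>[OF le] by simp
    then show "(\<lambda>j. case z of (x, y) \<Rightarrow> g (r j) x y * (qjh n (q (r j)) x y + \<epsilon>)
        - real (if y = x then n + 1 else 2 * n + 1) * ln (g (r j) x y))
      \<longlonglongrightarrow> (case z of (x, y) \<Rightarrow> \<gamma> x y * (qjh n Q x y + \<epsilon>)
        - real (if y = x then n + 1 else 2 * n + 1) * ln (\<gamma> x y))"
      unfolding xy prod.case by (intro tendsto_intros gl[OF le] tendsto_qjh Ql)
  qed
  have "(\<lambda>j. E (u (r j)) (q (r j)) (g (r j)) (t1 (r j)) (t2 (r j))) \<longlonglongrightarrow> E p Q \<gamma> \<tau>1 \<tau>2"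
    unfolding E_def ell_value_def
    by (intro tendsto_intros \<tau>1 \<tau>2 pen_lim tendsto_moment_pairing pl Ql)
  then have "(\<lambda>j. ell N \<kappa> lam \<epsilon> n R c (u (r j)) (q (r j)) \<alpha> (g (r j))) \<longlonglongrightarrow> ereal (E p Q \<gamma> \<tau>1 \<tau>2)"
    unfolding ellE by (simp add: lim_ereal)
  moreover have "(\<lambda>j. ell N \<kappa> lam \<epsilon> n R c (u (r j)) (q (r j)) \<alpha> (g (r j))) \<longlonglongrightarrow> I"
    using LIMSEQ_subseq_LIMSEQ[OF lim r(1)] by (simp add: o_def)
  ultimately have "I = ereal (E p Q \<gamma> \<tau>1 \<tau>2)" by (rule LIMSEQ_unique[rotated])
  moreover have "ell N \<kappa> lam \<epsilon> n R c p Q \<alpha> \<gamma> \<le> ereal (E p Q \<gamma> \<tau>1 \<tau>2)"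
    unfolding E_def A_def using ell_le_value[OF J_lim inv_lim pos(1)] pos(2) by simp
  moreover have "feasible n p Q \<gamma>" unfolding feasible_iff using p Qcl \<gamma> by blast
  ultimately show ?thesis by blast
qed

lemma ell_minimizer_exists:
  fixes R :: "nat \<Rightarrow> real^('m::{finite,linorder})^('m::{finite,linorder})"
  assumes pos: "\<alpha> > 0" "lam > 0" "\<epsilon> > 0" "N > 0"
    and c0: "c0 > 0" "\<And>Q. Qpsd n Q \<Longrightarrow> c0 * Qsize n Q \<le> moment_pairing n R Q"
  shows "\<exists>p Q \<gamma>. feasible n p Q \<gamma> \<and>
            (\<forall>p' Q' \<gamma>'. feasible n p' Q' \<gamma>' \<longrightarrow>
               ell N \<kappa> lam \<epsilon> n R c p Q \<alpha> \<gamma> \<le> ell N \<kappa> lam \<epsilon> n R c p' Q' \<alpha> \<gamma>')"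
proof -
  obtain p0 Q0 and \<gamma>0 :: "'m \<Rightarrow> 'm \<Rightarrow> real" and M where f0: "feasible n p0 Q0 \<gamma>0"
    and M: "ell N \<kappa> lam \<epsilon> n R c p0 Q0 \<alpha> \<gamma>0 \<le> ereal M"
    using feasible_finite_point[OF pos(1,2)] by blast
  \<comment> \<open>Restricting to values at most \<open>M\<close> puts the whole minimizing
    sequence into one sublevel set; feasible points with larger values cannot beat the
    infimum.\<close>
  define S where "S = {e. \<exists>p Q \<gamma>. feasible n p Q \<gamma> \<and> e = ell N \<kappa> lam \<epsilon> n R c p Q \<alpha> \<gamma> \<and> e \<le> ereal M}"
  have "S \<noteq> {}" using f0 M unfolding S_def by blast
  then obtain e where e: "\<And>j. e j \<in> S" "e \<longlonglongrightarrow> Inf S" using Inf_as_limit[of S] by blast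
  have "\<exists>p Q \<gamma>. feasible n p Q \<gamma> \<and> e j = ell N \<kappa> lam \<epsilon> n R c p Q \<alpha> \<gamma> \<and> e j \<le> ereal M" for j
    using e(1)[of j] unfolding S_def by blast
  then obtain u q g where f: "\<And>j. feasible n (u j) (q j) (g j)"
    and ej: "\<And>j. e j = ell N \<kappa> lam \<epsilon> n R c (u j) (q j) \<alpha> (g j)" and eM: "\<And>j. e j \<le> ereal M"
    by metis
  obtain p Q \<gamma> where m: "feasible n p Q \<gamma>" "ell N \<kappa> lam \<epsilon> n R c p Q \<alpha> \<gamma> \<le> Inf S"
    using ell_sublevel_limit[OF pos c0, of u q g \<kappa> c M "Inf S"] f e(2) eM unfolding ej by blast
  have "ell N \<kappa> lam \<epsilon> n R c p Q \<alpha> \<gamma> \<le> ell N \<kappa> lam \<epsilon> n R c p' Q' \<alpha> \<gamma>'" if "feasible n p' Q' \<gamma>'" for p' Q' \<gamma>'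
  proof (cases "ell N \<kappa> lam \<epsilon> n R c p' Q' \<alpha> \<gamma>' \<le> ereal M")
    case True
    then have "ell N \<kappa> lam \<epsilon> n R c p' Q' \<alpha> \<gamma>' \<in> S" using that unfolding S_def by blast
    then show ?thesis using m(2) Inf_lower order_trans by blast
  next
    case False
    have "Inf S \<le> e 0" using e(1) by (rule Inf_lower)
    then show ?thesis using m(2) eM[of 0] False by (meson le_cases order_trans)
  qed
  then show ?thesis using m(1) by blast
qed

section \<open>Interiority of the minimizers\<close>

text \<open>To the right of a zero \<open>\<theta>0\<close> the polynomial is at most L (x -
  \<theta>0), so for every s > 0 the integral of its inverse is at least ln ((e + s) / s) / L, which
  is unbounded as s tends to 0.\<close>

lemma ppos_inverse_integrable_imp_Bo:
  assumes p: "ppos n p" and int: "integrable circ (\<lambda>\<theta>. inverse (ppoly n p \<theta>))"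
  shows "Bo n p"
proof (rule ccontr)
  assume "\<not> Bo n p"
  then obtain \<theta>0 where \<theta>0: "\<theta>0 \<in> {0..<2*pi}" "ppoly n p \<theta>0 = 0"
    using p unfolding Bo_def ppos_def by (metis less_le)
  obtain L d where L: "L > 0" "d > 0"
    and lip: "\<And>y. \<bar>y - \<theta>0\<bar> < d \<Longrightarrow> cmod (complex_of_real (ppoly n p y) - complex_of_real (ppoly n p \<theta>0)) \<le> L * \<bar>y - \<theta>0\<bar>"
    using differentiable_locally_lipschitz[OF trigpoly_differentiable[OF trigpoly_ppoly]] by blast
  \<comment> \<open>The interval to the right stays within the Lipschitz radius and inside the
    half-open period, where there is always room on that side.\<close>
  define e where "e = min (d / 2) ((2 * pi - \<theta>0) / 2)"
  have e: "e > 0" "e < d" "\<theta>0 + e < 2 * pi" using L \<theta>0 by (auto simp: e_def min_def field_simps)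
  have pp: "AE \<theta> in circ. 0 < ppoly n p \<theta>"
  proof -
    have "AE \<theta> in circ. ppoly n p \<theta> \<noteq> 0" by (rule AE_ppoly_nonzero) (use p in \<open>simp add: ppos_def\<close>)
    then show ?thesis using AE_space
      by eventually_elim (use p in \<open>auto simp: ppos_def less_le\<close>)
  qed
  have "(1 / L) * ln ((e + s) / s) \<le> (\<integral>\<theta>. inverse (ppoly n p \<theta>) \<partial>circ)" if s: "s > 0" for s
  proof (rule set_integral_log_lower_bound[OF _ e(1) e(3) _ s int])
    show "AE x in circ. 0 \<le> inverse (ppoly n p x)"
      using pp by eventually_elim simp
    show "AE x in circ. x \<in> {\<theta>0..\<theta>0 + e} \<longrightarrow> 1 / L / (x - \<theta>0 + s) \<le> inverse (ppoly n p x)"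
      using pp
    proof eventually_elim
      case (elim x)
      show ?case
      proof
        assume x: "x \<in> {\<theta>0..\<theta>0 + e}"
        then have "cmod (complex_of_real (ppoly n p x)) \<le> L * \<bar>x - \<theta>0\<bar>" using lip[of x] e(2) \<theta>0 by auto
        then have "ppoly n p x \<le> L * (x - \<theta>0)" using x elim by simp
        also have "\<dots> \<le> L * (x - \<theta>0 + s)" using L s by (intro mult_left_mono) auto
        finally have "inverse (L * (x - \<theta>0 + s)) \<le> inverse (ppoly n p x)" using elim by (intro le_imp_inverse_le)
        then show "1 / L / (x - \<theta>0 + s) \<le> inverse (ppoly n p x)" by (simp add: divide_inverse)
      qed
    qed
  qed (use L \<theta>0 in auto)
  moreover obtain s where s: "s > 0" "L * (\<integral>\<theta>. inverse (ppoly n p \<theta>) \<partial>circ) < ln ((e + s) / s)"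
    using ln_ratio_unbounded[OF e(1)] by blast
  ultimately show False using L by (force simp: field_simps)
qed

section \<open>Raising one diagonal entry of the constant coefficient\<close>

lemma cquad_diag_unit:
  "cquad (\<chi> j k. complex_of_real ((t *\<^sub>R diag_unit i :: real^'m^'m) $ j $ k)) v
     = complex_of_real (t * (cmod (v $ i))\<^sup>2)"
proof -
  have "cnj (v $ j) * complex_of_real ((t *\<^sub>R diag_unit i :: real^'m^'m) $ j $ k) * v $ k
     = (if k = i then if j = i then cnj (v $ i) * complex_of_real t * v $ i else 0 else 0)" for j k
    by (simp add: diag_unit_def)
  then have "cquad (\<chi> j k. complex_of_real ((t *\<^sub>R diag_unit i :: real^'m^'m) $ j $ k)) v
     = cnj (v $ i) * complex_of_real t * v $ i"
    unfolding cquad_def by simp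
  also have "\<dots> = complex_of_real t * (cnj (v $ i) * v $ i)" by simp
  finally show ?thesis by (simp add: cnj_mult_self)
qed

lemma moment_pairing_add_const:
  "moment_pairing n R (Q(0 := Q 0 + D)) = moment_pairing n R Q + (\<Sum>i\<in>UNIV. \<Sum>j\<in>UNIV. D $ i $ j * R 0 $ i $ j)"
proof -
  have "(\<Sum>k=Suc 0..n. \<Sum>i\<in>UNIV. \<Sum>j\<in>UNIV. (Q(0 := Q 0 + D)) k $ i $ j * R k $ i $ j)
     = (\<Sum>k=Suc 0..n. \<Sum>i\<in>UNIV. \<Sum>j\<in>UNIV. Q k $ i $ j * R k $ i $ j)"
    by (rule sum.cong) auto
  then show ?thesis
    unfolding moment_pairing_eq
    by (simp add: sum.atLeast_Suc_atMost distrib_right sum.distrib del: fun_upd_apply)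
       (simp add: distrib_right sum.distrib)
qed

text \<open>The quadratic form can only grow, so semidefiniteness is kept and an angle where
  \<open>Q\<close> is nonsingular remains one.\<close>

lemma Bm_cl_add_diag_unit:
  fixes Q :: "nat \<Rightarrow> real^'m^'m"
  assumes Q: "Bm_cl n Q" and t: "t \<ge> 0"
  shows "Bm_cl n (Q(0 := Q 0 + t *\<^sub>R diag_unit i))"
proof -
  let ?Q = "Q(0 := Q 0 + t *\<^sub>R diag_unit i)"
  have Qp: "Qpsd n Q" using Q unfolding Bm_cl_iff by blast
  have sym: "transpose (?Q 0) = ?Q 0"
  proof -
    have "transpose (diag_unit i :: real^'m^'m) = diag_unit i"
      by (simp add: vec_eq_iff transpose_def diag_unit_def conj_commute)
    moreover have "transpose (Q 0 + t *\<^sub>R diag_unit i) = transpose (Q 0) + t *\<^sub>R transpose (diag_unit i)"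
      by (simp add: vec_eq_iff transpose_def)
    ultimately show ?thesis using Qp by (simp add: Qpsd_def)
  qed
  have quad: "Re (cquad (Qpoly n ?Q \<theta>) v) = Re (cquad (Qpoly n Q \<theta>) v) + t * (cmod (v $ i))\<^sup>2" for \<theta> v
    unfolding cquad_Qpoly_add_const cquad_diag_unit by simp
  have tn: "t * (cmod (v $ i))\<^sup>2 \<ge> 0" for v :: "complex^'m" using t by simp
  have "Qpsd n ?Q"
    unfolding Qpsd_def herm_psd_def
  proof (intro conjI ballI allI)
    show "hermitian (Qpoly n ?Q \<theta>)" for \<theta> by (rule Qpoly_hermitian[where Q = ?Q, OF sym])
    show "0 \<le> Re (cquad (Qpoly n ?Q \<theta>) v)" if "\<theta> \<in> {0..<2*pi}" for \<theta> v
      unfolding quad using Qp that by (intro add_nonneg_nonneg tn) (auto simp: Qpsd_def herm_psd_def)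
    show "k > n \<longrightarrow> ?Q k = 0" for k using Qp by (simp add: Qpsd_def)
  qed (rule sym)
  moreover obtain \<theta> where \<theta>: "\<theta> \<in> {0..<2*pi}" "det (Qpoly n Q \<theta>) \<noteq> 0" using Q unfolding Bm_cl_iff by blast
  have "herm_pd (Qpoly n Q \<theta>)"
    using \<theta> Qp by (intro psd_det_nonzero_imp_pd) (auto simp: Qpsd_def)
  then have "herm_pd (Qpoly n ?Q \<theta>)"
    unfolding herm_pd_def quad using Qpoly_hermitian[where Q = ?Q, OF sym] tn by (auto intro: add_pos_nonneg)
  then have "det (Qpoly n ?Q \<theta>) \<noteq> 0" by (rule pd_det_nonzero)
  ultimately show ?thesis unfolding Bm_cl_iff using \<theta> by blast
qed

text \<open>From ln (1 + z) >= z / (1 + z) at z = t w / q, which decreases in q, followed by q <= L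
  y. The left side has the shape c / (y + s) with c = s = t w / L that the logarithmic integral
  bound expects.\<close>

lemma one_sided_log_bound:
  assumes "t > 0" "L > 0" "w > 0" "y \<ge> 0" "0 < q" "q \<le> L * (y::real)"
  shows "t * (w / L) / (y + t * (w / L)) \<le> ln (1 + t * (w / q))"
proof -
  have "y \<noteq> 0" using assms(5,6) by auto
  then have y: "y > 0" using assms(4) by simp
  define z where "z = t * (w / q)"
  have z: "z > 0" using assms by (simp add: z_def)
  have "ln (1 / (1 + z)) \<le> 1 / (1 + z) - 1" using z by (intro ln_le_minus_one) auto
  then have 1: "z / (1 + z) \<le> ln (1 + z)" using z by (simp add: ln_div field_simps)
  have "z / (1 + z) = t * w / (q + t * w)" using assms by (simp add: z_def field_simps)
  moreover have "t * w / (L * y + t * w) \<le> t * w / (q + t * w)"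
    using assms y by (intro divide_left_mono mult_pos_pos add_pos_pos) auto
  moreover have "t * (w / L) / (y + t * (w / L)) = t * w / (L * y + t * w)"
    using assms by (simp add: field_simps)
  ultimately show ?thesis using 1 unfolding z_def[symmetric] by linarith
qed

text \<open>At a zero of a quadratic form of \<^term>\<open>Qpoly n Q\<close>, raising one diagonal entry of \<^term>\<open>Q 0\<close> by
  \<^term>\<open>t\<close> lowers the log-determinant term by more than any multiple of \<^term>\<open>t\<close>, while all other terms
  change by at most a multiple of \<^term>\<open>t\<close>.\<close>

lemma ell_minimizer_Bm:
  fixes R :: "nat \<Rightarrow> real^('m::{finite,linorder})^('m::{finite,linorder})"
    and Q :: "nat \<Rightarrow> real^('m::{finite,linorder})^('m::{finite,linorder})"
    and \<gamma> :: "'m \<Rightarrow> 'm \<Rightarrow> real"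
  assumes pos: "\<alpha> > 0" "lam > 0" "N > 0"
    and Bo: "Bo n p" and feas: "feasible n p Q \<gamma>"
    and min: "\<And>Q'. feasible n p Q' \<gamma> \<Longrightarrow> ell N \<kappa> lam \<epsilon> n R c p Q \<alpha> \<gamma> \<le> ell N \<kappa> lam \<epsilon> n R c p Q' \<alpha> \<gamma>"
    and fin: "ell N \<kappa> lam \<epsilon> n R c p Q \<alpha> \<gamma> \<le> ereal M"
  shows "Bm n Q"
proof (rule ccontr)
  assume notBm: "\<not> Bm n Q"
  have p: "ppos n p" and Qcl: "Bm_cl n Q" and g: "\<And>j h. h \<le> j \<Longrightarrow> \<gamma> j h > 0"
    using feas unfolding feasible_iff by auto
  have Qp: "Qpsd n Q" using Qcl unfolding Bm_cl_iff by blast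
  obtain \<theta>0 v where \<theta>0: "\<theta>0 \<in> {0..<2*pi}" and v: "v \<noteq> 0" "Re (cquad (Qpoly n Q \<theta>0) v) = 0"
    using notBm Qp unfolding Bm_def Qpsd_def herm_pd_def herm_psd_def by (metis less_le)
  obtain i where i: "v $ i \<noteq> 0" using v(1) by (auto simp: vec_eq_iff)
  define w where "w = (cmod (v $ i))\<^sup>2"
  have w: "w > 0" using i by (simp add: w_def)
  define A where "A = real N / (2*\<alpha>)"
  have A: "A > 0" using pos by (simp add: A_def)
  obtain t1 t2 where t1: "T_int (Jint n p Q) = ereal t1" and t2: "T_int (\<lambda>\<theta>. inverse (ppoly n p \<theta>)) = ereal t2"
    and ellQ: "ell N \<kappa> lam \<epsilon> n R c p Q \<alpha> \<gamma> = ereal (ell_value A \<kappa> lam \<epsilon> n R c p Q \<gamma> t1 t2)"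
    unfolding A_def by (rule ell_finite[OF fin pos])
  have intJ: "integrable circ (Jint n p Q)" and t1_eq: "t1 = (\<integral>\<theta>. Jint n p Q \<theta> \<partial>circ) / (2*pi)"
    using t1 unfolding T_int_circ by (auto split: if_splits)
  define Qt where "Qt t = Q(0 := Q 0 + t *\<^sub>R diag_unit i)" for t
  \<comment> \<open>The pointwise decrease of the entropy integrand; its integral is bounded above
    by minimality and below by the singularity at \<open>\<theta>0\<close>.\<close>
  define f where "f t \<theta> = Jint n p Q \<theta> - Jint n p (Qt t) \<theta>" for t \<theta>
  have Qt: "Bm_cl n (Qt t)" if "t \<ge> 0" for t
    unfolding Qt_def by (rule Bm_cl_add_diag_unit[OF Qcl that])
  have Qt_det: "Re (det (Qpoly n Q \<theta>)) * (1 + t * ((cmod (x $ i))\<^sup>2 / Re (cquad (Qpoly n Q \<theta>) x)))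
      \<le> Re (det (Qpoly n (Qt t) \<theta>))" if "herm_pd (Qpoly n Q \<theta>)" "t \<ge> 0" "x \<noteq> 0" for t \<theta> x
  proof -
    have "Qpoly n (Qt t) \<theta> = (\<chi> j k. Qpoly n Q \<theta> $ j $ k + complex_of_real t * diag_unit i $ j $ k)"
      unfolding Qt_def Qpoly_add_const by (simp add: vec_eq_iff diag_unit_def)
    then show ?thesis using pd_det_add_diag_unit_ge[OF that(1) that(3) that(2)] by simp
  qed
  have f_ge: "AE \<theta> in circ. ppoly n p \<theta> * ln (1 + t * (w / Re (cquad (Qpoly n Q \<theta>) v))) \<le> f t \<theta> \<and> 0 \<le> f t \<theta>
      \<and> 0 < Re (cquad (Qpoly n Q \<theta>) v)"
    if t: "t \<ge> 0" for t
    using Bm_cl_AE_pd[OF Qcl] Bm_cl_AE_pd[OF Qt[OF t]] AE_space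
  proof eventually_elim
    case (elim \<theta>)
    have p0: "0 \<le> ppoly n p \<theta>" using p elim(3) by (auto simp: ppos_def)
    let ?z = "1 + t * (w / Re (cquad (Qpoly n Q \<theta>) v))"
    have q: "0 < Re (cquad (Qpoly n Q \<theta>) v)" using elim(1) v(1) unfolding herm_pd_def by blast
    then have z: "1 \<le> ?z" using t w by simp
    have d: "0 < Re (det (Qpoly n Q \<theta>))" by (rule pd_det_pos[OF elim(1)])
    have "ln (Re (det (Qpoly n Q \<theta>))) + ln ?z = ln (Re (det (Qpoly n Q \<theta>)) * ?z)"
      using d z by (intro ln_mult_pos[symmetric]) auto
    also have "\<dots> \<le> ln (Re (det (Qpoly n (Qt t) \<theta>)))"
      using Qt_det[OF elim(1) t v(1)] d z by (intro ln_mono) (auto simp: w_def intro: mult_pos_pos)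
    finally have "ppoly n p \<theta> * ln ?z \<le> ppoly n p \<theta> * (ln (Re (det (Qpoly n (Qt t) \<theta>))) - ln (Re (det (Qpoly n Q \<theta>))))"
      using p0 by (intro mult_left_mono) auto
    then have "ppoly n p \<theta> * ln ?z \<le> f t \<theta>"
      unfolding f_def Jint_eq[OF elim(1) p0] Jint_eq[OF elim(2) p0] by (simp add: right_diff_distrib)
    moreover have "0 \<le> ppoly n p \<theta> * ln ?z" using p0 z by (intro mult_nonneg_nonneg) auto
    ultimately show ?case using q by linarith
  qed
  \<comment> \<open>Nonnegativity of \<open>f t\<close> puts the perturbed integrand below the
    integrable original one; a constant bounds it from below.\<close>
  have intJt: "integrable circ (Jint n p (Qt t))" if t: "t \<ge> 0" for t
  proof -
    obtain K where lb: "AE \<theta> in circ. - K \<le> Jint n p (Qt t) \<theta>"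
      using AE_Jint_ge[OF Qt[OF t] p order_refl] by blast
    show ?thesis
    proof (rule Bochner_Integration.integrable_bound)
      show "integrable circ (\<lambda>\<theta>. \<bar>K\<bar> + \<bar>Jint n p Q \<theta>\<bar>)" using intJ by auto
      show "Jint n p (Qt t) \<in> borel_measurable circ" by (rule Jint_measurable[OF Qt[OF t] p])
      show "AE \<theta> in circ. norm (Jint n p (Qt t) \<theta>) \<le> norm (\<bar>K\<bar> + \<bar>Jint n p Q \<theta>\<bar>)"
        using lb f_ge[OF t] by eventually_elim (auto simp: f_def)
    qed
  qed
  \<comment> \<open>\<open>D\<close> is the slope of the moment pairing along the perturbation;
    \<open>S\<close> bounds that of the penalty, because each \<open>qjh\<close> grows by at most
    t.\<close>
  define D where "D = (\<Sum>j\<in>UNIV. \<Sum>k\<in>UNIV. (diag_unit i :: real^('m::{finite,linorder})^('m::{finite,linorder})) $ j $ k * R 0 $ j $ k)"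
  define S where "S = (\<Sum>(j,h)\<in>{(j,h). h \<le> j}. \<gamma> j h)"
  \<comment> \<open>Minimality: the entropy saved cannot exceed the linear cost. Dividing by the
    weight \<open>A\<close> gives S / A, and 2 pi undoes the normalization of the integral.\<close>
  have f_int: "(\<integral>\<theta>. f t \<theta> \<partial>circ) \<le> t * (2 * pi * (D + S / A))" if t: "t > 0" for t
  proof -
    have t0: "t \<ge> 0" using t by simp
    define u1 where "u1 = (\<integral>\<theta>. Jint n p (Qt t) \<theta> \<partial>circ) / (2*pi)"
    have u1: "T_int (Jint n p (Qt t)) \<le> ereal u1" unfolding T_int_circ u1_def using intJt[OF t0] by simp
    have "feasible n p (Qt t) \<gamma>" unfolding feasible_iff using p Qt[OF t0] g by blast
    then have "ell N \<kappa> lam \<epsilon> n R c p Q \<alpha> \<gamma> \<le> ell N \<kappa> lam \<epsilon> n R c p (Qt t) \<alpha> \<gamma>" by (rule min)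
    also have "\<dots> \<le> ereal (ell_value A \<kappa> lam \<epsilon> n R c p (Qt t) \<gamma> u1 t2)"
      unfolding A_def using pos by (intro ell_le_value u1) (auto simp: t2)
    finally have le: "ell_value A \<kappa> lam \<epsilon> n R c p Q \<gamma> t1 t2 \<le> ell_value A \<kappa> lam \<epsilon> n R c p (Qt t) \<gamma> u1 t2"
      unfolding ellQ by simp
    have mp: "moment_pairing n R (Qt t) = moment_pairing n R Q + t * D"
      unfolding Qt_def moment_pairing_add_const D_def by (simp add: sum_distrib_left mult.assoc)
    have pen: "penalty n \<epsilon> \<gamma> (Qt t) \<le> penalty n \<epsilon> \<gamma> Q + t * S"
    proof -
      have "qjh n (Qt t) j h \<le> qjh n Q j h + t" for j h
        by (rule qjh_perturb_le) (use t in \<open>auto simp: Qt_def diag_unit_def intro: order_trans[OF abs_triangle_ineq]\<close>)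
      then have "penalty n \<epsilon> \<gamma> (Qt t) \<le> (\<Sum>(j,h)\<in>{(j,h). h \<le> j}. (\<gamma> j h * (qjh n Q j h + \<epsilon>)
          - real (if h = j then n + 1 else 2 * n + 1) * ln (\<gamma> j h)) + t * \<gamma> j h)"
        unfolding penalty_def
      proof (intro sum_mono)
        fix z :: "'m \<times> 'm" assume z: "z \<in> {(j, h). h \<le> j}" and q: "\<And>j h. qjh n (Qt t) j h \<le> qjh n Q j h + t"
        obtain j h where jh: "z = (j, h)" by (cases z)
        have "\<gamma> j h * qjh n (Qt t) j h \<le> \<gamma> j h * (qjh n Q j h + t)"
          using q[of j h] g[of h j] z jh by (intro mult_left_mono) auto
        then show "(case z of (j, h) \<Rightarrow> \<gamma> j h * (qjh n (Qt t) j h + \<epsilon>)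
            - real (if h = j then n + 1 else 2 * n + 1) * ln (\<gamma> j h))
          \<le> (case z of (j, h) \<Rightarrow> (\<gamma> j h * (qjh n Q j h + \<epsilon>)
            - real (if h = j then n + 1 else 2 * n + 1) * ln (\<gamma> j h)) + t * \<gamma> j h)"
          unfolding jh prod.case by (simp add: algebra_simps)
      qed
      also have "\<dots> = penalty n \<epsilon> \<gamma> Q + t * S"
        unfolding penalty_def S_def sum_distrib_left sum.distrib[symmetric]
        by (rule sum.cong) auto
      finally show ?thesis .
    qed
    have "A * t1 \<le> A * (u1 + t * D) + t * S"
      using le pen unfolding ell_value_def mp by (simp add: algebra_simps)
    then have "A * (t1 - u1) \<le> A * (t * (D + S / A))" using A by (simp add: algebra_simps)
    then have "t1 - u1 \<le> t * (D + S / A)" using A by (simp only: mult_le_cancel_left_pos)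
    moreover have "(\<integral>\<theta>. f t \<theta> \<partial>circ) = 2 * pi * (t1 - u1)"
      unfolding f_def t1_eq u1_def using intJ intJt[OF t0] by (simp add: field_simps)
    ultimately show ?thesis by (simp add: mult.left_commute)
  qed
  obtain L d where L: "L > 0" "d > 0"
    and lip: "\<And>y. \<bar>y - \<theta>0\<bar> < d \<Longrightarrow> cmod (cquad (Qpoly n Q y) v - cquad (Qpoly n Q \<theta>0) v) \<le> L * \<bar>y - \<theta>0\<bar>"
    using differentiable_locally_lipschitz[OF trigpoly_differentiable[OF trigpoly_cquad_Qpoly]] by blast
  \<comment> \<open>Positivity of \<open>p\<close> at \<open>\<theta>0\<close> enters here: the
    weight stays above \<open>m\<close> near the singular angle.\<close>
  define m where "m = ppoly n p \<theta>0 / 2"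
  have m: "m > 0" using Bo \<theta>0 by (simp add: m_def Bo_def)
  obtain d' where d': "d' > 0" "\<And>y. \<bar>y - \<theta>0\<bar> < d' \<Longrightarrow> m \<le> ppoly n p y"
  proof -
    have "isCont (ppoly n p) \<theta>0" using continuous_ppoly[of UNIV n p] by (simp add: continuous_on_eq_continuous_at)
    then obtain d' where "d' > 0" "\<And>y. \<bar>y - \<theta>0\<bar> < d' \<Longrightarrow> \<bar>ppoly n p y - ppoly n p \<theta>0\<bar> < m"
      using m unfolding continuous_at_eps_delta by (auto simp: dist_real_def)
    moreover have "ppoly n p \<theta>0 = 2 * m" by (simp add: m_def)
    ultimately show thesis by (intro that[of d']) (smt (verit))+
  qed
  define e where "e = min (min (d / 2) (d' / 2)) ((2 * pi - \<theta>0) / 2)"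
  have e: "e > 0" "e < d" "e < d'" "\<theta>0 + e < 2 * pi"
    using L d' \<theta>0 by (auto simp: e_def min_def field_simps)
  \<comment> \<open>For small t this gain is of order t ln (1/t), which exceeds every multiple of
    t.\<close>
  have lower: "m * (t * (w / L)) * ln ((e + t * (w / L)) / (t * (w / L))) \<le> (\<integral>\<theta>. f t \<theta> \<partial>circ)" if t: "t > 0" for t
  proof (rule set_integral_log_lower_bound[OF _ e(1) e(4)])
    show "integrable circ (f t)" unfolding f_def using intJ intJt[of t] t by auto
    show "AE x in circ. 0 \<le> f t x" using f_ge[of t] t by (auto elim: eventually_mono)
    show "AE x in circ. x \<in> {\<theta>0..\<theta>0 + e} \<longrightarrow> m * (t * (w / L)) / (x - \<theta>0 + t * (w / L)) \<le> f t x"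
      using f_ge[OF less_imp_le[OF t]]
    proof eventually_elim
      case (elim x)
      show ?case
      proof
        assume x: "x \<in> {\<theta>0..\<theta>0 + e}"
        let ?q = "Re (cquad (Qpoly n Q x) v)"
        have "?q \<le> cmod (cquad (Qpoly n Q x) v - cquad (Qpoly n Q \<theta>0) v)"
          using complex_Re_le_cmod[of "cquad (Qpoly n Q x) v - cquad (Qpoly n Q \<theta>0) v"] v(2) by simp
        also have "\<dots> \<le> L * (x - \<theta>0)" using lip[of x] x e(2) by simp
        finally have "t * (w / L) / (x - \<theta>0 + t * (w / L)) \<le> ln (1 + t * (w / ?q))"
          using x elim t L w by (intro one_sided_log_bound) auto
        moreover have "0 \<le> t * (w / L) / (x - \<theta>0 + t * (w / L))" using x t w L by simp
        moreover have "m \<le> ppoly n p x" using d'(2)[of x] x e(3) by simp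
        ultimately have "m * (t * (w / L) / (x - \<theta>0 + t * (w / L))) \<le> ppoly n p x * ln (1 + t * (w / ?q))"
          using m by (intro mult_mono) auto
        then show "m * (t * (w / L)) / (x - \<theta>0 + t * (w / L)) \<le> f t x" using elim by simp
      qed
    qed
  qed (use \<theta>0 m t w L in auto)
  obtain s where s: "s > 0" "2 * pi * (D + S / A) / (m * (w / L)) < ln ((e + s) / s)"
    using ln_ratio_unbounded[OF e(1)] by blast
  \<comment> \<open>Makes the shift in the lower bound equal to the \<open>s\<close> for which the
    logarithm exceeds the ratio of the two slopes.\<close>
  define t where "t = s / (w / L)"
  have t: "t > 0" "t * (w / L) = s" using s w L by (simp_all add: t_def)
  have "m * s * ln ((e + s) / s) \<le> t * (2 * pi * (D + S / A))"
    using order_trans[OF lower[OF t(1)] f_int[OF t(1)]] unfolding t(2) .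
  moreover have "t * (2 * pi * (D + S / A)) = m * s * (2 * pi * (D + S / A) / (m * (w / L)))"
    using m w L s by (simp add: t_def)
  ultimately have "ln ((e + s) / s) \<le> 2 * pi * (D + S / A) / (m * (w / L))"
    using m s(1) mult_pos_pos[OF m s(1)] by (simp only: mult_le_cancel_left_pos)
  then show False using s(2) by simp
qed

theorem theorem2:
  fixes R :: "nat \<Rightarrow> real^('m::{finite,linorder})^('m::{finite,linorder})" and c :: "nat \<Rightarrow> real"
    and n N :: nat and \<alpha> lam \<epsilon> \<kappa> :: real
    and \<Phi> :: "real \<Rightarrow> complex^('m::{finite,linorder})^('m::{finite,linorder})"
  assumes n_pos: "n \<ge> 1" and N_pos: "N > 0"
    and alpha_pos: "\<alpha> > 0" and lam_pos: "lam > 0" and eps_pos: "\<epsilon> > 0"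
    and R0_sym: "transpose (R 0) = R 0"
    and Phi_int: "set_integrable lborel {0..<2*pi} \<Phi>"
    and Phi_psd: "\<forall>\<theta>\<in>{0..<2*pi}. herm_psd (\<Phi> \<theta>)"
    and Phi_pd: "\<exists>a b. 0 \<le> a \<and> a < b \<and> b \<le> 2*pi \<and> (\<forall>\<theta>\<in>{a<..<b}. herm_pd (\<Phi> \<theta>))"
    and Phi_mom: "\<forall>k\<le>n. (LINT \<theta>:{0..<2*pi}|lborel.
                     (\<chi> i j. cis (\<theta> * real k) * \<Phi> \<theta> $ i $ j) /\<^sub>R (2*pi))
                  = (\<chi> i j. complex_of_real (R k $ i $ j))"
  shows "(\<exists>p Q \<gamma>. feasible n p Q \<gamma> \<and>
            (\<forall>p' Q' \<gamma>'. feasible n p' Q' \<gamma>' \<longrightarrow>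
               ell N \<kappa> lam \<epsilon> n R c p Q \<alpha> \<gamma> \<le> ell N \<kappa> lam \<epsilon> n R c p' Q' \<alpha> \<gamma>'))
       \<and> (\<forall>p Q \<gamma>. feasible n p Q \<gamma> \<and>
            (\<forall>p' Q' \<gamma>'. feasible n p' Q' \<gamma>' \<longrightarrow>
               ell N \<kappa> lam \<epsilon> n R c p Q \<alpha> \<gamma> \<le> ell N \<kappa> lam \<epsilon> n R c p' Q' \<alpha> \<gamma>')
            \<longrightarrow> Bo n p \<and> Bm n Q)"
proof (intro conjI allI impI)
  obtain a b where ab: "0 \<le> a" "a < b" "b \<le> 2*pi" and pd: "\<And>\<theta>. \<theta> \<in> {a<..<b} \<Longrightarrow> herm_pd (\<Phi> \<theta>)"
    using Phi_pd by blast
  obtain c0 where c0: "c0 > 0" "\<And>Q. Qpsd n Q \<Longrightarrow> c0 * Qsize n Q \<le> moment_pairing n R Q"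
    using moment_pairing_coercive[of \<Phi> n R a b, OF _ _ _ ab pd] Phi_int Phi_psd Phi_mom
    unfolding set_integrable_circ set_integral_circ by blast
  show "\<exists>p Q \<gamma>. feasible n p Q \<gamma> \<and>
            (\<forall>p' Q' \<gamma>'. feasible n p' Q' \<gamma>' \<longrightarrow>
               ell N \<kappa> lam \<epsilon> n R c p Q \<alpha> \<gamma> \<le> ell N \<kappa> lam \<epsilon> n R c p' Q' \<alpha> \<gamma>')"
    by (rule ell_minimizer_exists[OF alpha_pos lam_pos eps_pos N_pos c0])
next
  fix p Q and \<gamma> :: "'m \<Rightarrow> 'm \<Rightarrow> real"
  assume min: "feasible n p Q \<gamma> \<and>
            (\<forall>p' Q' \<gamma>'. feasible n p' Q' \<gamma>' \<longrightarrow>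
               ell N \<kappa> lam \<epsilon> n R c p Q \<alpha> \<gamma> \<le> ell N \<kappa> lam \<epsilon> n R c p' Q' \<alpha> \<gamma>')"
  obtain p0 Q0 and \<gamma>0 :: "'m \<Rightarrow> 'm \<Rightarrow> real" and M where f0: "feasible n p0 Q0 \<gamma>0"
    and M: "ell N \<kappa> lam \<epsilon> n R c p0 Q0 \<alpha> \<gamma>0 \<le> ereal M"
    using feasible_finite_point[OF alpha_pos lam_pos] by blast
  \<comment> \<open>A minimizer is no worse than the explicit feasible point, so its value, and with
    it each of the two integrals, is finite.\<close>
  have fin: "ell N \<kappa> lam \<epsilon> n R c p Q \<alpha> \<gamma> \<le> ereal M" using min f0 M order_trans by blast
  have p: "ppos n p" using min unfolding feasible_iff by blast
  obtain t2 where "T_int (\<lambda>\<theta>. inverse (ppoly n p \<theta>)) = ereal t2"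
    by (rule ell_finite[OF fin alpha_pos lam_pos N_pos])
  then have "integrable circ (\<lambda>\<theta>. inverse (ppoly n p \<theta>))"
    by (intro T_int_le_ereal(1)[of _ t2]) simp
  then show Bo: "Bo n p" by (rule ppos_inverse_integrable_imp_Bo[OF p])
  show "Bm n Q"
    by (rule ell_minimizer_Bm[OF alpha_pos lam_pos N_pos Bo _ _ fin]) (use min in blast)+
qed

end
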